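(* Let $d\ge 2$, $\Omega=\{0,1\}^{\mathbb{Z}^d}$. Let $\mathbb{P}$ be a nonuniformly exponentially $\varphi$-mixing Gibbs measure on $\Omega$ and let $\mathbb{Q}$ be a stationary and ergodic Gibbs measure on $\Omega$. Assume that the rate distortion function $\mathcal{R}(\varepsilon)=\mathcal{R}(\mathbb{Q},\mathbb{P},\varepsilon)$ is strictly positive on $[0,\varepsilon_0)$. Then for all $\alpha\in(0,1)$ and $\varepsilon>0$ small enough, namely with $\varepsilon/\alpha<\varepsilon_0$, there exist constants $\Lambda_1,\Lambda_2,C,c,K\in(0,\infty)$ and, for each $n$-pattern $A_n$, a number $\Lambda_n=\Lambda(A_n)$ with $\Lambda_1\le \Lambda_n\le\Lambda_2$, such that for every $t>0$, every $n\ge 1$, and $\mathbb{Q}$-almost every $\omega$ with $\omega_{C_n}\in\mathcal{G}_n(\varepsilon,\alpha)$, $$\left|\mathbb{P}\left(\mathbf{T}_{[\omega_{C_n}]^\varepsilon}>\frac{t}{\Lambda_n\,\mathbb{P}([\omega_{C_n}]^\varepsilon)}\right)-e^{-t}\right|\le C e^{-ct}e^{-Kn^d},$$ where $\Lambda_n=\Lambda(\omega_{C_n})$.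
   Context: Configurations $\sigma,\eta,\omega\in\Omega=\{0,1\}^{\mathbb{Z}^d}$; for $V\subseteq\mathbb{Z}^d$, $\mathcal{F}_V$ is the $\sigma$-algebra generated by $\{\sigma_x:x\in V\}$. For finite $V$, $\Delta(V,\eta,\sigma)=\sum_{x\in V}|\eta_x-\sigma_x|$ (Hamming distance on $V$). $C_n=[0,n]^d\cap\mathbb{Z}^d$. An $n$-pattern is a map $A_n:C_n\to\{0,1\}$; $[A_n]=\{\sigma:\sigma_{C_n}=A_n\}$ and $[A_n]^\varepsilon=\{\omega\in\Omega:\Delta(C_n,\omega,A_n)\le\varepsilon|C_n|\}$. For $x\in\mathbb{Z}^d$, $\theta_x[A_n]^\varepsilon$ denotes the translate of this event by $x$, i.e. the set of $\omega$ whose restriction to $C_n+x$, translated back to $C_n$, lies within Hamming distance $\varepsilon|C_n|$ of $A_n$. Approximate hitting time: $\mathbf{T}_{[A_n]^\varepsilon}(\sigma)=\min\{|C_k|:k>0,\ \exists x\in\mathbb{Z}^d \text{ with } C_n+x\subseteq C_k \text{ such that the restriction of }\sigma\text{ to }C_n+x,\text{ translated to }C_n,\text{ lies in }[A_n]^\varepsilon\}$. Good patterns: for $0<\alpha<1$, $0\le\varepsilon<1$, an $n$-pattern $A_n$ is $(\varepsilon,\alpha)$-good if $[A_n]^\varepsilon\cap\theta_x[A_n]^\varepsilon=\emptyset$ for all $x\in\mathbb{Z}^d$ with $0<|x|\le\alpha n$ ($|\cdot|$ the sup-norm); $\mathcal{G}_n(\varepsilon,\alpha)$ is the set of such patterns.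 Mixing: for $m>0$, $\varphi(m)=\sup\frac{1}{|A_1|}|\mathbb{P}(E_{A_1}\mid E_{A_2})-\mathbb{P}(E_{A_1})|$, the supremum over finite $A_1,A_2\subset\mathbb{Z}^d$ with $d(A_1,A_2)\ge m$ (sup-norm distance) and $E_{A_i}\in\mathcal{F}_{A_i}$ with $\mathbb{P}(E_{A_2})>0$; $\mathbb{P}$ is nonuniformly exponentially $\varphi$-mixing if $\varphi(m)\le C_1e^{-C_2m}$ for all $m>0$, some $C_1,C_2>0$. Rate distortion function: $\mathcal{R}(\mathbb{Q},\mathbb{P},\varepsilon)=\lim_n \mathcal{R}_n$, where $\mathcal{R}_n=\inf_{\mathbb{J}_n}\frac{1}{|C_n|}H(\mathbb{J}_n\|\mathbb{Q}_n\times\mathbb{P}_n)$, the infimum over joint distributions $\mathbb{J}_n$ on $\{0,1\}^{C_n}\times\{0,1\}^{C_n}$ whose first marginal is $\mathbb{Q}_n$ (the $C_n$-marginal of $\mathbb{Q}$) and with $\int\frac{\Delta(C_n,\omega,\sigma)}{|C_n|}d\mathbb{J}_n(\omega,\sigma)\le\varepsilon$; $H$ is relative entropy and $\mathbb{P}_n$ the $C_n$-marginal of $\mathbb{P}$. *)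

theory Defs
  imports "HOL-Probability.Probability"
begin

text \<open>Sites of the lattice Z^d are functions 'd => int for a finite index type 'd
  (so d = CARD('d)); spin values {0,1} are represented by bool (True = 1).\<close>

type_synonym 'd site = "'d \<Rightarrow> int"
type_synonym 'd config = "'d site \<Rightarrow> bool"

definition vadd :: "'d site \<Rightarrow> 'd site \<Rightarrow> 'd site" where
  "vadd x y = (\<lambda>i. x i + y i)"

definition vsub :: "'d site \<Rightarrow> 'd site \<Rightarrow> 'd site" where
  "vsub x y = (\<lambda>i. x i - y i)"

definition supnorm :: "('d::finite) site \<Rightarrow> int" where
  "supnorm x = Max (range (\<lambda>i. \<bar>x i\<bar>))"

definition config_space :: "'d config measure" where
  "config_space = PiM UNIV (\<lambda>_. count_space UNIV)"

definition shift :: "'d site \<Rightarrow> 'd config \<Rightarrow> 'd config" where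
  "shift x \<sigma> = (\<lambda>y. \<sigma> (vadd y x))"

definition translate :: "'d site set \<Rightarrow> 'd site \<Rightarrow> 'd site set" where
  "translate A x = (\<lambda>y. vadd y x) ` A"

definition cube :: "nat \<Rightarrow> 'd site set" where
  "cube n = {x. \<forall>i. 0 \<le> x i \<and> x i \<le> int n}"

definition Delta :: "'d site set \<Rightarrow> 'd config \<Rightarrow> 'd config \<Rightarrow> real" where
  "Delta V \<eta> \<sigma> = (\<Sum>x\<in>V. \<bar>of_bool (\<eta> x) - of_bool (\<sigma> x)\<bar>)"

text \<open>n-patterns: maps C_n -> {0,1}, represented as configurations that are False off C_n\<close>
definition pats :: "nat \<Rightarrow> 'd config set" where
  "pats n = {A. \<forall>x. x \<notin> cube n \<longrightarrow> A x = False}"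

definition pat_of :: "nat \<Rightarrow> 'd config \<Rightarrow> 'd config" where
  "pat_of n \<omega> = (\<lambda>x. if x \<in> cube n then \<omega> x else False)"

definition approx_ball :: "nat \<Rightarrow> real \<Rightarrow> 'd config \<Rightarrow> 'd config set" where
  "approx_ball n \<epsilon> A = {\<omega>. Delta (cube n) \<omega> A \<le> \<epsilon> * real (card (cube n :: 'd site set))}"

definition shifted_ball :: "'d site \<Rightarrow> nat \<Rightarrow> real \<Rightarrow> 'd config \<Rightarrow> 'd config set" where
  "shifted_ball x n \<epsilon> A = {\<omega>. shift x \<omega> \<in> approx_ball n \<epsilon> A}"

definition good :: "nat \<Rightarrow> real \<Rightarrow> real \<Rightarrow> ('d::finite) config \<Rightarrow> bool" where
  "good n \<epsilon> \<alpha> A \<longleftrightarrow> A \<in> pats n \<and>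
     (\<forall>x. 0 < supnorm x \<and> real_of_int (supnorm x) \<le> \<alpha> * real n \<longrightarrow>
        approx_ball n \<epsilon> A \<inter> shifted_ball x n \<epsilon> A = {})"

text \<open>approximate hitting time (infinity if [A_n]^eps is never hit)\<close>
definition hit_time :: "nat \<Rightarrow> real \<Rightarrow> 'd config \<Rightarrow> 'd config \<Rightarrow> enat" where
  "hit_time n \<epsilon> A \<sigma> = Inf {enat (card (cube k :: 'd site set)) | k. k > 0 \<and>
      (\<exists>x. translate (cube n) x \<subseteq> cube k \<and> \<sigma> \<in> shifted_ball x n \<epsilon> A)}"

definition local_event :: "'d config measure \<Rightarrow> 'd site set \<Rightarrow> 'd config set \<Rightarrow> bool" where
  "local_event M A E \<longleftrightarrow> E \<in> sets M \<and>
     (\<forall>\<sigma> \<tau>. (\<forall>x\<in>A. \<sigma> x = \<tau> x) \<longrightarrow> (\<sigma> \<in> E \<longleftrightarrow> \<tau> \<in> E))"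

definition setdist_ge :: "('d::finite) site set \<Rightarrow> 'd site set \<Rightarrow> real \<Rightarrow> bool" where
  "setdist_ge A1 A2 m \<longleftrightarrow> (\<forall>x\<in>A1. \<forall>y\<in>A2. real_of_int (supnorm (vsub x y)) \<ge> m)"

definition phi_mix :: "('d::finite) config measure \<Rightarrow> real \<Rightarrow> real" where
  "phi_mix P m = Sup {\<bar>measure P (E1 \<inter> E2) / measure P E2 - measure P E1\<bar> / real (card A1) |
       A1 A2 E1 E2. finite A1 \<and> finite A2 \<and> setdist_ge A1 A2 m \<and>
       local_event P A1 E1 \<and> local_event P A2 E2 \<and> measure P E2 > 0}"

definition nonunif_exp_phi_mixing :: "('d::finite) config measure \<Rightarrow> bool" where
  "nonunif_exp_phi_mixing P \<longleftrightarrow>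
     (\<exists>C1 C2. C1 > 0 \<and> C2 > 0 \<and> (\<forall>m>0. phi_mix P m \<le> C1 * exp (- C2 * m)))"

definition potential :: "(('d::finite) site set \<Rightarrow> 'd config \<Rightarrow> real) \<Rightarrow> bool" where
  "potential \<Phi> \<longleftrightarrow>
     (\<forall>A \<sigma> \<tau>. finite A \<longrightarrow> (\<forall>x\<in>A. \<sigma> x = \<tau> x) \<longrightarrow> \<Phi> A \<sigma> = \<Phi> A \<tau>) \<and>
     (\<forall>A x \<sigma>. finite A \<longrightarrow> \<Phi> (translate A x) \<sigma> = \<Phi> A (shift x \<sigma>)) \<and>
     (\<lambda>A. SUP \<sigma>. \<bar>\<Phi> A \<sigma>\<bar>) summable_on {A. finite A \<and> (\<lambda>_. 0) \<in> A}"

definition hamiltonian :: "('d site set \<Rightarrow> 'd config \<Rightarrow> real) \<Rightarrow> 'd site set \<Rightarrow> 'd config \<Rightarrow> real" where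
  "hamiltonian \<Phi> \<Lambda> \<sigma> = (\<Sum>\<^sub>\<infinity>A\<in>{A. finite A \<and> A \<inter> \<Lambda> \<noteq> {}}. \<Phi> A \<sigma>)"

definition splice :: "'d site set \<Rightarrow> 'd config \<Rightarrow> 'd config \<Rightarrow> 'd config" where
  "splice \<Lambda> \<xi> \<eta> = (\<lambda>x. if x \<in> \<Lambda> then \<xi> x else \<eta> x)"

definition local_confs :: "'d site set \<Rightarrow> 'd config set" where
  "local_confs \<Lambda> = {\<xi>. \<forall>x. x \<notin> \<Lambda> \<longrightarrow> \<xi> x = False}"

definition gibbs_kernel :: "('d site set \<Rightarrow> 'd config \<Rightarrow> real) \<Rightarrow> 'd site set \<Rightarrow> 'd config set \<Rightarrow> 'd config \<Rightarrow> real" where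
  "gibbs_kernel \<Phi> \<Lambda> E \<eta> =
     (\<Sum>\<xi>\<in>local_confs \<Lambda>. exp (- hamiltonian \<Phi> \<Lambda> (splice \<Lambda> \<xi> \<eta>)) * indicator E (splice \<Lambda> \<xi> \<eta>))
     / (\<Sum>\<xi>\<in>local_confs \<Lambda>. exp (- hamiltonian \<Phi> \<Lambda> (splice \<Lambda> \<xi> \<eta>)))"

definition gibbs_measure :: "('d::finite) config measure \<Rightarrow> bool" where
  "gibbs_measure P \<longleftrightarrow> prob_space P \<and> sets P = sets config_space \<and>
     (\<exists>\<Phi>. potential \<Phi> \<and>
        (\<forall>\<Lambda> E. finite \<Lambda> \<longrightarrow> E \<in> sets P \<longrightarrow>
           measure P E = (\<integral>\<eta>. gibbs_kernel \<Phi> \<Lambda> E \<eta> \<partial>P)))"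

definition stationary :: "'d config measure \<Rightarrow> bool" where
  "stationary Q \<longleftrightarrow> (\<forall>x. distr Q config_space (shift x) = Q)"

definition ergodic :: "'d config measure \<Rightarrow> bool" where
  "ergodic Q \<longleftrightarrow> (\<forall>E\<in>sets Q. (\<forall>x. shift x -` E \<inter> space Q = E) \<longrightarrow>
      measure Q E = 0 \<or> measure Q E = 1)"

definition marg :: "'d config measure \<Rightarrow> nat \<Rightarrow> 'd config \<Rightarrow> real" where
  "marg M n A = measure M {\<sigma> \<in> space M. \<forall>x\<in>cube n. \<sigma> x = A x}"

definition joint_ok :: "'d config measure \<Rightarrow> nat \<Rightarrow> real \<Rightarrow> ('d config \<times> 'd config \<Rightarrow> real) \<Rightarrow> bool" where
  "joint_ok Q n \<epsilon> J \<longleftrightarrow>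
     (\<forall>p. J p \<ge> 0) \<and> (\<forall>p. p \<notin> pats n \<times> pats n \<longrightarrow> J p = 0) \<and>
     (\<forall>a\<in>pats n. (\<Sum>b\<in>pats n. J (a, b)) = marg Q n a) \<and>
     (\<Sum>p\<in>pats n \<times> pats n. J p * (Delta (cube n) (fst p) (snd p) / real (card (cube n :: 'd site set)))) \<le> \<epsilon>"

definition rel_entropy :: "nat \<Rightarrow> ('d config \<times> 'd config \<Rightarrow> real) \<Rightarrow> 'd config measure \<Rightarrow> 'd config measure \<Rightarrow> ereal" where
  "rel_entropy n J Q P = (\<Sum>p\<in>pats n \<times> pats n.
      if J p = 0 then 0
      else if marg Q n (fst p) * marg P n (snd p) = 0 then \<infinity>
      else ereal (J p * ln (J p / (marg Q n (fst p) * marg P n (snd p)))))"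

definition rate_distortion_n :: "'d config measure \<Rightarrow> 'd config measure \<Rightarrow> real \<Rightarrow> nat \<Rightarrow> ereal" where
  "rate_distortion_n Q P \<epsilon> n =
     Inf {rel_entropy n J Q P / ereal (real (card (cube n :: 'd site set))) | J. joint_ok Q n \<epsilon> J}"

end

theory Submission
  imports Defs "HOL-Real_Asymp.Real_Asymp"
begin

text \<open>
  Mixing makes \<open>P\<close> the only Gibbs measure of its translation invariant potential, hence stationary on local
  events. If \<open>A\<close> is good, no constant configuration lies in its ball (it would also lie in all translates), so
  \<open>A\<close> has more than \<open>\<epsilon> |C\<^sub>n|\<close> ones and as many zeros; the mean Hamming distance of \<open>A\<close> to a \<open>P\<close>-sample
  then exceeds \<open>\<epsilon> |C\<^sub>n|\<close> by a fixed fraction of \<open>|C\<^sub>n|\<close>, and a Chernoff bound on sparse sublattices yields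
  \<open>\<rho> := P [A]\<^sup>\<epsilon> \<le> exp (- K n\<^sup>d)\<close> for all large \<open>n\<close>.

  Cut the observation window into blocks whose side is a small negative power of \<open>\<rho>\<close>, separated by corridors of
  width \<open>O (log (1 / \<rho>))\<close>. The blocks are nearly independent, so the probability of no hit is almost
  \<open>(1 - \<tau>)\<^sup>r\<close> with \<open>\<tau>\<close> the hitting probability of one block and \<open>r\<close> the number of blocks, and \<open>\<Lambda>\<close> is the constant
  for which this equals \<open>e\<^sup>-\<^sup>t\<close>. A second moment estimate bounds \<open>\<Lambda>\<close> from below; goodness enters by packing:
  occurrences of \<open>A\<close> are more than \<open>\<alpha> n\<close> apart, so only boundedly many fit at distance \<open>O(n)\<close> of each other.
  The resulting error \<open>O (\<rho>\<^sup>\<kappa> (1 + t))\<close> and the trivial exponential tail bound are combined by taking their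
  geometric mean. For the finitely many small \<open>n\<close> the exponential tail bound suffices.
\<close>

section \<open>Local events and mixing\<close>

text \<open>The coefficient \<open>phi_mix\<close> divides by the size of the first region only. A
  mixing error therefore scales with the single site or block that is split off, and not with
  everything collected on the other side; this is what allows inductions over arbitrarily many sites
  and blocks. The comparison of blocks needs translated events to have equal probability, and a
  Gibbs measure of a translation invariant potential may break the symmetry. Hence uniqueness has to
  come first. The corridor width is chosen so that \<open>exp (- C2 * h)\<close> is at most
  \<rho>^2. The mixing error of one block is then negligible against its hitting probability, which
  is of order f^d \<rho> for side f. Neither final bound suffices alone: the one with the small
  factor grows in t, and the one that decays in t has no small factor. Their product keeps half of
  each advantage.\<close>

definition box :: "nat \<Rightarrow> ('d::finite) site set" where
  "box L = {x. \<forall>i. 0 \<le> x i \<and> x i < int L}"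

lemma box_PiE: "(box L :: ('d::finite) site set) = PiE UNIV (\<lambda>_. {0..<int L})"
  by (auto simp: box_def PiE_def)

lemma finite_box [simp]: "finite (box L)"
  unfolding box_PiE by (rule finite_PiE) auto

lemma card_box: "card (box L :: ('d::finite) site set) = L ^ CARD('d)"
  unfolding box_PiE by (subst card_PiE) auto

lemma cube_eq_box: "cube n = box (Suc n)"
proof -
  have "a \<le> int n \<longleftrightarrow> a < int (Suc n)" for a by linarith
  then show ?thesis unfolding cube_def box_def by simp
qed

lemma finite_cube [simp]: "finite (cube n :: ('d::finite) site set)"
  by (simp add: cube_eq_box)

lemma card_cube: "card (cube n :: ('d::finite) site set) = (n + 1) ^ CARD('d)"
  by (simp add: cube_eq_box card_box)

lemma supnorm_le_iff: "supnorm (x :: ('d::finite) site) \<le> b \<longleftrightarrow> (\<forall>i. \<bar>x i\<bar> \<le> b)"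
  unfolding supnorm_def by (subst Max_le_iff) auto

lemma supnorm_ge_iff: "b \<le> supnorm (x :: ('d::finite) site) \<longleftrightarrow> (\<exists>i. b \<le> \<bar>x i\<bar>)"
  unfolding supnorm_def by (subst Max_ge_iff) auto

lemma supnorm_ge: "\<bar>x i\<bar> \<le> supnorm (x :: ('d::finite) site)"
  by (auto simp: supnorm_ge_iff)

lemma supnorm_pos: "x \<noteq> (\<lambda>_. 0) \<Longrightarrow> 0 < supnorm (x :: ('d::finite) site)"
  by (metis abs_le_zero_iff ext linorder_not_le supnorm_le_iff)

text \<open>The locality clause of \<open>local_event\<close> alone; for finite \<open>V\<close>
  measurability follows from it.\<close>

definition depends_on :: "'d site set \<Rightarrow> 'd config set \<Rightarrow> bool" where
  "depends_on V E \<longleftrightarrow> (\<forall>\<sigma> \<tau>. (\<forall>x\<in>V. \<sigma> x = \<tau> x) \<longrightarrow> (\<sigma> \<in> E \<longleftrightarrow> \<tau> \<in> E))"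

definition cylinder :: "'d site set \<Rightarrow> 'd config \<Rightarrow> 'd config set" where
  "cylinder V a = {\<sigma>. \<forall>x\<in>V. \<sigma> x = a x}"

lemma depends_onD: "depends_on V E \<Longrightarrow> (\<And>x. x \<in> V \<Longrightarrow> \<sigma> x = \<tau> x) \<Longrightarrow> \<sigma> \<in> E \<longleftrightarrow> \<tau> \<in> E"
  by (auto simp: depends_on_def)

lemma depends_on_cylinder: "depends_on V (cylinder V a)"
  by (auto simp: depends_on_def cylinder_def)

lemma depends_on_Int: "depends_on V E \<Longrightarrow> depends_on W F \<Longrightarrow> depends_on (V \<union> W) (E \<inter> F)"
  unfolding depends_on_def by blast

lemma space_config_space [simp]: "space config_space = UNIV"
  by (simp add: config_space_def space_PiM)

lemma cylinder_sets: "finite V \<Longrightarrow> cylinder V a \<in> sets config_space"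
proof (induction V rule: finite_induct)
  case empty
  then show ?case using sets.top[of config_space] by (simp add: cylinder_def)
next
  case (insert x V)
  have "(\<lambda>\<sigma>. \<sigma> x) \<in> measurable config_space (count_space UNIV)"
    unfolding config_space_def by (rule measurable_component_singleton) simp
  then have "(\<lambda>\<sigma>. \<sigma> x) -` {a x} \<inter> space config_space \<in> sets config_space"
    by (rule measurable_sets) simp
  moreover have "cylinder (insert x V) a = ((\<lambda>\<sigma>. \<sigma> x) -` {a x} \<inter> space config_space) \<inter> cylinder V a"
    by (auto simp: cylinder_def)
  ultimately show ?case using insert.IH by (simp del: space_config_space) 
qed

lemma finite_local_confs: "finite V \<Longrightarrow> finite (local_confs V)"
proof -
  assume "finite V"
  moreover have "local_confs V \<subseteq> (\<lambda>S x. x \<in> S) ` Pow V"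
  proof
    fix \<xi> assume "\<xi> \<in> local_confs V"
    then have "\<xi> = (\<lambda>x. x \<in> {x. \<xi> x})" "{x. \<xi> x} \<in> Pow V" by (auto simp: local_confs_def)
    then show "\<xi> \<in> (\<lambda>S x. x \<in> S) ` Pow V" by blast
  qed
  ultimately show ?thesis by (meson finite_Pow_iff finite_imageI finite_subset)
qed

lemma splice_local_confs: "splice V \<sigma> (\<lambda>_. False) \<in> local_confs V"
  by (simp add: splice_def local_confs_def)

lemma local_confs_cylinder_iff:
  "a \<in> local_confs V \<Longrightarrow> \<sigma> \<in> cylinder V a \<longleftrightarrow> a = splice V \<sigma> (\<lambda>_. False)"
  by (auto simp: splice_def local_confs_def cylinder_def fun_eq_iff)

text \<open>Exactly one cylinder based on \<open>V\<close> contains \<open>\<sigma>\<close>.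
  Measurability and integrals of local functions thereby become statements about finite
  sums.\<close>

lemma local_fun_expand:
  assumes "finite V" and g: "\<And>\<sigma> \<tau>. (\<And>x. x \<in> V \<Longrightarrow> \<sigma> x = \<tau> x) \<Longrightarrow> g \<sigma> = g \<tau>"
  shows "g \<sigma> = (\<Sum>a\<in>local_confs V. g a * (indicator (cylinder V a) \<sigma> :: real))"
proof -
  have "(\<Sum>a\<in>local_confs V. g a * (indicator (cylinder V a) \<sigma> :: real))
      = (\<Sum>a\<in>local_confs V. if a = splice V \<sigma> (\<lambda>_. False) then g a else 0)"
    by (intro sum.cong) (auto simp: local_confs_cylinder_iff indicator_def)
  also have "\<dots> = g (splice V \<sigma> (\<lambda>_. False))"
    using finite_local_confs[OF assms(1)] splice_local_confs[of V \<sigma>] by simp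
  also have "\<dots> = g \<sigma>" by (rule g) (simp add: splice_def)
  finally show ?thesis by simp
qed

lemma depends_on_sets:
  assumes "finite V" "depends_on V E"
  shows "E \<in> sets config_space"
proof -
  have "E = (\<Union>a\<in>local_confs V \<inter> E. cylinder V a)"
  proof (intro equalityI subsetI)
    fix \<sigma> assume "\<sigma> \<in> E"
    then have "splice V \<sigma> (\<lambda>_. False) \<in> E"
      using depends_onD[OF assms(2), of "splice V \<sigma> (\<lambda>_. False)" \<sigma>] by (simp add: splice_def)
    moreover have "\<sigma> \<in> cylinder V (splice V \<sigma> (\<lambda>_. False))" by (simp add: splice_def cylinder_def)
    ultimately show "\<sigma> \<in> (\<Union>a\<in>local_confs V \<inter> E. cylinder V a)"
      using splice_local_confs by blast
  next
    fix \<sigma> assume "\<sigma> \<in> (\<Union>a\<in>local_confs V \<inter> E. cylinder V a)"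
    then obtain a where "a \<in> E" "\<forall>x\<in>V. \<sigma> x = a x" by (auto simp: cylinder_def)
    then show "\<sigma> \<in> E" using depends_onD[OF assms(2), of \<sigma> a] by blast
  qed
  also have "\<dots> \<in> sets config_space"
    using finite_local_confs[OF assms(1)] cylinder_sets[OF assms(1)]
    by (intro sets.finite_UN) auto
  finally show ?thesis .
qed

section \<open>Integration of local functions\<close>

locale config_measure = prob_space P for P :: "('d::finite) config measure" +
  assumes sets_P: "sets P = sets config_space"
begin

lemma space_P [simp]: "space P = UNIV"
  using sets_eq_imp_space_eq[OF sets_P] by simp

lemma depends_on_sets_P: "finite V \<Longrightarrow> depends_on V E \<Longrightarrow> E \<in> sets P"
  using depends_on_sets sets_P by blast

lemma local_event_iff: "finite V \<Longrightarrow> local_event P V E \<longleftrightarrow> depends_on V E"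
  using depends_on_sets_P by (auto simp: local_event_def depends_on_def)

lemma local_fun_measurable:
  fixes g :: "'d config \<Rightarrow> real"
  assumes "finite V" and g: "\<And>\<sigma> \<tau>. (\<And>x. x \<in> V \<Longrightarrow> \<sigma> x = \<tau> x) \<Longrightarrow> g \<sigma> = g \<tau>"
  shows "g \<in> borel_measurable P"
proof -
  have [measurable]: "cylinder V a \<in> sets P" for a
    using cylinder_sets[OF assms(1)] sets_P by blast
  have "(\<lambda>\<sigma>. \<Sum>a\<in>local_confs V. g a * (indicator (cylinder V a) \<sigma> :: real)) \<in> borel_measurable P"
    by measurable
  moreover have "g = (\<lambda>\<sigma>. \<Sum>a\<in>local_confs V. g a * (indicator (cylinder V a) \<sigma> :: real))"
    by (rule ext) (rule local_fun_expand[OF assms])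
  ultimately show ?thesis by simp
qed

lemma local_fun_integral:
  fixes g :: "'d config \<Rightarrow> real"
  assumes "finite V" and g: "\<And>\<sigma> \<tau>. (\<And>x. x \<in> V \<Longrightarrow> \<sigma> x = \<tau> x) \<Longrightarrow> g \<sigma> = g \<tau>"
    and E: "E \<in> sets P"
  shows "integrable P (\<lambda>\<sigma>. g \<sigma> * indicator E \<sigma>)"
    and "(\<integral>\<sigma>. g \<sigma> * indicator E \<sigma> \<partial>P) = (\<Sum>a\<in>local_confs V. g a * measure P (cylinder V a \<inter> E))"
proof -
  have c: "cylinder V a \<inter> E \<in> sets P" for a
    using cylinder_sets[OF assms(1)] sets_P E by blast
  have eq: "(\<lambda>\<sigma>. g \<sigma> * indicator E \<sigma>)
      = (\<lambda>\<sigma>. \<Sum>a\<in>local_confs V. g a * (indicator (cylinder V a \<inter> E) \<sigma> :: real))"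
  proof
    fix \<sigma>
    show "g \<sigma> * indicator E \<sigma> = (\<Sum>a\<in>local_confs V. g a * (indicator (cylinder V a \<inter> E) \<sigma> :: real))"
      unfolding indicator_inter_arith mult.assoc[symmetric] sum_distrib_right[symmetric]
      using local_fun_expand[of V g \<sigma>, OF assms(1) g] by simp
  qed
  have i: "integrable P (\<lambda>\<sigma>. g a * (indicator (cylinder V a \<inter> E) \<sigma> :: real))" for a
    using c[of a] by (simp add: integrable_real_indicator emeasure_finite less_top[symmetric])
  show "integrable P (\<lambda>\<sigma>. g \<sigma> * indicator E \<sigma>)"
    unfolding eq by (intro Bochner_Integration.integrable_sum i)
  show "(\<integral>\<sigma>. g \<sigma> * indicator E \<sigma> \<partial>P) = (\<Sum>a\<in>local_confs V. g a * measure P (cylinder V a \<inter> E))"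
    unfolding eq using c by (subst Bochner_Integration.integral_sum[OF i]) simp
qed

end

section \<open>Consequences of exponential mixing for finite regions\<close>

locale mixing_field = config_measure P for P :: "('d::finite) config measure" +
  fixes C1 C2 :: real
  assumes C1: "C1 > 0" and C2: "C2 > 0"
    and mixing: "\<And>m. m > 0 \<Longrightarrow> phi_mix P m \<le> C1 * exp (- C2 * m)"
begin

text \<open>A real \<open>Sup\<close> is an upper bound only for a bounded set. All quotients here
  are at most 1: the numerator compares two numbers in [0,1], and an empty \<open>A1\<close> yields
  0 by the convention for division by zero.\<close>

lemma phi_mix_upper:
  assumes "finite A1" "finite A2" "setdist_ge A1 A2 m"
    "depends_on A1 E1" "depends_on A2 E2" "measure P E2 > 0"
  shows "\<bar>measure P (E1 \<inter> E2) / measure P E2 - measure P E1\<bar> / real (card A1) \<le> phi_mix P m"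
proof -
  let ?S = "{\<bar>measure P (E1 \<inter> E2) / measure P E2 - measure P E1\<bar> / real (card A1) |
       A1 A2 E1 E2. finite A1 \<and> finite A2 \<and> setdist_ge A1 A2 m \<and>
       local_event P A1 E1 \<and> local_event P A2 E2 \<and> measure P E2 > 0}"
  have "bdd_above ?S"
  proof (rule bdd_aboveI[of _ 1])
    fix z assume "z \<in> ?S"
    then obtain A1 A2 :: "'d site set" and E1 E2
      where z: "z = \<bar>measure P (E1 \<inter> E2) / measure P E2 - measure P E1\<bar> / real (card A1)"
      and "local_event P A1 E1" "local_event P A2 E2" and pos: "measure P E2 > 0"
      by blast
    then have e2: "measure P E2 > 0" "E1 \<in> sets P" "E2 \<in> sets P"
      by (simp_all add: local_event_def)
    have "measure P (E1 \<inter> E2) \<le> measure P E2" using e2 by (intro finite_measure_mono) auto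
    then have "measure P (E1 \<inter> E2) / measure P E2 \<le> 1" "0 \<le> measure P (E1 \<inter> E2) / measure P E2" using e2 by auto
    then have "\<bar>measure P (E1 \<inter> E2) / measure P E2 - measure P E1\<bar> \<le> 1"
      using prob_le_1[of E1] measure_nonneg[of P E1] by linarith
    then show "z \<le> 1" unfolding z
      by (cases "card A1 = 0") (auto simp: divide_le_eq)
  qed
  moreover have "\<bar>measure P (E1 \<inter> E2) / measure P E2 - measure P E1\<bar> / real (card A1) \<in> ?S"
    using assms(1-3,6) local_event_iff[OF assms(1)] local_event_iff[OF assms(2)] assms(4,5)
    by (intro CollectI exI[of _ A1] exI[of _ A2] exI[of _ E1] exI[of _ E2] conjI refl) simp_all
  ultimately show ?thesis unfolding phi_mix_def by (rule cSup_upper[rotated])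
qed

text \<open>Multiplying out the conditional probability covers null events \<open>E2\<close> too.
  Only the size of \<open>A1\<close> enters the error.\<close>

lemma mixing_bound:
  assumes "finite A1" "finite A2" "setdist_ge A1 A2 m" "m > 0"
    "depends_on A1 E1" "depends_on A2 E2"
  shows "\<bar>measure P (E1 \<inter> E2) - measure P E1 * measure P E2\<bar>
      \<le> measure P E2 * (real (card A1) * (C1 * exp (- C2 * m)))"
proof -
  have s: "E1 \<in> sets P" "E2 \<in> sets P" using assms depends_on_sets_P by auto
  have le: "measure P (E1 \<inter> E2) \<le> measure P E2" using s by (intro finite_measure_mono) auto
  show ?thesis
  proof (cases "measure P E2 = 0")
    case True
    then show ?thesis using le measure_nonneg[of P "E1 \<inter> E2"] by simp
  next
    case False
    then have pos: "measure P E2 > 0" by (simp add: less_le)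
    show ?thesis
    proof (cases "A1 = {}")
      case True
      \<comment> \<open>For empty \<open>A1\<close> the quotient in \<open>phi_mix\<close> is 0 by
        convention and says nothing, but \<open>E1\<close> is then trivial.\<close>
      then have "E1 = {} \<or> E1 = UNIV" using assms(5) by (auto simp: depends_on_def)
      then show ?thesis using True prob_space by auto
    next
      case False
      then have c: "real (card A1) > 0" using assms(1) by (simp add: card_gt_0_iff)
      have "\<bar>measure P (E1 \<inter> E2) / measure P E2 - measure P E1\<bar> / real (card A1) \<le> C1 * exp (- C2 * m)"
        using phi_mix_upper[OF assms(1,2,3,5,6) pos] mixing[OF assms(4)] by linarith
      then have "\<bar>measure P (E1 \<inter> E2) / measure P E2 - measure P E1\<bar> \<le> real (card A1) * (C1 * exp (- C2 * m))"
        using c by (simp add: divide_le_eq mult.commute)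
      then have "measure P E2 * \<bar>measure P (E1 \<inter> E2) / measure P E2 - measure P E1\<bar>
          \<le> measure P E2 * (real (card A1) * (C1 * exp (- C2 * m)))"
        using pos by (intro mult_left_mono) auto
      moreover have "measure P E2 * \<bar>measure P (E1 \<inter> E2) / measure P E2 - measure P E1\<bar>
          = \<bar>measure P (E1 \<inter> E2) - measure P E1 * measure P E2\<bar>"
        using pos by (simp add: abs_mult_pos' right_diff_distrib mult.commute)
      ultimately show ?thesis by simp
    qed
  qed
qed

text \<open>\<open>mixing_bound\<close> is applied to every cylinder over \<open>A2\<close>, and the
  coefficients of \<open>g\<close> are nonnegative. The lower bound is the direction that the moment
  generating function uses.\<close>

lemma mixing_bound_fun:
  fixes g :: "'d config \<Rightarrow> real"
  assumes "finite A1" "finite A2" "setdist_ge A1 A2 m" "m > 0" "depends_on A1 E1"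
    and g: "\<And>\<sigma> \<tau>. (\<And>x. x \<in> A2 \<Longrightarrow> \<sigma> x = \<tau> x) \<Longrightarrow> g \<sigma> = g \<tau>" and nn: "\<And>\<sigma>. g \<sigma> \<ge> 0"
  shows "(measure P E1 - real (card A1) * (C1 * exp (- C2 * m))) * (\<integral>\<sigma>. g \<sigma> \<partial>P)
      \<le> (\<integral>\<sigma>. g \<sigma> * indicator E1 \<sigma> \<partial>P)"
proof -
  let ?e = "real (card A1) * (C1 * exp (- C2 * m))"
  have s: "E1 \<in> sets P" by (rule depends_on_sets_P[OF assms(1,5)])
  have 1: "(\<integral>\<sigma>. g \<sigma> \<partial>P) = (\<Sum>a\<in>local_confs A2. g a * measure P (cylinder A2 a))"
    using local_fun_integral(2)[OF assms(2) g sets.top] by simp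
  have "(measure P E1 - ?e) * (\<integral>\<sigma>. g \<sigma> \<partial>P)
      = (\<Sum>a\<in>local_confs A2. g a * ((measure P E1 - ?e) * measure P (cylinder A2 a)))"
    unfolding 1 sum_distrib_left by (intro sum.cong refl) (rule mult.left_commute)
  also have "\<dots> \<le> (\<Sum>a\<in>local_confs A2. g a * measure P (cylinder A2 a \<inter> E1))"
  proof (rule sum_mono, rule mult_left_mono[OF _ nn])
    fix a
    have "\<bar>measure P (E1 \<inter> cylinder A2 a) - measure P E1 * measure P (cylinder A2 a)\<bar>
        \<le> measure P (cylinder A2 a) * ?e"
      by (rule mixing_bound[OF assms(1-5) depends_on_cylinder])
    then show "(measure P E1 - ?e) * measure P (cylinder A2 a) \<le> measure P (cylinder A2 a \<inter> E1)"
      by (simp add: algebra_simps Int_commute abs_le_iff)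
  qed
  also have "\<dots> = (\<integral>\<sigma>. g \<sigma> * indicator E1 \<sigma> \<partial>P)"
    using local_fun_integral(2)[OF assms(2) g s] by simp
  finally show ?thesis .
qed

end

section \<open>Uniqueness and stationarity of Gibbs measures\<close>

lemma translate_vsub: "translate (translate A x) (\<lambda>i. - x i) = A"
  by (auto simp: translate_def vadd_def image_image)

lemma translate_vsub': "translate (translate A (\<lambda>i. - x i)) x = A"
  by (auto simp: translate_def vadd_def image_image)

lemma finite_translate [simp]: "finite A \<Longrightarrow> finite (translate A x)"
  by (simp add: translate_def)

lemma mem_translate: "y \<in> translate A x \<longleftrightarrow> vsub y x \<in> A"
proof
  assume "y \<in> translate A x"
  then show "vsub y x \<in> A" by (auto simp: translate_def vadd_def vsub_def)
next
  assume "vsub y x \<in> A"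
  moreover have "y = vadd (vsub y x) x" by (simp add: vadd_def vsub_def)
  ultimately show "y \<in> translate A x" unfolding translate_def by blast
qed

lemma shift_shift_neg: "shift x (shift (\<lambda>i. - x i) \<sigma>) = \<sigma>"
  by (simp add: shift_def vadd_def)

lemma shift_neg_shift: "shift (\<lambda>i. - x i) (shift x \<sigma>) = \<sigma>"
  by (simp add: shift_def vadd_def)

lemma surj_shift: "surj (shift x)"
  by (metis shift_shift_neg surjI)

lemma depends_on_shift:
  fixes A :: "'d site set"
  assumes "depends_on A E"
  shows "depends_on (translate A x) {\<sigma>. shift x \<sigma> \<in> E}"
  unfolding depends_on_def
proof (intro allI impI)
  fix \<sigma> \<tau> :: "'d config" assume *: "\<forall>y\<in>translate A x. \<sigma> y = \<tau> y"
  have "shift x \<sigma> \<in> E \<longleftrightarrow> shift x \<tau> \<in> E"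
    by (rule depends_onD[OF assms]) (use * in \<open>simp add: shift_def translate_def\<close>)
  then show "\<sigma> \<in> {\<sigma>. shift x \<sigma> \<in> E} \<longleftrightarrow> \<tau> \<in> {\<sigma>. shift x \<sigma> \<in> E}" by simp
qed

definition touching :: "'d site set \<Rightarrow> 'd site set set" where
  "touching \<Lambda> = {A. finite A \<and> A \<inter> \<Lambda> \<noteq> {}}"

lemma hamiltonian_touching: "hamiltonian \<Phi> \<Lambda> \<sigma> = infsum (\<lambda>A. \<Phi> A \<sigma>) (touching \<Lambda>)"
  by (simp add: hamiltonian_def touching_def)

lemma le_if_le_exp_mult:
  fixes a b :: real
  assumes "\<And>\<delta>. \<delta> > 0 \<Longrightarrow> a \<le> exp \<delta> * b"
  shows "a \<le> b"
proof -
  have "((\<lambda>\<delta>. exp \<delta> * b) \<longlongrightarrow> exp 0 * b) (at_right 0)"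
    by (intro tendsto_intros)
  moreover have "eventually (\<lambda>\<delta>::real. a \<le> exp \<delta> * b) (at_right 0)"
    using assms by (auto simp: eventually_at_right_field intro: exI[of _ 1])
  ultimately show ?thesis
    using tendsto_lowerbound[of "\<lambda>\<delta>. exp \<delta> * b" "exp 0 * b" "at_right 0" a] by simp
qed

section \<open>Potentials, Hamiltonians and Gibbs kernels\<close>

locale interaction =
  fixes \<Phi> :: "('d::finite) site set \<Rightarrow> 'd config \<Rightarrow> real"
  assumes potential: "potential \<Phi>"
begin

abbreviation "nrm A \<equiv> SUP \<sigma>. \<bar>\<Phi> A \<sigma>\<bar>"

lemma \<Phi>_local: "finite A \<Longrightarrow> (\<And>x. x \<in> A \<Longrightarrow> \<sigma> x = \<tau> x) \<Longrightarrow> \<Phi> A \<sigma> = \<Phi> A \<tau>"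
  using potential unfolding potential_def by blast

lemma \<Phi>_translate: "finite A \<Longrightarrow> \<Phi> (translate A x) \<sigma> = \<Phi> A (shift x \<sigma>)"
  using potential unfolding potential_def by blast

text \<open>Locality makes the range of \<open>\<Phi> A\<close> finite, so the real supremum is a
  genuine bound.\<close>

lemma \<Phi>_le_nrm: assumes "finite A" shows "\<bar>\<Phi> A \<sigma>\<bar> \<le> nrm A"
proof -
  have "range (\<lambda>\<sigma>. \<bar>\<Phi> A \<sigma>\<bar>) \<subseteq> (\<lambda>\<sigma>. \<bar>\<Phi> A \<sigma>\<bar>) ` local_confs A"
  proof clarify
    fix \<sigma>
    have "\<Phi> A \<sigma> = \<Phi> A (splice A \<sigma> (\<lambda>_. False))"
      by (rule \<Phi>_local[OF assms]) (simp add: splice_def)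
    then show "\<bar>\<Phi> A \<sigma>\<bar> \<in> (\<lambda>\<sigma>. \<bar>\<Phi> A \<sigma>\<bar>) ` local_confs A" using splice_local_confs by (metis imageI)
  qed
  then have "finite (range (\<lambda>\<sigma>. \<bar>\<Phi> A \<sigma>\<bar>))"
    using finite_local_confs[OF assms] finite_surj by blast
  then show ?thesis by (intro cSUP_upper) (auto intro: bdd_above_finite)
qed

lemma nrm_translate: assumes "finite A" shows "nrm (translate A x) = nrm A"
proof -
  have "(SUP \<sigma>. \<bar>\<Phi> (translate A x) \<sigma>\<bar>) = (SUP \<sigma>. \<bar>\<Phi> A (shift x \<sigma>)\<bar>)"
    using \<Phi>_translate[OF assms] by simp
  also have "\<dots> = Sup ((\<lambda>\<sigma>. \<bar>\<Phi> A \<sigma>\<bar>) ` range (shift x))"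
    by (simp add: image_image)
  finally show ?thesis by (simp add: surj_shift)
qed

lemma nrm_summable_at: "(\<lambda>A. nrm A) summable_on {A. finite A \<and> x \<in> A}"
proof -
  have "(\<lambda>A. nrm A) summable_on {A. finite A \<and> (\<lambda>_. 0) \<in> A}"
    using potential unfolding potential_def by blast
  moreover have "(\<lambda>A. nrm A) summable_on {A. finite A \<and> (\<lambda>_. 0) \<in> A}
      \<longleftrightarrow> (\<lambda>A. nrm A) summable_on {A. finite A \<and> x \<in> A}"
    by (rule summable_on_reindex_bij_witness[where j="\<lambda>A. translate A x" and i="\<lambda>A. translate A (\<lambda>i. - x i)"])
      (simp_all add: translate_vsub translate_vsub' mem_translate vsub_def nrm_translate)
  ultimately show ?thesis by blast
qed

lemma nrm_summable: "finite \<Lambda> \<Longrightarrow> (\<lambda>A. nrm A) summable_on touching \<Lambda>"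
proof (induction \<Lambda> rule: finite_induct)
  case empty
  then show ?case by (simp add: touching_def)
next
  case (insert x \<Lambda>)
  have "touching (insert x \<Lambda>) = {A. finite A \<and> x \<in> A} \<union> touching \<Lambda>" by (auto simp: touching_def)
  then show ?case using summable_on_union[OF nrm_summable_at insert.IH] by simp
qed

lemma \<Phi>_summable:
  assumes "finite \<Lambda>" "S \<subseteq> touching \<Lambda>"
  shows "(\<lambda>A. \<Phi> A \<sigma>) summable_on S" "(\<lambda>A. nrm A) summable_on S"
proof -
  show n: "(\<lambda>A. nrm A) summable_on S"
    using summable_on_subset[OF nrm_summable[OF assms(1)] assms(2)] .
  have "(\<lambda>A. norm (\<Phi> A \<sigma>)) summable_on S"
    by (rule summable_on_comparison_test[OF n]) (use assms(2) \<Phi>_le_nrm in \<open>auto simp: touching_def\<close>)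
  then show "(\<lambda>A. \<Phi> A \<sigma>) summable_on S" by (rule abs_summable_summable)
qed

lemma infsum_\<Phi>_le:
  assumes "finite \<Lambda>" "S \<subseteq> touching \<Lambda>"
  shows "\<bar>infsum (\<lambda>A. \<Phi> A \<sigma>) S\<bar> \<le> infsum (\<lambda>A. nrm A) S"
  using norm_infsum_le[OF has_sum_infsum[OF \<Phi>_summable(1)[OF assms, of \<sigma>]] has_sum_infsum[OF \<Phi>_summable(2)[OF assms]]]
    assms(2) \<Phi>_le_nrm by (auto simp: touching_def)

lemma hamiltonian_bound: "finite \<Lambda> \<Longrightarrow> \<bar>hamiltonian \<Phi> \<Lambda> \<sigma>\<bar> \<le> infsum (\<lambda>A. nrm A) (touching \<Lambda>)"
  unfolding hamiltonian_touching by (rule infsum_\<Phi>_le) auto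

text \<open>The error is dominated by the tail of the summable series of norms, hence is uniform in
  \<open>\<sigma>\<close>. Uniformity gives both quasilocality and measurability of the
  Hamiltonian.\<close>

lemma hamiltonian_approx:
  assumes \<Lambda>: "finite \<Lambda>" and "\<delta> > 0"
  obtains F where "finite F" "F \<subseteq> touching \<Lambda>"
    "\<And>\<sigma>. \<bar>hamiltonian \<Phi> \<Lambda> \<sigma> - (\<Sum>A\<in>F. \<Phi> A \<sigma>)\<bar> \<le> \<delta>"
proof -
  obtain F where F: "finite F" "F \<subseteq> touching \<Lambda>"
    "dist (\<Sum>A\<in>F. nrm A) (infsum (\<lambda>A. nrm A) (touching \<Lambda>)) \<le> \<delta>"
    using infsum_finite_approximation[OF nrm_summable[OF \<Lambda>] \<open>\<delta> > 0\<close>] by blast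
  have "\<bar>hamiltonian \<Phi> \<Lambda> \<sigma> - (\<Sum>A\<in>F. \<Phi> A \<sigma>)\<bar> \<le> \<delta>" for \<sigma>
  proof -
    have "hamiltonian \<Phi> \<Lambda> \<sigma> - (\<Sum>A\<in>F. \<Phi> A \<sigma>) = infsum (\<lambda>A. \<Phi> A \<sigma>) (touching \<Lambda> - F)"
      unfolding hamiltonian_touching
      using infsum_Diff[OF \<Phi>_summable(1)[OF \<Lambda> order_refl, of \<sigma>] \<Phi>_summable(1)[OF \<Lambda> F(2)] F(2)] F(1) by simp
    moreover have "\<bar>infsum (\<lambda>A. \<Phi> A \<sigma>) (touching \<Lambda> - F)\<bar> \<le> infsum (\<lambda>A. nrm A) (touching \<Lambda> - F)"
      by (rule infsum_\<Phi>_le[OF \<Lambda>]) auto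
    moreover have "infsum (\<lambda>A. nrm A) (touching \<Lambda> - F) = infsum (\<lambda>A. nrm A) (touching \<Lambda>) - (\<Sum>A\<in>F. nrm A)"
      using infsum_Diff[OF nrm_summable[OF \<Lambda>] \<Phi>_summable(2)[OF \<Lambda> F(2)] F(2)] F(1) by simp
    ultimately show ?thesis using F(3) by (simp add: dist_real_def)
  qed
  then show ?thesis using that F by blast
qed

lemma sum_\<Phi>_local:
  assumes "finite F" "F \<subseteq> touching \<Lambda>" "\<And>x. x \<in> \<Union>F \<Longrightarrow> \<sigma> x = \<tau> x"
  shows "(\<Sum>A\<in>F. \<Phi> A \<sigma>) = (\<Sum>A\<in>F. \<Phi> A \<tau>)"
  by (rule sum.cong[OF refl], rule \<Phi>_local) (use assms in \<open>auto simp: touching_def\<close>)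

lemma hamiltonian_quasilocal:
  assumes \<Lambda>: "finite \<Lambda>" and "\<delta> > 0"
  obtains W where "finite W" "\<Lambda> \<subseteq> W"
    "\<And>\<sigma> \<tau>. (\<And>x. x \<in> W \<Longrightarrow> \<sigma> x = \<tau> x) \<Longrightarrow> \<bar>hamiltonian \<Phi> \<Lambda> \<sigma> - hamiltonian \<Phi> \<Lambda> \<tau>\<bar> \<le> \<delta>"
proof -
  obtain F where F: "finite F" "F \<subseteq> touching \<Lambda>"
    "\<And>\<sigma>. \<bar>hamiltonian \<Phi> \<Lambda> \<sigma> - (\<Sum>A\<in>F. \<Phi> A \<sigma>)\<bar> \<le> \<delta> / 2"
    using hamiltonian_approx[OF \<Lambda>, of "\<delta> / 2"] \<open>\<delta> > 0\<close> by (metis half_gt_zero)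
  show ?thesis
  proof (rule that[of "\<Lambda> \<union> \<Union>F"])
    show "finite (\<Lambda> \<union> \<Union>F)" using F(1,2) \<Lambda> by (auto simp: touching_def)
  next
    fix \<sigma> \<tau> :: "'d config" assume *: "\<And>x. x \<in> \<Lambda> \<union> \<Union>F \<Longrightarrow> \<sigma> x = \<tau> x"
    have "(\<Sum>A\<in>F. \<Phi> A \<sigma>) = (\<Sum>A\<in>F. \<Phi> A \<tau>)"
      by (rule sum_\<Phi>_local[OF F(1,2)]) (use * in blast)
    then show "\<bar>hamiltonian \<Phi> \<Lambda> \<sigma> - hamiltonian \<Phi> \<Lambda> \<tau>\<bar> \<le> \<delta>"
      using F(3)[of \<sigma>] F(3)[of \<tau>] by linarith
  qed auto
qed

lemma hamiltonian_translate:
  "hamiltonian \<Phi> (translate \<Lambda> x) \<sigma> = hamiltonian \<Phi> \<Lambda> (shift x \<sigma>)"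
  unfolding hamiltonian_touching
proof (rule infsum_reindex_bij_witness[where i="\<lambda>A. translate A x" and j="\<lambda>A. translate A (\<lambda>i. - x i)"])
  fix A assume A: "A \<in> touching (translate \<Lambda> x)"
  then obtain y where y: "y \<in> A" "y \<in> translate \<Lambda> x" by (auto simp: touching_def)
  then have "vsub y x \<in> translate A (\<lambda>i. - x i) \<inter> \<Lambda>" by (simp add: mem_translate vsub_def)
  then show "translate A (\<lambda>i. - x i) \<in> touching \<Lambda>" using A by (auto simp: touching_def)
  show "\<Phi> (translate A (\<lambda>i. - x i)) (shift x \<sigma>) = \<Phi> A \<sigma>"
    using \<Phi>_translate[of "translate A (\<lambda>i. - x i)" x \<sigma>] A by (simp add: touching_def translate_vsub')
next
  fix A assume A: "A \<in> touching \<Lambda>"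
  then obtain y where y: "y \<in> A" "y \<in> \<Lambda>" by (auto simp: touching_def)
  then have "vadd y x \<in> translate A x \<inter> translate \<Lambda> x" by (simp add: translate_def)
  then show "translate A x \<in> touching (translate \<Lambda> x)" using A by (auto simp: touching_def)
qed (simp_all add: translate_vsub translate_vsub')

lemma splice_shift: "shift x (splice (translate \<Lambda> x) \<xi> \<eta>) = splice \<Lambda> (shift x \<xi>) (shift x \<eta>)"
  by (auto simp: fun_eq_iff shift_def splice_def mem_translate vsub_def vadd_def)

text \<open>Shift covariance of the specification. In \<open>local_stationary\<close> it identifies
  the kernel of a region with the kernel of its translate.\<close>

lemma gibbs_kernel_translate:
  "gibbs_kernel \<Phi> (translate \<Lambda> x) {\<sigma>. shift x \<sigma> \<in> E} \<eta> = gibbs_kernel \<Phi> \<Lambda> E (shift x \<eta>)"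
proof -
  have bij: "bij_betw (shift x) (local_confs (translate \<Lambda> x)) (local_confs \<Lambda>)"
    by (rule bij_betw_byWitness[where f'="shift (\<lambda>i. - x i)"])
      (auto simp: shift_shift_neg shift_neg_shift local_confs_def mem_translate vsub_def vadd_def shift_def)
  show ?thesis
    unfolding gibbs_kernel_def hamiltonian_translate splice_shift
    by (subst (1 2) sum.reindex_bij_betw[OF bij, symmetric])
      (simp add: indicator_def splice_shift)
qed

abbreviation "weight \<Lambda> \<xi> \<eta> \<equiv> exp (- hamiltonian \<Phi> \<Lambda> (splice \<Lambda> \<xi> \<eta>))"

abbreviation "partition_fun \<Lambda> \<eta> \<equiv> (\<Sum>\<xi>\<in>local_confs \<Lambda>. weight \<Lambda> \<xi> \<eta>)"

lemma partition_fun_pos: assumes "finite \<Lambda>" shows "partition_fun \<Lambda> \<eta> > 0"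
proof -
  have "local_confs \<Lambda> \<noteq> {}" using splice_local_confs by blast
  then show ?thesis using finite_local_confs[OF assms] by (intro sum_pos) auto
qed

lemma gibbs_kernel_bounds:
  assumes "finite \<Lambda>" shows "0 \<le> gibbs_kernel \<Phi> \<Lambda> E \<eta>" "gibbs_kernel \<Phi> \<Lambda> E \<eta> \<le> 1"
proof -
  have "(\<Sum>\<xi>\<in>local_confs \<Lambda>. weight \<Lambda> \<xi> \<eta> * indicator E (splice \<Lambda> \<xi> \<eta>)) \<le> partition_fun \<Lambda> \<eta>"
    by (rule sum_mono) (simp add: indicator_def)
  then show "gibbs_kernel \<Phi> \<Lambda> E \<eta> \<le> 1"
    unfolding gibbs_kernel_def using partition_fun_pos[OF assms, of \<eta>] by simp
  show "0 \<le> gibbs_kernel \<Phi> \<Lambda> E \<eta>"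
    unfolding gibbs_kernel_def by (intro divide_nonneg_nonneg sum_nonneg mult_nonneg_nonneg) auto
qed

text \<open>Finite energy: whatever the boundary condition, every weight lies between
  \<open>exp (- B)\<close> and \<open>exp B\<close>, where \<open>B\<close> is the total norm of the
  sets that touch \<open>\<Lambda>\<close>.\<close>

lemma gibbs_kernel_cylinder_bound:
  assumes "finite \<Lambda>"
  obtains c where "c > 0" "\<And>\<eta>. c \<le> gibbs_kernel \<Phi> \<Lambda> (cylinder \<Lambda> a) \<eta>"
proof -
  let ?B = "infsum (\<lambda>A. nrm A) (touching \<Lambda>)"
  let ?n = "real (card (local_confs \<Lambda>))"
  let ?a = "splice \<Lambda> a (\<lambda>_. False)"
  have n: "?n > 0" using finite_local_confs[OF assms] splice_local_confs by (auto simp: card_gt_0_iff)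
  have "exp (- ?B) / (?n * exp ?B) \<le> gibbs_kernel \<Phi> \<Lambda> (cylinder \<Lambda> a) \<eta>" for \<eta>
    unfolding gibbs_kernel_def
  proof (rule frac_le)
    have "- ?B \<le> - hamiltonian \<Phi> \<Lambda> (splice \<Lambda> ?a \<eta>)"
      using hamiltonian_bound[OF assms, of "splice \<Lambda> ?a \<eta>"] by linarith
    then have "exp (- ?B) \<le> weight \<Lambda> ?a \<eta> * indicator (cylinder \<Lambda> a) (splice \<Lambda> ?a \<eta>)"
      by (simp add: cylinder_def splice_def)
    also have "\<dots> \<le> (\<Sum>\<xi>\<in>local_confs \<Lambda>. weight \<Lambda> \<xi> \<eta> * indicator (cylinder \<Lambda> a) (splice \<Lambda> \<xi> \<eta>))"
      by (rule member_le_sum[OF splice_local_confs]) (use finite_local_confs[OF assms] in auto)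
    finally show "exp (- ?B) \<le> \<dots>" .
    show "partition_fun \<Lambda> \<eta> \<le> ?n * exp ?B"
    proof (rule sum_bounded_above)
      fix \<xi> show "weight \<Lambda> \<xi> \<eta> \<le> exp ?B"
        using hamiltonian_bound[OF assms, of "splice \<Lambda> \<xi> \<eta>"] by simp
    qed
  qed (use partition_fun_pos[OF assms] in \<open>auto intro!: sum_nonneg\<close>)
  moreover have "exp (- ?B) / (?n * exp ?B) > 0" using n by simp
  ultimately show ?thesis using that by blast
qed

text \<open>Properness of the kernel: resampling inside \<open>\<Lambda>\<close> does not affect an
  event outside, so its indicator factors out.\<close>

lemma gibbs_kernel_Int:
  assumes "depends_on W E2" "W \<inter> \<Lambda> = {}"
  shows "gibbs_kernel \<Phi> \<Lambda> (E \<inter> E2) \<eta> = gibbs_kernel \<Phi> \<Lambda> E \<eta> * indicator E2 \<eta>"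
proof -
  have "splice \<Lambda> \<xi> \<eta> \<in> E2 \<longleftrightarrow> \<eta> \<in> E2" for \<xi>
    by (rule depends_onD[OF assms(1)]) (use assms(2) in \<open>auto simp: splice_def\<close>)
  then have "(indicator (E \<inter> E2) (splice \<Lambda> \<xi> \<eta>) :: real) = indicator E (splice \<Lambda> \<xi> \<eta>) * indicator E2 \<eta>" for \<xi>
    by (simp add: indicator_def)
  then show ?thesis
    unfolding gibbs_kernel_def by (simp add: sum_distrib_right mult.assoc times_divide_eq_left)
qed

text \<open>Numerator and normalisation each change by at most a factor \<open>exp \<delta>\<close>,
  whence the \<open>2 * \<delta>\<close>.\<close>

lemma gibbs_kernel_compare:
  assumes \<Lambda>: "finite \<Lambda>" and E: "depends_on A E" "A \<subseteq> \<Lambda>"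
    and W: "\<And>\<xi>. \<bar>hamiltonian \<Phi> \<Lambda> (splice \<Lambda> \<xi> \<zeta>) - hamiltonian \<Phi> \<Lambda> (splice \<Lambda> \<xi> \<eta>)\<bar> \<le> \<delta>"
  shows "gibbs_kernel \<Phi> \<Lambda> E \<zeta> \<le> exp (2 * \<delta>) * gibbs_kernel \<Phi> \<Lambda> E \<eta>"
proof -
  let ?N = "\<lambda>\<eta>. \<Sum>\<xi>\<in>local_confs \<Lambda>. weight \<Lambda> \<xi> \<eta> * indicator E (splice \<Lambda> \<xi> \<eta>)"
  have w: "weight \<Lambda> \<xi> \<zeta> \<le> exp \<delta> * weight \<Lambda> \<xi> \<eta>" "exp (-\<delta>) * weight \<Lambda> \<xi> \<eta> \<le> weight \<Lambda> \<xi> \<zeta>" for \<xi>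
    using W[of \<xi>] by (simp_all add: exp_add[symmetric])
  have i: "(indicator E (splice \<Lambda> \<xi> \<zeta>) :: real) = indicator E (splice \<Lambda> \<xi> \<eta>)" for \<xi>
    using depends_onD[OF E(1), of "splice \<Lambda> \<xi> \<zeta>" "splice \<Lambda> \<xi> \<eta>"] E(2)
    by (auto simp: splice_def indicator_def subset_iff)
  have N: "?N \<zeta> \<le> exp \<delta> * ?N \<eta>"
    unfolding sum_distrib_left mult.assoc[symmetric] i
    by (intro sum_mono mult_right_mono w) auto
  have D: "exp (-\<delta>) * partition_fun \<Lambda> \<eta> \<le> partition_fun \<Lambda> \<zeta>"
    unfolding sum_distrib_left by (intro sum_mono w)
  have "gibbs_kernel \<Phi> \<Lambda> E \<zeta> \<le> (exp \<delta> * ?N \<eta>) / (exp (-\<delta>) * partition_fun \<Lambda> \<eta>)"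
    unfolding gibbs_kernel_def
    by (intro frac_le N D) (use partition_fun_pos[OF \<Lambda>, of \<eta>] in \<open>auto intro!: sum_nonneg mult_nonneg_nonneg\<close>)
  also have "\<dots> = exp (2 * \<delta>) * gibbs_kernel \<Phi> \<Lambda> E \<eta>"
    unfolding gibbs_kernel_def mult_2 exp_add by (simp add: exp_minus field_simps)
  finally show ?thesis .
qed

end


section \<open>The DLR equations and stationarity on local events\<close>

locale gibbs_mixing_field = mixing_field P C1 C2 + interaction \<Phi>
  for P :: "('d::finite) config measure" and C1 C2 and \<Phi> :: "'d site set \<Rightarrow> 'd config \<Rightarrow> real" +
  assumes dlr: "finite \<Lambda> \<Longrightarrow> E \<in> sets P \<Longrightarrow> measure P E = (\<integral>\<eta>. gibbs_kernel \<Phi> \<Lambda> E \<eta> \<partial>P)"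
begin

lemma hamiltonian_splice_measurable:
  assumes \<Lambda>: "finite \<Lambda>"
  shows "(\<lambda>\<eta>. hamiltonian \<Phi> \<Lambda> (splice \<Lambda> \<xi> \<eta>)) \<in> borel_measurable P"
proof -
  have "\<exists>F. finite F \<and> F \<subseteq> touching \<Lambda> \<and>
      (\<forall>\<sigma>. \<bar>hamiltonian \<Phi> \<Lambda> \<sigma> - (\<Sum>A\<in>F. \<Phi> A \<sigma>)\<bar> \<le> 1 / real (Suc j))" for j
    using hamiltonian_approx[OF \<Lambda>, of "1 / real (Suc j)"] by (metis of_nat_0_less_iff zero_less_Suc zero_less_divide_1_iff)
  then obtain F where F: "\<And>j. finite (F j)" "\<And>j. F j \<subseteq> touching \<Lambda>"
      "\<And>j \<sigma>. \<bar>hamiltonian \<Phi> \<Lambda> \<sigma> - (\<Sum>A\<in>F j. \<Phi> A \<sigma>)\<bar> \<le> 1 / real (Suc j)"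
    by metis
  show ?thesis
  proof (rule borel_measurable_LIMSEQ_real)
    fix j
    show "(\<lambda>\<eta>. \<Sum>A\<in>F j. \<Phi> A (splice \<Lambda> \<xi> \<eta>)) \<in> borel_measurable P"
    proof (rule local_fun_measurable)
      show "finite (\<Union>(F j))" using F(1,2) by (auto simp: touching_def)
      fix \<sigma> \<tau> :: "'d config" assume "\<And>x. x \<in> \<Union>(F j) \<Longrightarrow> \<sigma> x = \<tau> x"
      then show "(\<Sum>A\<in>F j. \<Phi> A (splice \<Lambda> \<xi> \<sigma>)) = (\<Sum>A\<in>F j. \<Phi> A (splice \<Lambda> \<xi> \<tau>))"
        by (intro sum_\<Phi>_local[OF F(1,2)]) (simp add: splice_def)
    qed
  next
    fix \<eta>
    have "(\<lambda>j. 1 / real (Suc j)) \<longlonglongrightarrow> 0"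
      using LIMSEQ_inverse_real_of_nat by (simp add: inverse_eq_divide)
    then have "(\<lambda>j. (\<Sum>A\<in>F j. \<Phi> A (splice \<Lambda> \<xi> \<eta>)) - hamiltonian \<Phi> \<Lambda> (splice \<Lambda> \<xi> \<eta>)) \<longlonglongrightarrow> 0"
      by (rule Lim_null_comparison[rotated])
        (use F(3) in \<open>auto simp: abs_minus_commute intro!: always_eventually\<close>)
    then show "(\<lambda>j. \<Sum>A\<in>F j. \<Phi> A (splice \<Lambda> \<xi> \<eta>)) \<longlonglongrightarrow> hamiltonian \<Phi> \<Lambda> (splice \<Lambda> \<xi> \<eta>)"
      by (simp add: LIM_zero_iff)
  qed
qed

lemma gibbs_kernel_measurable:
  assumes \<Lambda>: "finite \<Lambda>" and V: "finite V" "depends_on V E"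
  shows "gibbs_kernel \<Phi> \<Lambda> E \<in> borel_measurable P"
proof -
  have [measurable]: "(\<lambda>\<eta>. hamiltonian \<Phi> \<Lambda> (splice \<Lambda> \<xi> \<eta>)) \<in> borel_measurable P" for \<xi>
    by (rule hamiltonian_splice_measurable[OF \<Lambda>])
  have [measurable]: "(\<lambda>\<eta>. indicator E (splice \<Lambda> \<xi> \<eta>) :: real) \<in> borel_measurable P" for \<xi>
  proof (rule local_fun_measurable[OF V(1)])
    fix \<sigma> \<tau> :: "'d config" assume "\<And>x. x \<in> V \<Longrightarrow> \<sigma> x = \<tau> x"
    then have "splice \<Lambda> \<xi> \<sigma> \<in> E \<longleftrightarrow> splice \<Lambda> \<xi> \<tau> \<in> E"
      by (intro depends_onD[OF V(2)]) (simp add: splice_def)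
    then show "(indicator E (splice \<Lambda> \<xi> \<sigma>) :: real) = indicator E (splice \<Lambda> \<xi> \<tau>)"
      by (simp add: indicator_def)
  qed
  show ?thesis unfolding gibbs_kernel_def[abs_def] by measurable
qed

lemma gibbs_kernel_integrable:
  assumes "finite \<Lambda>" "finite V" "depends_on V E"
  shows "integrable P (gibbs_kernel \<Phi> \<Lambda> E)"
  by (rule integrable_const_bound[where B=1])
    (use gibbs_kernel_measurable[OF assms] gibbs_kernel_bounds[OF assms(1)] in auto)

lemma cylinder_pos:
  assumes "finite V" shows "measure P (cylinder V a) > 0"
proof -
  obtain c where c: "c > 0" "\<And>\<eta>. c \<le> gibbs_kernel \<Phi> V (cylinder V a) \<eta>"
    using gibbs_kernel_cylinder_bound[OF assms] by blast
  have "c = (\<integral>\<eta>. c \<partial>P)" using prob_space by simp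
  also have "\<dots> \<le> (\<integral>\<eta>. gibbs_kernel \<Phi> V (cylinder V a) \<eta> \<partial>P)"
    by (intro integral_mono gibbs_kernel_integrable[OF assms assms depends_on_cylinder] c(2)) simp
  also have "\<dots> = measure P (cylinder V a)"
    using dlr[OF assms depends_on_sets_P[OF assms depends_on_cylinder]] by simp
  finally show ?thesis using c(1) by simp
qed

text \<open>Conditioning on a large finite window outside \<open>\<Lambda>\<close> pins the Gibbs kernel up to an arbitrarily small
  factor, so mixing forces it to be close to \<open>P\<close> for \<^emph>\<open>every\<close> boundary condition. This is the
  uniqueness statement behind the stationarity of \<open>P\<close>.\<close>

lemma gibbs_kernel_close:
  assumes A: "finite A" "A \<subseteq> \<Lambda>" "depends_on A E" and \<Lambda>: "finite \<Lambda>" and m: "m > 0"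
    and far: "\<And>x y. x \<in> A \<Longrightarrow> y \<notin> \<Lambda> \<Longrightarrow> real_of_int (supnorm (vsub x y)) \<ge> m"
  shows "\<bar>gibbs_kernel \<Phi> \<Lambda> E \<eta> - measure P E\<bar> \<le> real (card A) * (C1 * exp (- C2 * m))"
proof -
  let ?e = "real (card A) * (C1 * exp (- C2 * m))" and ?k = "gibbs_kernel \<Phi> \<Lambda> E \<eta>"
  have main: "?k \<le> exp \<delta> * (measure P E + ?e) \<and> measure P E - ?e \<le> exp \<delta> * ?k" if \<delta>: "\<delta> > 0" for \<delta>
  proof -
    obtain W where W: "finite W" "\<Lambda> \<subseteq> W"
      "\<And>\<sigma> \<tau>. (\<And>x. x \<in> W \<Longrightarrow> \<sigma> x = \<tau> x) \<Longrightarrow> \<bar>hamiltonian \<Phi> \<Lambda> \<sigma> - hamiltonian \<Phi> \<Lambda> \<tau>\<bar> \<le> \<delta> / 2"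
      by (rule hamiltonian_quasilocal[OF \<Lambda> half_gt_zero[OF \<delta>]]) blast
    \<comment> \<open>The conditioning event copies \<open>\<eta>\<close> on
      \<open>W - \<Lambda>\<close>. It has positive probability, depends only on sites at distance
      at least \<open>m\<close> from \<open>A\<close>, and fixes the energies in
      \<open>\<Lambda>\<close> up to \<open>\<delta> / 2\<close>.\<close>
    let ?E2 = "cylinder (W - \<Lambda>) \<eta>"
    have fW: "finite (W - \<Lambda>)" using W(1) by simp
    have dE2: "depends_on (W - \<Lambda>) ?E2" by (rule depends_on_cylinder)
    have sE2: "?E2 \<in> sets P" by (rule depends_on_sets_P[OF fW dE2])
    have dI: "depends_on (A \<union> (W - \<Lambda>)) (E \<inter> ?E2)" by (rule depends_on_Int[OF A(3) dE2])
    have fI: "finite (A \<union> (W - \<Lambda>))" using A(1) fW by simp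
    have pos: "measure P ?E2 > 0" by (rule cylinder_pos[OF fW])
    have H: "\<bar>hamiltonian \<Phi> \<Lambda> (splice \<Lambda> \<xi> \<zeta>) - hamiltonian \<Phi> \<Lambda> (splice \<Lambda> \<xi> \<eta>)\<bar> \<le> \<delta> / 2"
      if "\<zeta> \<in> ?E2" for \<zeta> \<xi>
      by (rule W(3)) (use that in \<open>auto simp: splice_def cylinder_def\<close>)
    have up: "gibbs_kernel \<Phi> \<Lambda> E \<zeta> \<le> exp \<delta> * ?k" if "\<zeta> \<in> ?E2" for \<zeta>
      using gibbs_kernel_compare[OF \<Lambda> A(3,2) H[OF that]] by simp
    have lo: "?k \<le> exp \<delta> * gibbs_kernel \<Phi> \<Lambda> E \<zeta>" if "\<zeta> \<in> ?E2" for \<zeta>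
      using gibbs_kernel_compare[OF \<Lambda> A(3,2), of \<eta> \<zeta> "\<delta> / 2"] H[OF that] by (simp add: abs_minus_commute)
    have k2: "gibbs_kernel \<Phi> \<Lambda> (E \<inter> ?E2) = (\<lambda>\<zeta>. gibbs_kernel \<Phi> \<Lambda> E \<zeta> * indicator ?E2 \<zeta>)"
      by (rule ext) (rule gibbs_kernel_Int[OF dE2], blast)
    \<comment> \<open>The DLR equation for the intersection expresses its probability as the
      integral, over the conditioning event, of a kernel that is there nearly constant and close to
      \<open>?k\<close>.\<close>
    have eq: "measure P (E \<inter> ?E2) = (\<integral>\<zeta>. gibbs_kernel \<Phi> \<Lambda> E \<zeta> * indicator ?E2 \<zeta> \<partial>P)"
      using dlr[OF \<Lambda> depends_on_sets_P[OF fI dI]] unfolding k2 .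
    have int: "integrable P (\<lambda>\<zeta>. gibbs_kernel \<Phi> \<Lambda> E \<zeta> * indicator ?E2 \<zeta>)"
      using gibbs_kernel_integrable[OF \<Lambda> fI dI] unfolding k2 .
    have int2: "integrable P (\<lambda>\<zeta>. c * indicator ?E2 \<zeta> :: real)" for c
      using sE2 by (simp add: integrable_real_indicator emeasure_finite less_top[symmetric])
    have "measure P (E \<inter> ?E2) \<le> (\<integral>\<zeta>. (exp \<delta> * ?k) * indicator ?E2 \<zeta> \<partial>P)"
      unfolding eq by (intro integral_mono int int2) (use up in \<open>auto simp: indicator_def\<close>)
    then have u: "measure P (E \<inter> ?E2) \<le> exp \<delta> * ?k * measure P ?E2" using sE2 by simp
    have "(\<integral>\<zeta>. ?k * indicator ?E2 \<zeta> \<partial>P) \<le> (\<integral>\<zeta>. exp \<delta> * (gibbs_kernel \<Phi> \<Lambda> E \<zeta> * indicator ?E2 \<zeta>) \<partial>P)"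
      by (intro integral_mono integrable_mult_right int int2) (use lo in \<open>auto simp: indicator_def\<close>)
    then have l: "?k * measure P ?E2 \<le> exp \<delta> * measure P (E \<inter> ?E2)" unfolding eq using sE2 by simp
    have "setdist_ge A (W - \<Lambda>) m" using far by (auto simp: setdist_ge_def)
    from mixing_bound[OF A(1) fW this m A(3) dE2]
    have mb: "\<bar>measure P (E \<inter> ?E2) - measure P E * measure P ?E2\<bar> \<le> measure P ?E2 * ?e" .
    have "measure P (E \<inter> ?E2) \<le> (measure P E + ?e) * measure P ?E2"
      using mb by (simp add: algebra_simps abs_le_iff)
    then have "?k * measure P ?E2 \<le> exp \<delta> * ((measure P E + ?e) * measure P ?E2)"
      using l by (meson exp_ge_zero mult_left_mono order_trans)
    then have 1: "?k \<le> exp \<delta> * (measure P E + ?e)"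
      using pos unfolding mult.assoc[symmetric] by (simp add: mult_le_cancel_right)
    have "(measure P E - ?e) * measure P ?E2 \<le> exp \<delta> * ?k * measure P ?E2"
      using mb u by (simp add: algebra_simps abs_le_iff)
    then have "measure P E - ?e \<le> exp \<delta> * ?k"
      using pos by (simp add: mult_le_cancel_right)
    with 1 show ?thesis by blast
  qed
  \<comment> \<open>Now \<open>\<delta>\<close> tends to 0. The window \<open>W\<close> grows
    meanwhile, but \<open>?e\<close> involves neither \<open>\<delta>\<close> nor
    \<open>W\<close>.\<close>
  have "?k \<le> measure P E + ?e" by (rule le_if_le_exp_mult) (use main in blast)
  moreover have "measure P E - ?e \<le> ?k" by (rule le_if_le_exp_mult) (use main in blast)
  ultimately show ?thesis by (simp add: abs_le_iff)
qed

text \<open>By \<open>gibbs_kernel_close\<close> each probability is near a Gibbs kernel with an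
  arbitrary boundary condition. The kernel of \<open>\<Lambda>\<close> with boundary
  \<open>shift x undefined\<close> and that of the translate of \<open>\<Lambda>\<close> with
  boundary \<open>undefined\<close> are the same number. Letting the collar width \<open>m\<close>
  grow removes the error.\<close>

lemma local_stationary:
  assumes A: "finite A" "depends_on A E"
  shows "measure P {\<sigma>. shift x \<sigma> \<in> E} = measure P E"
proof -
  let ?E' = "{\<sigma>. shift x \<sigma> \<in> E}"
  have bound: "\<bar>measure P ?E' - measure P E\<bar> \<le> 2 * real (card A) * C1 * exp (- C2) ^ Suc m" for m
  proof -
    define \<Lambda> where "\<Lambda> = (\<Union>a\<in>A. {y. \<forall>i. a i - int m \<le> y i \<and> y i \<le> a i + int m})"
    have "{y. \<forall>i. a i - int m \<le> y i \<and> y i \<le> a i + int m} = PiE UNIV (\<lambda>i. {a i - int m .. a i + int m})"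
      for a :: "'d site" by auto
    then have \<Lambda>: "finite \<Lambda>" unfolding \<Lambda>_def using A(1) by (auto intro!: finite_PiE)
    have sub: "A \<subseteq> \<Lambda>" unfolding \<Lambda>_def by force
    have far: "real_of_int (supnorm (vsub a y)) \<ge> real (Suc m)" if ay: "a \<in> A" "y \<notin> \<Lambda>" for a y
    proof -
      obtain i where "\<not> (a i - int m \<le> y i \<and> y i \<le> a i + int m)" using ay unfolding \<Lambda>_def by blast
      then have "int (Suc m) \<le> \<bar>vsub a y i\<bar>" unfolding vsub_def by linarith
      then have "int (Suc m) \<le> supnorm (vsub a y)" unfolding supnorm_ge_iff by blast
      then show ?thesis by linarith
    qed
    have vs: "vsub (vsub a x) (vsub y x) = vsub a y" for a y :: "'d site" by (simp add: vsub_def)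
    have "\<bar>gibbs_kernel \<Phi> \<Lambda> E (shift x undefined) - measure P E\<bar> \<le> real (card A) * (C1 * exp (- C2 * real (Suc m)))"
      by (rule gibbs_kernel_close[OF A(1) sub A(2) \<Lambda>]) (use far in auto)
    moreover have "\<bar>gibbs_kernel \<Phi> (translate \<Lambda> x) ?E' undefined - measure P ?E'\<bar>
        \<le> real (card (translate A x)) * (C1 * exp (- C2 * real (Suc m)))"
    proof (rule gibbs_kernel_close)
      show "translate A x \<subseteq> translate \<Lambda> x" using sub by (auto simp: translate_def)
      show "depends_on (translate A x) ?E'" by (rule depends_on_shift[OF A(2)])
      fix a y assume "a \<in> translate A x" "y \<notin> translate \<Lambda> x"
      then have "vsub a x \<in> A" "vsub y x \<notin> \<Lambda>" by (simp_all add: mem_translate)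
      from far[OF this] show "real_of_int (supnorm (vsub a y)) \<ge> real (Suc m)" by (simp add: vs)
    qed (use A(1) \<Lambda> in auto)
    moreover have "real (card (translate A x)) * (C1 * exp (- C2 * real (Suc m))) \<le> real (card A) * (C1 * exp (- C2 * real (Suc m)))"
      using C1 A(1) by (intro mult_right_mono) (auto simp: translate_def card_image_le)
    moreover have "exp (- C2 * real (Suc m)) = exp (- C2) ^ Suc m"
      by (metis exp_of_nat_mult mult.commute)
    ultimately show ?thesis unfolding gibbs_kernel_translate by (simp add: abs_le_iff)
  qed
  have "(\<lambda>m. exp (- C2) ^ Suc m) \<longlonglongrightarrow> 0"
    using C2 by (intro LIMSEQ_Suc[OF LIMSEQ_realpow_zero]) auto
  then have "(\<lambda>m. 2 * real (card A) * C1 * exp (- C2) ^ Suc m) \<longlonglongrightarrow> 2 * real (card A) * C1 * 0"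
    by (intro tendsto_mult_left)
  then have "\<bar>measure P ?E' - measure P E\<bar> \<le> 0"
    using bound by (intro tendsto_lowerbound[where F=sequentially]) auto
  then show ?thesis by simp
qed

end

text \<open>Interface for all that follows: the Gibbs structure is used from here on only through
  positivity of cylinders and stationarity on local events.\<close>

locale stationary_mixing_field = mixing_field P C1 C2
  for P :: "('d::finite) config measure" and C1 C2 +
  assumes cylinder_pos: "finite V \<Longrightarrow> measure P (cylinder V a) > 0"
    and local_stationary: "finite V \<Longrightarrow> depends_on V E \<Longrightarrow> measure P {\<sigma>. shift x \<sigma> \<in> E} = measure P E"

lemma gibbs_mixing_stationary:
  assumes "gibbs_measure P" "nonunif_exp_phi_mixing P"
  obtains C1 C2 where "stationary_mixing_field P C1 C2"
proof -
  obtain \<Phi> where \<Phi>: "potential \<Phi>" "\<And>\<Lambda> E. finite \<Lambda> \<Longrightarrow> E \<in> sets P \<Longrightarrow>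
      measure P E = (\<integral>\<eta>. gibbs_kernel \<Phi> \<Lambda> E \<eta> \<partial>P)" and P: "prob_space P" "sets P = sets config_space"
    using assms(1) unfolding gibbs_measure_def by blast
  obtain C1 C2 where C: "C1 > 0" "C2 > 0" "\<And>m. m > 0 \<Longrightarrow> phi_mix P m \<le> C1 * exp (- C2 * m)"
    using assms(2) unfolding nonunif_exp_phi_mixing_def by blast
  interpret gibbs_mixing_field P C1 C2 \<Phi>
    using P C \<Phi> by (simp add: gibbs_mixing_field_def mixing_field_def config_measure_def
      mixing_field_axioms_def config_measure_axioms_def interaction_def gibbs_mixing_field_axioms_def)
  have "stationary_mixing_field P C1 C2"
    by unfold_locales (use cylinder_pos local_stationary in blast)+
  then show ?thesis using that by blast
qed

section \<open>Exponential smallness of good pattern probabilities\<close>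

text \<open>The quadratic Taylor lower bound for \<open>exp s\<close> is inverted by means of (1 - s
  + s^2/2) (1 + s + s^2/2) = 1 + s^4/4.\<close>

lemma one_minus_exp_lower: "s - s\<^sup>2 / 2 \<le> 1 - exp (- s)" if "0 \<le> s" for s :: real
proof -
  have "1 \<le> 1 + s ^ 4 / 4" by simp
  also have "\<dots> = (1 - s + s\<^sup>2 / 2) * (1 + s + s\<^sup>2 / 2)"
    by (simp add: algebra_simps power2_eq_square power4_eq_xxxx)
  also have "\<dots> \<le> (1 - s + s\<^sup>2 / 2) * exp s"
  proof (rule mult_left_mono[OF exp_lower_Taylor_quadratic[OF that]])
    have "0 \<le> (1 - s)\<^sup>2" by simp
    then show "0 \<le> 1 - s + s\<^sup>2 / 2" by (simp add: power2_eq_square algebra_simps)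
  qed
  finally have "exp (- s) \<le> 1 - s + s\<^sup>2 / 2"
    by (simp add: exp_minus inverse_eq_divide divide_le_eq)
  then show ?thesis by simp
qed

section \<open>Mismatches, sparse sublattices and good patterns\<close>

lemma Delta_cong: "(\<And>x. x \<in> V \<Longrightarrow> \<sigma> x = \<tau> x) \<Longrightarrow> Delta V \<sigma> A = Delta V \<tau> A"
  unfolding Delta_def by (rule sum.cong) auto

lemma depends_on_approx_ball:
  fixes A :: "'d config"
  shows "depends_on (cube n) (approx_ball n \<epsilon> A)"
  unfolding depends_on_def
proof (intro allI impI)
  fix \<sigma> \<tau> :: "'d config" assume "\<forall>x\<in>cube n. \<sigma> x = \<tau> x"
  then have "Delta (cube n) \<sigma> A = Delta (cube n) \<tau> A" by (intro Delta_cong) blast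
  then show "\<sigma> \<in> approx_ball n \<epsilon> A \<longleftrightarrow> \<tau> \<in> approx_ball n \<epsilon> A" by (simp add: approx_ball_def)
qed

definition mismatch :: "'d config \<Rightarrow> 'd site \<Rightarrow> 'd config set" where
  "mismatch A y = {\<sigma>. \<sigma> y \<noteq> A y}"

lemma depends_on_mismatch: "depends_on {y} (mismatch A y)"
  by (auto simp: depends_on_def mismatch_def)

lemma Delta_mismatch: "Delta V \<sigma> A = (\<Sum>y\<in>V. indicator (mismatch A y) \<sigma>)"
  unfolding Delta_def by (rule sum.cong) (auto simp: mismatch_def indicator_def)

definition separated :: "nat \<Rightarrow> ('d::finite) site set \<Rightarrow> bool" where
  "separated m V \<longleftrightarrow> (\<forall>x\<in>V. \<forall>y\<in>V. x \<noteq> y \<longrightarrow> int m \<le> supnorm (vsub x y))"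

text \<open>The part of a coset of the sublattice m Z^d that lies in the cube; its points are far
  enough apart for mixing to be effective.\<close>

definition residue_class :: "nat \<Rightarrow> nat \<Rightarrow> 'd site \<Rightarrow> 'd site set" where
  "residue_class n m c = {y \<in> cube n. (\<lambda>i. y i mod int m) = c}"

lemma finite_residue_class [simp]: "finite (residue_class n m c :: ('d::finite) site set)"
  by (simp add: residue_class_def)

lemma separated_residue_class: "separated m (residue_class n m c :: ('d::finite) site set)"
  unfolding separated_def
proof (intro ballI impI)
  fix x y :: "'d site" assume x: "x \<in> residue_class n m c" and y: "y \<in> residue_class n m c" and "x \<noteq> y"
  then obtain i where i: "x i \<noteq> y i" by blast
  have "x i mod int m = y i mod int m"
    using x y unfolding residue_class_def by (metis (mono_tags, lifting) mem_Collect_eq)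
  then have "int m dvd x i - y i" by (simp add: mod_eq_dvd_iff)
  then have "int m \<le> \<bar>x i - y i\<bar>" using i dvd_imp_le_int[of "x i - y i" "int m"] by simp
  then show "int m \<le> supnorm (vsub x y)" unfolding supnorm_ge_iff vsub_def by blast
qed

text \<open>The points \<open>m z + c\<close> with \<open>z\<close> in a box of side
  \<open>Suc n div m\<close> fit into the cube, which has n + 1 sites in each direction.\<close>

lemma card_residue_class:
  assumes m: "m > 0" and c: "c \<in> box m"
  shows "(Suc n div m) ^ CARD('d) \<le> card (residue_class n m c :: ('d::finite) site set)"
proof -
  let ?h = "\<lambda>z i. int m * z i + c i"
  have c': "0 \<le> c i" "c i < int m" for i using c by (auto simp: box_def)
  have "inj_on ?h (box (Suc n div m))"
    using m by (auto simp: inj_on_def fun_eq_iff)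
  moreover have "?h ` box (Suc n div m) \<subseteq> (residue_class n m c :: 'd site set)"
  proof clarify
    fix z :: "'d site" assume z: "z \<in> box (Suc n div m)"
    have "0 \<le> int m * z i + c i \<and> int m * z i + c i \<le> int n" for i
    proof -
      have "0 \<le> z i" "z i < int (Suc n div m)" using z unfolding box_def by blast+
      then have "z i + 1 \<le> int (Suc n div m)" by (intro zless_imp_add1_zle)
      then have "int m * (z i + 1) \<le> int m * int (Suc n div m)" by (intro mult_left_mono) auto
      also have "\<dots> \<le> int (Suc n)" using times_div_less_eq_dividend[of m "Suc n"] by (metis of_nat_le_iff of_nat_mult)
      finally show ?thesis using c'[of i] \<open>0 \<le> z i\<close> by (simp add: algebra_simps)
    qed
    then show "?h z \<in> residue_class n m c"
      using c' by (auto simp: residue_class_def cube_def fun_eq_iff)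
  qed
  ultimately have "card (box (Suc n div m) :: 'd site set) \<le> card (residue_class n m c :: 'd site set)"
    by (intro card_inj_on_le) auto
  then show ?thesis by (simp add: card_box)
qed

lemma sum_residue_classes:
  assumes "m > 0"
  shows "(\<Sum>c\<in>box m. \<Sum>y\<in>residue_class n m c. f y) = (\<Sum>y\<in>(cube n :: ('d::finite) site set). f y)"
  unfolding residue_class_def
  by (rule sum.group[OF finite_cube finite_box]) (use assms in \<open>auto simp: box_def\<close>)

text \<open>The premise \<open>1 \<le> \<alpha> * real n\<close> puts the vector with all
  coordinates 1 among the tested translations.\<close>

lemma good_const_notin_ball:
  assumes "good n \<epsilon> \<alpha> (A :: ('d::finite) config)" "1 \<le> \<alpha> * real n"
  shows "(\<lambda>_. b) \<notin> approx_ball n \<epsilon> A"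
proof
  assume *: "(\<lambda>_. b) \<in> approx_ball n \<epsilon> A"
  have "supnorm ((\<lambda>_. 1) :: 'd site) = 1" by (simp add: supnorm_def)
  then have "approx_ball n \<epsilon> A \<inter> shifted_ball (\<lambda>_. 1) n \<epsilon> A = {}"
    using assms unfolding good_def by simp
  moreover have "(\<lambda>_. b) \<in> shifted_ball (\<lambda>_. 1) n \<epsilon> A"
    using * by (simp add: shifted_ball_def shift_def)
  ultimately show False using * by blast
qed

section \<open>A Chernoff bound for the number of mismatches\<close>

context stationary_mixing_field
begin

definition density :: real where "density = measure P {\<sigma>. \<sigma> (\<lambda>_. 0)}"

lemma depends_on_site: "depends_on {y} {\<sigma>. \<sigma> y}"
  by (auto simp: depends_on_def)

lemma prob_site: "measure P {\<sigma>. \<sigma> y} = density"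
proof -
  have "{\<sigma>. \<sigma> y} = {\<sigma>. shift y \<sigma> \<in> {\<sigma>. \<sigma> (\<lambda>_. 0)}}" by (simp add: shift_def vadd_def)
  then show ?thesis
    unfolding density_def using local_stationary[OF _ depends_on_site, of "\<lambda>_. 0" y] by simp
qed

lemma prob_mismatch: "measure P (mismatch A y) = (if A y then 1 - density else density)"
proof (cases "A y")
  case True
  have "{\<sigma>. \<sigma> y} \<in> sets P" by (rule depends_on_sets_P[OF _ depends_on_site]) simp
  then have "measure P (space P - {\<sigma>. \<sigma> y}) = 1 - measure P {\<sigma>. \<sigma> y}" by (rule prob_compl)
  moreover have "mismatch A y = space P - {\<sigma>. \<sigma> y}" using True by (auto simp: mismatch_def)
  ultimately show ?thesis using True prob_site by simp
next
  case False
  then show ?thesis using prob_site by (simp add: mismatch_def)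
qed

lemma density_bounds: "0 < density" "density < 1"
proof -
  have "measure P (cylinder {\<lambda>_. 0} (\<lambda>_. True)) > 0" by (rule cylinder_pos) simp
  moreover have "cylinder {\<lambda>_. 0} (\<lambda>_. True) = {\<sigma> :: 'd config. \<sigma> (\<lambda>_. 0)}" by (auto simp: cylinder_def)
  ultimately show "0 < density" by (simp add: density_def)
  have "measure P (cylinder {\<lambda>_. 0} (\<lambda>_. False)) > 0" by (rule cylinder_pos) simp
  moreover have "cylinder {\<lambda>_. 0} (\<lambda>_. False) = mismatch (\<lambda>_. True) ((\<lambda>_. 0) :: 'd site)"
    by (auto simp: cylinder_def mismatch_def)
  ultimately show "density < 1" by (simp add: prob_mismatch)
qed

text \<open>Sites are added one at a time, using exp (- s 1_E) = 1 - (1 - exp (- s)) 1_E. With the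
  new site as first region, \<open>mixing_bound_fun\<close> decouples it at the cost
  \<open>C1 * exp (- C2 * real m)\<close>, however large \<open>V\<close> already is.\<close>

lemma mismatch_mgf:
  assumes "finite V" "separated m V" "m > 0" "0 \<le> s"
  shows "(\<integral>\<sigma>. exp (- s * (\<Sum>y\<in>V. indicator (mismatch A y) \<sigma>)) \<partial>P)
     \<le> exp (\<Sum>y\<in>V. s\<^sup>2 / 2 + s * (C1 * exp (- C2 * real m)) - s * measure P (mismatch A y))"
  using assms(1,2)
proof (induction V rule: finite_induct)
  case empty
  then show ?case using prob_space by simp
next
  case (insert y V)
  let ?g = "\<lambda>\<sigma>. exp (- s * (\<Sum>y\<in>V. indicator (mismatch A y) \<sigma>))"
  let ?\<phi> = "C1 * exp (- C2 * real m)" and ?q = "measure P (mismatch A y)"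
  have sep: "separated m V" using insert.prems by (auto simp: separated_def)
  have dist: "setdist_ge {y} V (real m)"
    using insert.prems insert.hyps unfolding setdist_ge_def separated_def
    by (metis insertCI insertE of_int_le_iff of_int_of_nat_eq singletonD)
  have local: "?g \<sigma> = ?g \<tau>" if "\<And>x. x \<in> V \<Longrightarrow> \<sigma> x = \<tau> x" for \<sigma> \<tau>
  proof -
    have "(\<Sum>y\<in>V. indicator (mismatch A y) \<sigma>) = (\<Sum>y\<in>V. indicator (mismatch A y) \<tau> :: real)"
      by (rule sum.cong[OF refl]) (use that in \<open>simp add: mismatch_def indicator_def\<close>)
    then show ?thesis by simp
  qed
  have sets: "mismatch A y \<in> sets P" by (rule depends_on_sets_P[OF _ depends_on_mismatch]) simp
  have int1: "integrable P (\<lambda>\<sigma>. ?g \<sigma> * indicator (mismatch A y) \<sigma>)"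
    by (rule local_fun_integral(1)[OF insert.hyps(1) local sets])
  have int2: "integrable P ?g"
    using local_fun_integral(1)[OF insert.hyps(1) local sets.top] by simp
  have "exp (- s * (\<Sum>y\<in>insert y V. indicator (mismatch A y) \<sigma>))
      = ?g \<sigma> - (1 - exp (- s)) * (?g \<sigma> * indicator (mismatch A y) \<sigma>)" for \<sigma>
    using insert.hyps by (cases "\<sigma> \<in> mismatch A y") (simp_all add: algebra_simps exp_add exp_diff exp_minus field_simps)
  then have "(\<integral>\<sigma>. exp (- s * (\<Sum>y\<in>insert y V. indicator (mismatch A y) \<sigma>)) \<partial>P)
      = (\<integral>\<sigma>. ?g \<sigma> \<partial>P) - (1 - exp (- s)) * (\<integral>\<sigma>. ?g \<sigma> * indicator (mismatch A y) \<sigma> \<partial>P)"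
    using int1 int2 by (simp add: Bochner_Integration.integral_diff)
  also have "\<dots> \<le> (\<integral>\<sigma>. ?g \<sigma> \<partial>P) - (1 - exp (- s)) * ((?q - ?\<phi>) * (\<integral>\<sigma>. ?g \<sigma> \<partial>P))"
  proof -
    have "(?q - ?\<phi>) * (\<integral>\<sigma>. ?g \<sigma> \<partial>P) \<le> (\<integral>\<sigma>. ?g \<sigma> * indicator (mismatch A y) \<sigma> \<partial>P)"
      using mixing_bound_fun[OF _ insert.hyps(1) dist _ depends_on_mismatch local] \<open>m > 0\<close> by simp
    then show ?thesis using \<open>0 \<le> s\<close> by (intro diff_left_mono mult_left_mono) auto
  qed
  also have "\<dots> = (\<integral>\<sigma>. ?g \<sigma> \<partial>P) * (1 - (1 - exp (- s)) * (?q - ?\<phi>))" by (simp add: algebra_simps)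
  also have "\<dots> \<le> (\<integral>\<sigma>. ?g \<sigma> \<partial>P) * exp (s\<^sup>2 / 2 + s * ?\<phi> - s * ?q)"
  proof (rule mult_left_mono)
    have "(s - s\<^sup>2 / 2) * ?q \<le> (1 - exp (- s)) * ?q"
      by (intro mult_right_mono one_minus_exp_lower \<open>0 \<le> s\<close>) simp
    moreover have "s\<^sup>2 / 2 * ?q \<le> s\<^sup>2 / 2 * 1" by (intro mult_left_mono) auto
    moreover have "(1 - exp (- s)) * ?\<phi> \<le> s * ?\<phi>"
      using C1 exp_ge_add_one_self[of "- s"] by (intro mult_right_mono) auto
    ultimately have "1 - (1 - exp (- s)) * (?q - ?\<phi>) \<le> 1 + (s\<^sup>2 / 2 + s * ?\<phi> - s * ?q)"
      by (simp add: algebra_simps)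
    also have "\<dots> \<le> exp (s\<^sup>2 / 2 + s * ?\<phi> - s * ?q)" by (rule exp_ge_add_one_self)
    finally show "1 - (1 - exp (- s)) * (?q - ?\<phi>) \<le> exp (s\<^sup>2 / 2 + s * ?\<phi> - s * ?q)" .
  qed simp
  also have "\<dots> \<le> exp (\<Sum>y\<in>V. s\<^sup>2 / 2 + s * ?\<phi> - s * measure P (mismatch A y)) * exp (s\<^sup>2 / 2 + s * ?\<phi> - s * ?q)"
    by (intro mult_right_mono insert.IH[OF sep]) simp
  also have "\<dots> = exp (\<Sum>y\<in>insert y V. s\<^sup>2 / 2 + s * ?\<phi> - s * measure P (mismatch A y))"
    using insert.hyps by (simp add: exp_add[symmetric] algebra_simps)
  finally show ?case .
qed

lemma mismatch_lower_tail:
  assumes V: "finite V" "separated m V" "m > 0" and \<gamma>: "\<gamma> > 0" "C1 * exp (- C2 * real m) \<le> \<gamma> / 4"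
  shows "measure P {\<sigma>. (\<Sum>y\<in>V. indicator (mismatch A y) \<sigma>) \<le> (\<Sum>y\<in>V. measure P (mismatch A y) - \<gamma>)}
    \<le> exp (- (\<gamma>\<^sup>2 / 4) * real (card V))"
proof -
  let ?X = "\<lambda>\<sigma>. (\<Sum>y\<in>V. indicator (mismatch A y) \<sigma> :: real)"
  let ?\<mu> = "(\<Sum>y\<in>V. measure P (mismatch A y) - \<gamma>)" and ?\<phi> = "C1 * exp (- C2 * real m)"
  \<comment> \<open>Chernoff parameter: the mixing error is at most \<open>\<gamma> / 4\<close>, so
    the exponent per site is at most \<gamma>^2/8 + \<gamma>^2/8 - \<gamma>^2/2 = -
    \<gamma>^2/4.\<close>
  define s where "s = \<gamma> / 2"
  have s: "s \<ge> 0" using \<gamma> by (simp add: s_def)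
  have local: "?X \<sigma> = ?X \<tau>" if "\<And>x. x \<in> V \<Longrightarrow> \<sigma> x = \<tau> x" for \<sigma> \<tau>
    by (rule sum.cong[OF refl]) (use that in \<open>simp add: mismatch_def indicator_def\<close>)
  have local2: "exp (- s * ?X \<sigma>) = exp (- s * ?X \<tau>)" if "\<And>x. x \<in> V \<Longrightarrow> \<sigma> x = \<tau> x" for \<sigma> \<tau>
    using local[OF that] by simp
  have "depends_on V {\<sigma>. ?X \<sigma> \<le> ?\<mu>}"
    unfolding depends_on_def using local by (metis mem_Collect_eq)
  then have sets: "{\<sigma>. ?X \<sigma> \<le> ?\<mu>} \<in> sets P" by (rule depends_on_sets_P[OF V(1)])
  have int: "integrable P (\<lambda>\<sigma>. exp (- s * ?X \<sigma>))"
    using local_fun_integral(1)[OF V(1) local2 sets.top] by simp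
  have "measure P {\<sigma>. ?X \<sigma> \<le> ?\<mu>} = (\<integral>\<sigma>. indicator {\<sigma>. ?X \<sigma> \<le> ?\<mu>} \<sigma> \<partial>P)" using sets by simp
  also have "\<dots> \<le> (\<integral>\<sigma>. exp (s * ?\<mu>) * exp (- s * ?X \<sigma>) \<partial>P)"
  proof (intro integral_mono integrable_mult_right int)
    show "integrable P (\<lambda>\<sigma>. indicator {\<sigma>. ?X \<sigma> \<le> ?\<mu>} \<sigma> :: real)"
      using sets by (simp add: integrable_real_indicator emeasure_finite less_top[symmetric])
    fix \<sigma>
    show "(indicator {\<sigma>. ?X \<sigma> \<le> ?\<mu>} \<sigma> :: real) \<le> exp (s * ?\<mu>) * exp (- s * ?X \<sigma>)"
      using mult_left_mono[OF _ s, of "?X \<sigma>" ?\<mu>] by (auto simp: indicator_def exp_add[symmetric])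
  qed
  also have "\<dots> = exp (s * ?\<mu>) * (\<integral>\<sigma>. exp (- s * ?X \<sigma>) \<partial>P)" by simp
  also have "\<dots> \<le> exp (s * ?\<mu>) * exp (\<Sum>y\<in>V. s\<^sup>2 / 2 + s * ?\<phi> - s * measure P (mismatch A y))"
    by (intro mult_left_mono mismatch_mgf V s) simp
  also have "\<dots> = exp (\<Sum>y\<in>V. s\<^sup>2 / 2 + s * ?\<phi> - s * \<gamma>)"
    by (simp add: exp_add[symmetric] sum_distrib_left sum.distrib[symmetric] algebra_simps del: sum.distrib sum_constant sum_subtractf)
  also have "\<dots> \<le> exp (\<Sum>y\<in>V. - (\<gamma>\<^sup>2 / 4))"
  proof -
    have "s * ?\<phi> \<le> s * (\<gamma> / 4)" using \<gamma>(2) s by (rule mult_left_mono)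
    then have "s\<^sup>2 / 2 + s * ?\<phi> - s * \<gamma> \<le> - (\<gamma>\<^sup>2 / 4)"
      by (simp add: s_def power2_eq_square algebra_simps)
    then show ?thesis by (subst exp_le_cancel_iff) (rule sum_mono)
  qed
  finally show ?thesis by (simp add: mult.commute)
qed

text \<open>Too few mismatches in the whole cube force a deficit in at least one residue class. The
  union bound over the classes produces the prefactor.\<close>

lemma ball_upper_bound:
  assumes m: "m > 0" and \<gamma>: "\<gamma> > 0" "C1 * exp (- C2 * real m) \<le> \<gamma> / 4"
    and mean: "(\<epsilon> + \<gamma>) * real (card (cube n :: 'd site set)) \<le> (\<Sum>y\<in>cube n. measure P (mismatch A y))"
  shows "measure P (approx_ball n \<epsilon> A) \<le> real m ^ CARD('d) * exp (- (\<gamma>\<^sup>2 / 4) * real (Suc n div m) ^ CARD('d))"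
proof -
  let ?X = "\<lambda>c \<sigma>. (\<Sum>y\<in>residue_class n m c. indicator (mismatch A y) \<sigma> :: real)"
  let ?\<mu> = "\<lambda>c. (\<Sum>y\<in>residue_class n m c. measure P (mismatch A y) - \<gamma>)"
  let ?T = "\<lambda>c. {\<sigma>. ?X c \<sigma> \<le> ?\<mu> c}"
  have sets: "?T c \<in> sets P" for c
  proof (rule depends_on_sets_P[of "residue_class n m c"])
    have "?X c \<sigma> = ?X c \<tau>" if "\<forall>x\<in>residue_class n m c. \<sigma> x = \<tau> x" for \<sigma> \<tau>
      by (rule sum.cong[OF refl]) (use that in \<open>simp add: mismatch_def indicator_def\<close>)
    then show "depends_on (residue_class n m c) (?T c)" unfolding depends_on_def by (metis mem_Collect_eq)
  qed simp
  have "approx_ball n \<epsilon> A \<subseteq> (\<Union>c\<in>box m. ?T c)"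
  proof (rule subsetI, rule ccontr)
    fix \<sigma> assume \<sigma>: "\<sigma> \<in> approx_ball n \<epsilon> A" and "\<sigma> \<notin> (\<Union>c\<in>box m. ?T c)"
    then have gt: "?\<mu> c < ?X c \<sigma>" if "c \<in> box m" for c using that by force
    have "(\<lambda>_. 0) \<in> (box m :: 'd site set)" using m by (simp add: box_def)
    then have "(\<Sum>c\<in>(box m :: 'd site set). ?\<mu> c) < (\<Sum>c\<in>box m. ?X c \<sigma>)"
      by (intro sum_strict_mono gt) auto
    then have "(\<Sum>y\<in>cube n. measure P (mismatch A y) - \<gamma>) < Delta (cube n) \<sigma> A"
      unfolding sum_residue_classes[OF m] Delta_mismatch .
    then show False using mean \<sigma> by (simp add: sum_subtractf approx_ball_def algebra_simps)
  qed
  then have "measure P (approx_ball n \<epsilon> A) \<le> measure P (\<Union>c\<in>box m. ?T c)"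
    using sets by (intro finite_measure_mono) auto
  also have "\<dots> \<le> (\<Sum>c\<in>box m. measure P (?T c))"
    by (rule finite_measure_subadditive_finite) (use sets in auto)
  also have "\<dots> \<le> (\<Sum>c\<in>(box m :: 'd site set). exp (- (\<gamma>\<^sup>2 / 4) * real (Suc n div m) ^ CARD('d)))"
  proof (rule sum_mono)
    fix c :: "'d site" assume c: "c \<in> box m"
    have "measure P (?T c) \<le> exp (- (\<gamma>\<^sup>2 / 4) * real (card (residue_class n m c)))"
      by (rule mismatch_lower_tail[OF finite_residue_class separated_residue_class m \<gamma>])
    also have "\<dots> \<le> exp (- (\<gamma>\<^sup>2 / 4) * real (Suc n div m) ^ CARD('d))"
    proof -
      have "real ((Suc n div m) ^ CARD('d)) \<le> real (card (residue_class n m c))"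
        using card_residue_class[OF m c] of_nat_le_iff by blast
      then have "\<gamma>\<^sup>2 / 4 * real (Suc n div m) ^ CARD('d) \<le> \<gamma>\<^sup>2 / 4 * real (card (residue_class n m c))"
        by (intro mult_left_mono) auto
      then show ?thesis by simp
    qed
    finally show "measure P (?T c) \<le> exp (- (\<gamma>\<^sup>2 / 4) * real (Suc n div m) ^ CARD('d))" .
  qed
  finally show ?thesis by (simp add: card_box)
qed

text \<open>In the proof \<open>k True\<close> counts the zeros of \<open>A\<close> and
  \<open>k False\<close> its ones. Both exceed \<epsilon> N, and the two excesses add up to (1 - 2
  \<epsilon>) N. The mean mismatch minus \<epsilon> N is the combination of these excesses with
  weights \<open>density\<close> and \<open>1 - density\<close>.\<close>

lemma good_mean_mismatch:
  assumes g: "good n \<epsilon> \<alpha> (A :: 'd config)" "1 \<le> \<alpha> * real n"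
  shows "\<epsilon> < 1 / 2"
    and "(\<epsilon> + min density (1 - density) * (1 - 2 * \<epsilon>)) * real (card (cube n :: 'd site set))
      \<le> (\<Sum>y\<in>cube n. measure P (mismatch A y))"
proof -
  let ?N = "real (card (cube n :: 'd site set))" and ?\<delta> = "min density (1 - density)"
  define k where "k = (\<lambda>b. Delta (cube n) (\<lambda>_. b) A)"
  have k: "\<epsilon> * ?N < k b" for b
    using good_const_notin_ball[OF g, of b] by (simp add: approx_ball_def k_def)
  have sum: "k True + k False = ?N"
  proof -
    have "k True + k False = (\<Sum>y\<in>(cube n :: 'd site set). 1)"
      unfolding k_def Delta_def sum.distrib[symmetric] by (rule sum.cong) auto
    then show ?thesis by simp
  qed
  then have "2 * \<epsilon> * ?N < 1 * ?N" using k[of True] k[of False] by linarith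
  then show "\<epsilon> < 1 / 2" using mult_right_less_imp_less[of "2 * \<epsilon>" ?N 1] by simp
  have "(\<Sum>y\<in>cube n. measure P (mismatch A y)) = (1 - density) * k False + density * k True"
    unfolding k_def Delta_def sum_distrib_left sum.distrib[symmetric]
    by (rule sum.cong) (auto simp: prob_mismatch)
  moreover have "?\<delta> * (k False - \<epsilon> * ?N) \<le> (1 - density) * (k False - \<epsilon> * ?N)"
    using k[of False] by (intro mult_right_mono) auto
  moreover have "?\<delta> * (k True - \<epsilon> * ?N) \<le> density * (k True - \<epsilon> * ?N)"
    using k[of True] by (intro mult_right_mono) auto
  moreover have "?\<delta> * (k False - \<epsilon> * ?N) + ?\<delta> * (k True - \<epsilon> * ?N) = ?\<delta> * (1 - 2 * \<epsilon>) * ?N"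
    unfolding distrib_left[symmetric] using sum by (simp add: algebra_simps)
  ultimately show "(\<epsilon> + ?\<delta> * (1 - 2 * \<epsilon>)) * ?N \<le> (\<Sum>y\<in>cube n. measure P (mismatch A y))"
    by (simp add: algebra_simps)
qed

lemma good_ball_small:
  assumes "\<alpha> > 0"
  obtains K n0 where "K > 0"
    "\<And>n A. n \<ge> n0 \<Longrightarrow> good n \<epsilon> \<alpha> A \<Longrightarrow> measure P (approx_ball n \<epsilon> A) \<le> exp (- K * real n ^ CARD('d))"
proof (cases "\<epsilon> < 1 / 2")
  case False
  \<comment> \<open>For \<epsilon> at least 1/2 no pattern is good once \<alpha> n reaches 1, so the
    claim is vacuous for such \<open>n\<close>.\<close>
  show ?thesis
  proof (rule that[of 1 "nat \<lceil>1 / \<alpha>\<rceil>"])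
    fix n and A :: "'d config" assume "n \<ge> nat \<lceil>1 / \<alpha>\<rceil>" and g: "good n \<epsilon> \<alpha> A"
    then have "1 \<le> \<alpha> * real n" using assms by (simp add: field_simps nat_le_iff ceiling_le_iff)
    then show "measure P (approx_ball n \<epsilon> A) \<le> exp (- 1 * real n ^ CARD('d))"
      using good_mean_mismatch(1)[OF g] False by blast
  qed simp
next
  case True
  let ?D = "CARD('d)"
  define \<gamma> where "\<gamma> = min density (1 - density) * (1 - 2 * \<epsilon>)"
  have \<gamma>: "\<gamma> > 0" using True density_bounds by (simp add: \<gamma>_def)
  have "(\<lambda>m. C1 * exp (- C2 * real m)) \<longlonglongrightarrow> C1 * 0"
  proof (intro tendsto_mult_left)
    have "(\<lambda>m. exp (- C2) ^ m) \<longlonglongrightarrow> 0" using C2 by (intro LIMSEQ_realpow_zero) auto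
    moreover have "(\<lambda>m. exp (- C2) ^ m) = (\<lambda>m. exp (- C2 * real m))"
      by (rule ext) (metis exp_of_nat_mult mult.commute)
    ultimately show "(\<lambda>m. exp (- C2 * real m)) \<longlonglongrightarrow> 0" by simp
  qed
  then have "\<forall>\<^sub>F m in sequentially. C1 * exp (- C2 * real m) < \<gamma> / 4"
    using \<gamma> by (intro order_tendstoD(2)) auto
  then obtain m0 where m0: "\<And>m. m \<ge> m0 \<Longrightarrow> C1 * exp (- C2 * real m) < \<gamma> / 4"
    by (auto simp: eventually_sequentially)
  define m where "m = Suc m0"
  have m: "m > 0" "C1 * exp (- C2 * real m) \<le> \<gamma> / 4" using m0[of m] by (auto simp: m_def)
  define K where "K = \<gamma>\<^sup>2 / 4 / (2 * real m) ^ ?D"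
  have K: "K > 0" using \<gamma> m(1) by (simp add: K_def)
  \<comment> \<open>The terms ensure, in order, that \<open>Suc n div m\<close> is at least
    \<open>n / (2 * m)\<close>, that \<alpha> n is at least 1, and that half of the exponent absorbs
    the union bound factor \<open>real m ^ ?D\<close>.\<close>
  define n0 where "n0 = Suc (2 * m + nat \<lceil>1 / \<alpha>\<rceil> + nat \<lceil>real ?D * ln (real m) * 2 / K\<rceil>)"
  show ?thesis
  proof (rule that[of "K / 2" n0])
    show "K / 2 > 0" using K by simp
    fix n and A :: "'d config" assume n: "n \<ge> n0" and g: "good n \<epsilon> \<alpha> A"
    have n1: "n \<ge> 1" "2 * m \<le> n" "1 / \<alpha> \<le> real n" "real ?D * ln (real m) * 2 / K \<le> real n"
      using n unfolding n0_def by linarith+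
    have "1 \<le> \<alpha> * real n" using n1(3) assms by (simp add: field_simps)
    from good_mean_mismatch(2)[OF g this]
    have "measure P (approx_ball n \<epsilon> A) \<le> real m ^ ?D * exp (- (\<gamma>\<^sup>2 / 4) * real (Suc n div m) ^ ?D)"
      by (intro ball_upper_bound[OF m(1) \<gamma> m(2)]) (simp add: \<gamma>_def)
    also have "\<dots> \<le> real m ^ ?D * exp (- K * real n ^ ?D)"
    proof -
      have "real n / (2 * real m) \<le> real (Suc n div m)"
      proof -
        have "real (Suc n) / real m - 1 < real (Suc n div m)"
          by (metis floor_divide_of_nat_eq diff_less_eq floor_less_iff less_add_one of_int_of_nat_eq real_of_int_floor_gt_diff_one)
        moreover have "real n / (2 * real m) \<le> real (Suc n) / real m - 1"
        proof -
          have "2 * real m \<le> real n" using n1(2) by linarith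
          then show ?thesis using m(1) by (simp add: field_simps)
        qed
        ultimately show ?thesis by linarith
      qed
      then have "(real n / (2 * real m)) ^ ?D \<le> real (Suc n div m) ^ ?D" by (intro power_mono) auto
      then have "\<gamma>\<^sup>2 / 4 * (real n / (2 * real m)) ^ ?D \<le> \<gamma>\<^sup>2 / 4 * real (Suc n div m) ^ ?D"
        by (intro mult_left_mono) auto
      then have "K * real n ^ ?D \<le> \<gamma>\<^sup>2 / 4 * real (Suc n div m) ^ ?D"
        by (simp add: K_def power_divide)
      then show ?thesis by (intro mult_left_mono) auto
    qed
    also have "\<dots> \<le> exp (K / 2 * real n ^ ?D) * exp (- K * real n ^ ?D)"
    proof (rule mult_right_mono)
      have "real n \<le> real n ^ ?D" using n1(1) by (intro self_le_power) auto
      then have "K / 2 * real n \<le> K / 2 * real n ^ ?D" using K by (intro mult_left_mono) auto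
      moreover have "real ?D * ln (real m) \<le> K / 2 * real n" using n1(4) K by (simp add: field_simps)
      ultimately have "exp (real ?D * ln (real m)) \<le> exp (K / 2 * real n ^ ?D)" by simp
      then show "real m ^ ?D \<le> exp (K / 2 * real n ^ ?D)" using m(1) by (simp add: exp_of_nat_mult)
    qed simp
    also have "\<dots> = exp (- (K / 2) * real n ^ ?D)" by (simp add: exp_add[symmetric])
    finally show "measure P (approx_ball n \<epsilon> A) \<le> exp (- (K / 2) * real n ^ ?D)" .
  qed
qed

end

section \<open>Block decomposition and second moments\<close>

definition avoid :: "'d config set \<Rightarrow> 'd site set \<Rightarrow> 'd config set" where
  "avoid B X = {\<sigma>. \<forall>x\<in>X. shift x \<sigma> \<notin> B}"

text \<open>\<open>avoid B X\<close> is indexed by positions of the lower corner of a pattern; these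
  are the sites that such an event reads.\<close>

definition sumset_cube :: "nat \<Rightarrow> ('d::finite) site set \<Rightarrow> 'd site set" where
  "sumset_cube n X = (\<Union>x\<in>X. translate (cube n) x)"

text \<open>Used with period \<open>F = f + m\<close>, which leaves corridors of width
  \<open>m\<close> between blocks of side \<open>f\<close>.\<close>

definition block :: "nat \<Rightarrow> nat \<Rightarrow> ('d::finite) site \<Rightarrow> 'd site set" where
  "block f F b = translate (box f) (\<lambda>i. int F * b i)"

lemma finite_sumset_cube [simp]: "finite X \<Longrightarrow> finite (sumset_cube n X)"
  by (simp add: sumset_cube_def)

lemma card_translate: "card (translate A x) = card A"
  unfolding translate_def by (rule card_image) (auto simp: inj_on_def vadd_def fun_eq_iff)

lemma card_sumset_cube:
  assumes "finite X"
  shows "card (sumset_cube n (X :: ('d::finite) site set)) \<le> card X * (n + 1) ^ CARD('d)"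
proof -
  have "card (sumset_cube n X) \<le> (\<Sum>x\<in>X. card (translate (cube n) x))"
    unfolding sumset_cube_def by (rule card_UN_le[OF assms])
  then show ?thesis by (simp add: card_translate card_cube)
qed

lemma shift_vadd: "shift x (shift v \<sigma>) = shift (vadd x v) \<sigma>"
  by (simp add: shift_def vadd_def add.assoc)

lemma depends_on_avoid:
  fixes X :: "('d::finite) site set"
  assumes "depends_on (cube n) B"
  shows "depends_on (sumset_cube n X) (avoid B X)"
  unfolding depends_on_def
proof (intro allI impI)
  fix \<sigma> \<tau> :: "'d config" assume *: "\<forall>y\<in>sumset_cube n X. \<sigma> y = \<tau> y"
  have "shift x \<sigma> \<in> B \<longleftrightarrow> shift x \<tau> \<in> B" if "x \<in> X" for x
    by (rule depends_onD[OF assms]) (use * that in \<open>auto simp: sumset_cube_def translate_def shift_def\<close>)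
  then show "\<sigma> \<in> avoid B X \<longleftrightarrow> \<tau> \<in> avoid B X" by (simp add: avoid_def)
qed

lemma avoid_Un: "avoid B (X \<union> Y) = avoid B X \<inter> avoid B Y"
  by (auto simp: avoid_def)

lemma avoid_translate: "avoid B (translate X v) = {\<sigma>. shift v \<sigma> \<in> avoid B X}"
  by (simp add: avoid_def translate_def shift_vadd)

text \<open>Two points of a cube differ by at most \<open>n\<close> in each coordinate, so passing
  from positions to sites costs \<open>n\<close> in distance.\<close>

lemma setdist_sumset_cube:
  assumes "\<And>x y. x \<in> X \<Longrightarrow> y \<in> Y \<Longrightarrow> real_of_int (supnorm (vsub x y)) \<ge> real n + h"
  shows "setdist_ge (sumset_cube n X) (sumset_cube n Y) h"
  unfolding setdist_ge_def
proof (intro ballI)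
  fix x' y' assume "x' \<in> sumset_cube n X" "y' \<in> sumset_cube n Y"
  then obtain x y where xy: "x \<in> X" "vsub x' x \<in> cube n" "y \<in> Y" "vsub y' y \<in> cube n"
    by (auto simp: sumset_cube_def mem_translate)
  have "real_of_int (supnorm (vsub x y)) \<ge> real n + h" by (rule assms[OF xy(1,3)])
  moreover obtain i where i: "supnorm (vsub x y) \<le> \<bar>vsub x y i\<bar>"
    using supnorm_ge_iff[of "supnorm (vsub x y)" "vsub x y"] by auto
  moreover have "0 \<le> x' i - x i" "x' i - x i \<le> int n" "0 \<le> y' i - y i" "y' i - y i \<le> int n"
    using xy(2,4) by (simp_all add: cube_def vsub_def)
  then have "\<bar>vsub x y i\<bar> \<le> int n + \<bar>vsub x' y' i\<bar>" by (simp add: vsub_def)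
  moreover have "\<bar>vsub x' y' i\<bar> \<le> supnorm (vsub x' y')" by (rule supnorm_ge)
  ultimately show "h \<le> real_of_int (supnorm (vsub x' y'))" by linarith
qed

lemma block_separated:
  assumes "b \<noteq> b'" "x \<in> block f (f + m) b" "y \<in> block f (f + m) b'"
  shows "int m < supnorm (vsub x y)"
proof -
  obtain i where i: "b i \<noteq> b' i" using assms(1) by blast
  let ?F = "int (f + m)"
  have x: "0 \<le> x i - ?F * b i" "x i - ?F * b i < int f" and y: "0 \<le> y i - ?F * b' i" "y i - ?F * b' i < int f"
    using assms(2,3) by (auto simp: block_def mem_translate box_def vsub_def)
  have "?F * 1 \<le> ?F * \<bar>b i - b' i\<bar>" using i by (intro mult_left_mono) auto
  also have "\<dots> = \<bar>?F * b i - ?F * b' i\<bar>" by (simp add: abs_mult right_diff_distrib[symmetric])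
  finally have F: "?F \<le> \<bar>?F * b i - ?F * b' i\<bar>" by simp
  have "int m < \<bar>s - t\<bar>" if "int f + int m \<le> \<bar>u - v\<bar>" "0 \<le> s - u" "s - u < int f" "0 \<le> t - v" "t - v < int f"
    for s t u v using that by linarith
  from this[OF F[unfolded of_nat_add] x[unfolded of_nat_add] y[unfolded of_nat_add]]
  have "int m < \<bar>x i - y i\<bar>" .
  then have "int m + 1 \<le> \<bar>vsub x y i\<bar>" by (simp add: vsub_def)
  then show ?thesis using supnorm_ge[of "vsub x y" i] by linarith
qed

lemma finite_block [simp]: "finite (block f F b)"
  by (simp add: block_def)

lemma card_block: "card (block f F b :: ('d::finite) site set) = f ^ CARD('d)"
  by (simp add: block_def card_translate card_box)

lemma card_UN_blocks:
  "card (\<Union>b\<in>(box q :: ('d::finite) site set). block f (f + m) b) = q ^ CARD('d) * f ^ CARD('d)"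
proof -
  have "block f (f + m) b \<inter> block f (f + m) b' = {}" if "b \<noteq> b'" for b b' :: "'d site"
  proof (rule ccontr)
    assume "block f (f + m) b \<inter> block f (f + m) b' \<noteq> {}"
    then obtain x where "x \<in> block f (f + m) b" "x \<in> block f (f + m) b'" by blast
    from block_separated[OF that this] show False by (simp add: vsub_def supnorm_def)
  qed
  then have "card (\<Union>b\<in>(box q :: 'd site set). block f (f + m) b) = (\<Sum>b\<in>(box q :: 'd site set). card (block f (f + m) b))"
    by (intro card_UN_disjoint) auto
  then show ?thesis by (simp add: card_block card_box)
qed

lemma UN_blocks_subset_box:
  assumes "q * (f + m) \<le> L"
  shows "(\<Union>b\<in>box q. block f (f + m) b) \<subseteq> (box L :: ('d::finite) site set)"
proof clarify
  fix b x :: "'d site" assume b: "b \<in> box q" and x: "x \<in> block f (f + m) b"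
  let ?F = "int (f + m)"
  have "0 \<le> x i \<and> x i < int L" for i
  proof -
    have bi: "0 \<le> b i" "b i + 1 \<le> int q" using b unfolding box_def by (auto simp: zless_imp_add1_zle)
    have xi: "0 \<le> x i - ?F * b i" "x i - ?F * b i < int f"
      using x by (auto simp: block_def mem_translate box_def vsub_def)
    have "?F * (b i + 1) \<le> ?F * int q" by (intro mult_left_mono bi) auto
    also have "\<dots> = int (q * (f + m))" by (simp add: mult.commute)
    also have "\<dots> \<le> int L" using assms of_nat_le_iff by blast
    finally have "?F * b i + ?F \<le> int L" by (simp add: algebra_simps)
    moreover have "0 \<le> ?F * b i" using bi by simp
    ultimately show ?thesis using xi by linarith
  qed
  then show "x \<in> box L" by (simp add: box_def)
qed

section \<open>Exponential sums over the lattice and a packing bound\<close>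

lemma sum_exp_abs_le:
  assumes "c > 0"
  shows "(\<Sum>j\<in>{- int R..int R}. exp (- c * \<bar>real_of_int j\<bar>)) \<le> 2 / (1 - exp (- c))"
proof -
  have r: "0 < exp (- c)" "exp (- c) < 1" using assms by auto
  have "j \<in> int ` {..R} \<union> (\<lambda>k. - int k) ` {..R}" if "j \<in> {- int R..int R}" for j
  proof (cases "j \<ge> 0")
    case True
    then have "j = int (nat j)" "nat j \<in> {..R}" using that by auto
    then show ?thesis by blast
  next
    case False
    then have "j = - int (nat (- j))" "nat (- j) \<in> {..R}" using that by auto
    then show ?thesis by blast
  qed
  then have "{- int R..int R} \<subseteq> int ` {..R} \<union> (\<lambda>k. - int k) ` {..R}" by (rule subsetI)
  then have "(\<Sum>j\<in>{- int R..int R}. exp (- c * \<bar>real_of_int j\<bar>))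
      \<le> (\<Sum>j\<in>int ` {..R} \<union> (\<lambda>k. - int k) ` {..R}. exp (- c * \<bar>real_of_int j\<bar>))"
    by (intro sum_mono2) auto
  also have "\<dots> \<le> (\<Sum>j\<in>int ` {..R}. exp (- c * \<bar>real_of_int j\<bar>)) + (\<Sum>j\<in>(\<lambda>k. - int k) ` {..R}. exp (- c * \<bar>real_of_int j\<bar>))"
    by (simp add: sum_Un sum_nonneg)
  also have "\<dots> = 2 * (\<Sum>k\<le>R. exp (- c) ^ k)"
    by (simp add: sum.reindex inj_on_def exp_of_nat_mult[symmetric] mult.commute)
  also have "(\<Sum>k\<le>R. exp (- c) ^ k) \<le> 1 / (1 - exp (- c))"
  proof -
    have "(\<Sum>k\<le>R. exp (- c) ^ k) = (1 - exp (- c) ^ Suc R) / (1 - exp (- c))"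
      using r sum_gp_basic[of "exp (- c)" R] by (simp add: field_simps)
    also have "\<dots> \<le> 1 / (1 - exp (- c))" using r by (intro divide_right_mono) auto
    finally show ?thesis .
  qed
  finally show ?thesis by simp
qed

text \<open>The sup norm dominates the average of the absolute coordinates. The summand is thus at
  most a product of one-dimensional exponentials of rate \<open>c / real CARD('d)\<close>, and the
  sum over a large box factorises.\<close>

lemma sum_exp_supnorm_le:
  assumes c: "c > 0" and X: "finite (X :: ('d::finite) site set)"
  shows "(\<Sum>y\<in>X. exp (- c * real_of_int (supnorm y))) \<le> (2 / (1 - exp (- c / real CARD('d)))) ^ CARD('d)"
proof -
  let ?D = "CARD('d)"
  define c' where "c' = c / real ?D"
  have c': "c' > 0" using c by (simp add: c'_def)
  define R where "R = nat (Max (insert 0 (supnorm ` X)))"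
  have R: "supnorm y \<le> int R" if "y \<in> X" for y
  proof -
    have "supnorm y \<le> Max (insert 0 (supnorm ` X))" using X that by (intro Max_ge) auto
    then show ?thesis by (simp add: R_def)
  qed
  have sub: "X \<subseteq> PiE UNIV (\<lambda>_. {- int R..int R})"
  proof
    fix y assume "y \<in> X"
    then have "\<bar>y i\<bar> \<le> int R" for i using R supnorm_ge[of y i] by force
    then have "- int R \<le> y i \<and> y i \<le> int R" for i by (simp add: abs_le_iff minus_le_iff)
    then show "y \<in> PiE UNIV (\<lambda>_. {- int R..int R})" by (simp add: PiE_iff)
  qed
  have le: "exp (- c * real_of_int (supnorm y)) \<le> (\<Prod>i\<in>UNIV. exp (- c' * \<bar>real_of_int (y i)\<bar>))" for y :: "'d site"
  proof -
    have "(\<Sum>i\<in>(UNIV :: 'd set). \<bar>real_of_int (y i)\<bar>) \<le> (\<Sum>i\<in>(UNIV :: 'd set). real_of_int (supnorm y))"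
      by (rule sum_mono) (metis of_int_abs of_int_le_iff supnorm_ge)
    then have "c' * (\<Sum>i\<in>(UNIV :: 'd set). \<bar>real_of_int (y i)\<bar>) \<le> c' * (real ?D * real_of_int (supnorm y))"
      using c' by (intro mult_left_mono) auto
    also have "\<dots> = c * real_of_int (supnorm y)" by (simp add: c'_def)
    finally have "- c * real_of_int (supnorm y) \<le> (\<Sum>i\<in>UNIV. - c' * \<bar>real_of_int (y i)\<bar>)"
      by (simp add: sum_negf sum_distrib_left)
    then have "exp (- c * real_of_int (supnorm y)) \<le> exp (\<Sum>i\<in>UNIV. - c' * \<bar>real_of_int (y i)\<bar>)" by simp
    then show ?thesis by (simp only: exp_sum[OF finite])
  qed
  have "(\<Sum>y\<in>X. exp (- c * real_of_int (supnorm y)))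
      \<le> (\<Sum>y\<in>PiE (UNIV :: 'd set) (\<lambda>_. {- int R..int R}). \<Prod>i\<in>UNIV. exp (- c' * \<bar>real_of_int (y i)\<bar>))"
  proof -
    have "(\<Sum>y\<in>X. exp (- c * real_of_int (supnorm y))) \<le> (\<Sum>y\<in>X. \<Prod>i\<in>UNIV. exp (- c' * \<bar>real_of_int (y i)\<bar>))"
      by (intro sum_mono le)
    also have "\<dots> \<le> (\<Sum>y\<in>PiE (UNIV :: 'd set) (\<lambda>_. {- int R..int R}). \<Prod>i\<in>UNIV. exp (- c' * \<bar>real_of_int (y i)\<bar>))"
      by (intro sum_mono2 sub finite_PiE prod_nonneg) auto
    finally show ?thesis .
  qed
  also have "\<dots> = (\<Prod>i\<in>(UNIV :: 'd set). \<Sum>j\<in>{- int R..int R}. exp (- c' * \<bar>real_of_int j\<bar>))"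
    by (rule prod_sum_PiE[symmetric]) auto
  also have "\<dots> = (\<Sum>j\<in>{- int R..int R}. exp (- c' * \<bar>real_of_int j\<bar>)) ^ ?D" by simp
  also have "\<dots> \<le> (2 / (1 - exp (- c'))) ^ ?D"
    by (intro power_mono sum_exp_abs_le c' sum_nonneg) auto
  finally show ?thesis by (simp add: c'_def)
qed

text \<open>A grid cell of side \<open>s\<close> contains at most one point of an
  \<open>s\<close>-separated set, and \<open>2 * r div s + 1\<close> cells per coordinate cover the
  ball.\<close>

lemma card_separated_le:
  assumes "s > 0" and Z: "Z \<subseteq> {y :: ('d::finite) site. supnorm (vsub y x) \<le> int r}" and sep: "separated s Z"
  shows "card Z \<le> (2 * r div s + 1) ^ CARD('d)"
proof -
  let ?h = "\<lambda>y i. (y i - x i + int r) div int s"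
  have "inj_on ?h Z"
  proof (rule inj_onI, rule ccontr)
    fix y z assume yz: "y \<in> Z" "z \<in> Z" "?h y = ?h z" "y \<noteq> z"
    then have "int s \<le> supnorm (vsub y z)" using sep by (auto simp: separated_def)
    then obtain i where i: "int s \<le> \<bar>y i - z i\<bar>" unfolding supnorm_ge_iff vsub_def by blast
    let ?a = "y i - x i + int r" and ?b = "z i - x i + int r"
    have "?a div int s = ?b div int s" using yz(3) by meson
    then have "?a - ?b = ?a mod int s - ?b mod int s"
      by (metis add_diff_cancel_left mult_div_mod_eq)
    moreover have "0 \<le> ?a mod int s" "?a mod int s < int s" "0 \<le> ?b mod int s" "?b mod int s < int s"
      using assms(1) by simp_all
    ultimately have "\<bar>?a - ?b\<bar> < int s" by linarith
    then show False using i by simp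
  qed
  moreover have "?h ` Z \<subseteq> box (2 * r div s + 1)"
  proof clarify
    fix y assume "y \<in> Z"
    then have "supnorm (vsub y x) \<le> int r" using Z by blast
    then have r: "\<bar>y i - x i\<bar> \<le> int r" for i unfolding supnorm_le_iff vsub_def by blast
    have b: "0 \<le> y i - x i + int r \<and> y i - x i + int r \<le> int (2 * r)" for i
      using r[of i] by linarith
    have "0 \<le> ?h y i \<and> ?h y i < int (2 * r div s + 1)" for i
    proof
      show "0 \<le> ?h y i" using b[of i] assms(1) by (simp add: pos_imp_zdiv_nonneg_iff)
      have "?h y i \<le> int (2 * r) div int s" using b[of i] assms(1) by (intro zdiv_mono1) auto
      also have "\<dots> = int (2 * r div s)" by (simp add: zdiv_int)
      finally show "?h y i < int (2 * r div s + 1)" by simp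
    qed
    then show "?h y \<in> box (2 * r div s + 1)" unfolding box_def by blast
  qed
  ultimately have "card Z \<le> card (box (2 * r div s + 1) :: 'd site set)"
    by (intro card_inj_on_le) auto
  then show ?thesis by (simp only: card_box)
qed

section \<open>Near independence of separated blocks\<close>

context stationary_mixing_field
begin

lemma avoid_sets: "depends_on (cube n) B \<Longrightarrow> finite X \<Longrightarrow> avoid B X \<in> sets P"
  using depends_on_sets_P depends_on_avoid finite_sumset_cube by blast

lemma prob_avoid_translate:
  "depends_on (cube n) B \<Longrightarrow> finite X \<Longrightarrow> measure P (avoid B (translate X v)) = measure P (avoid B X)"
  unfolding avoid_translate by (rule local_stationary[OF finite_sumset_cube depends_on_avoid])

lemma prob_occurrence: "depends_on (cube n) B \<Longrightarrow> measure P {\<sigma>. shift x \<sigma> \<in> B} = measure P B"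
  by (rule local_stationary[OF finite_cube])

lemma occurrence_sets: "depends_on (cube n) B \<Longrightarrow> {\<sigma>. shift x \<sigma> \<in> B} \<in> sets P"
  using depends_on_sets_P[OF finite_translate[OF finite_cube] depends_on_shift] by blast

lemma avoid_mixing:
  assumes B: "depends_on (cube n) B" and X: "finite X" and Y: "finite Y" and h: "h > 0"
    and far: "\<And>x y. x \<in> X \<Longrightarrow> y \<in> Y \<Longrightarrow> real n + h \<le> real_of_int (supnorm (vsub x y))"
  shows "\<bar>measure P (avoid B (X \<union> Y)) - measure P (avoid B X) * measure P (avoid B Y)\<bar>
    \<le> measure P (avoid B Y) * (real (card X) * real (n + 1) ^ CARD('d) * (C1 * exp (- C2 * h)))"
proof -
  have "\<bar>measure P (avoid B (X \<union> Y)) - measure P (avoid B X) * measure P (avoid B Y)\<bar>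
      \<le> measure P (avoid B Y) * (real (card (sumset_cube n X)) * (C1 * exp (- C2 * h)))"
    unfolding avoid_Un
    by (rule mixing_bound[OF _ _ setdist_sumset_cube h depends_on_avoid[OF B] depends_on_avoid[OF B]])
      (use X Y far in auto)
  also have "\<dots> \<le> measure P (avoid B Y) * (real (card X * (n + 1) ^ CARD('d)) * (C1 * exp (- C2 * h)))"
    using C1 card_sumset_cube[OF X, of n] by (intro mult_left_mono mult_right_mono) (auto simp del: of_nat_mult)
  finally show ?thesis by simp
qed

text \<open>Splitting off one block costs \<open>e\<close> times the probability for the remaining
  ones, and \<open>e\<close> involves that one block only. Keeping this factor gives the geometric
  bound, which decays for long times; replacing it by 1 gives the additive bound, which is precise
  for moderate times.\<close>

lemma avoid_blocks:
  fixes f :: nat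
  assumes B: "depends_on (cube n) B" and h: "h > 0" and S: "finite S"
  defines "e \<equiv> real f ^ CARD('d) * real (n + 1) ^ CARD('d) * (C1 * exp (- C2 * real h))"
    and "g \<equiv> measure P (avoid B (box f))"
    and "p \<equiv> \<lambda>S. measure P (avoid B (\<Union>b\<in>S. block f (f + (n + h)) b))"
  shows "p S \<le> (g + e) ^ card S" "\<bar>p S - g ^ card S\<bar> \<le> real (card S) * e"
proof -
  have e: "e \<ge> 0" using C1 by (simp add: e_def)
  have step: "\<bar>p (insert b S) - g * p S\<bar> \<le> p S * e" if "finite S" "b \<notin> S" for b S
  proof -
    have far: "real n + real h \<le> real_of_int (supnorm (vsub x y))"
      if x: "x \<in> block f (f + (n + h)) b" and y: "y \<in> (\<Union>b\<in>S. block f (f + (n + h)) b)" for x y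
    proof -
      obtain b' where b': "b' \<in> S" "y \<in> block f (f + (n + h)) b'" using y by blast
      then have "b \<noteq> b'" using \<open>b \<notin> S\<close> by blast
      from block_separated[OF this x b'(2)] have "int (n + h) < supnorm (vsub x y)" .
      then show ?thesis by linarith
    qed
    let ?X = "block f (f + (n + h)) b" and ?Y = "\<Union>b\<in>S. block f (f + (n + h)) b"
    have g: "measure P (avoid B ?X) = g"
      unfolding block_def g_def by (rule prob_avoid_translate[OF B finite_box])
    have "\<bar>measure P (avoid B (?X \<union> ?Y)) - measure P (avoid B ?X) * measure P (avoid B ?Y)\<bar>
        \<le> measure P (avoid B ?Y) * (real (card ?X) * real (n + 1) ^ CARD('d) * (C1 * exp (- C2 * real h)))"
      by (rule avoid_mixing[OF B]) (use that h far in auto)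
    then show ?thesis by (simp add: p_def e_def card_block g)
  qed
  have p0: "p S \<ge> 0" "p S \<le> 1" for S by (auto simp: p_def)
  have g0: "0 \<le> g" "g \<le> 1" by (auto simp: g_def)
  from S show "p S \<le> (g + e) ^ card S"
  proof (induction S rule: finite_induct)
    case empty
    then show ?case using p0 by simp
  next
    case (insert b S)
    have "p (insert b S) \<le> (g + e) * p S" using step[OF insert.hyps] by (simp add: abs_le_iff algebra_simps)
    also have "\<dots> \<le> (g + e) * (g + e) ^ card S" using g0 e by (intro mult_left_mono insert.IH) auto
    finally show ?case using insert.hyps by simp
  qed
  from S show "\<bar>p S - g ^ card S\<bar> \<le> real (card S) * e"
  proof (induction S rule: finite_induct)
    case empty
    have "avoid B {} = space P" by (simp add: avoid_def)
    then show ?case using prob_space by (simp add: p_def)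
  next
    case (insert b S)
    have "\<bar>p (insert b S) - g * p S\<bar> \<le> 1 * e"
      using step[OF insert.hyps] mult_right_mono[OF p0(2)[of S] e] by linarith
    moreover have "\<bar>g * p S - g * g ^ card S\<bar> \<le> 1 * (real (card S) * e)"
      unfolding right_diff_distrib[symmetric] abs_mult using g0 insert.IH e by (intro mult_mono) auto
    ultimately have "\<bar>p (insert b S) - g * g ^ card S\<bar> \<le> e + real (card S) * e" by linarith
    then show ?case using insert.hyps by (simp add: algebra_simps)
  qed
qed

lemma avoid_subset_bounds:
  assumes B: "depends_on (cube n) B" and X: "finite X" and Y: "Y \<subseteq> X"
  shows "measure P (avoid B X) \<le> measure P (avoid B Y)"
    and "measure P (avoid B Y) \<le> measure P (avoid B X) + real (card (X - Y)) * measure P B"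
proof -
  have fY: "finite Y" using X Y finite_subset by blast
  show "measure P (avoid B X) \<le> measure P (avoid B Y)"
    by (rule finite_measure_mono) (use Y avoid_sets[OF B fY] in \<open>auto simp: avoid_def\<close>)
  have sub: "avoid B Y \<subseteq> avoid B X \<union> (\<Union>x\<in>X - Y. {\<sigma>. shift x \<sigma> \<in> B})" by (auto simp: avoid_def)
  have s: "(\<Union>x\<in>X - Y. {\<sigma>. shift x \<sigma> \<in> B}) \<in> sets P"
    using X by (intro sets.finite_UN occurrence_sets[OF B]) auto
  have "measure P (avoid B Y) \<le> measure P (avoid B X \<union> (\<Union>x\<in>X - Y. {\<sigma>. shift x \<sigma> \<in> B}))"
    using sub s avoid_sets[OF B X] by (intro finite_measure_mono) auto
  also have "\<dots> \<le> measure P (avoid B X) + measure P (\<Union>x\<in>X - Y. {\<sigma>. shift x \<sigma> \<in> B})"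
    by (rule measure_Un_le[OF avoid_sets[OF B X] s])
  also have "measure P (\<Union>x\<in>X - Y. {\<sigma>. shift x \<sigma> \<in> B}) \<le> (\<Sum>x\<in>X - Y. measure P {\<sigma>. shift x \<sigma> \<in> B})"
    using X occurrence_sets[OF B] by (intro finite_measure_subadditive_finite) auto
  also have "\<dots> = real (card (X - Y)) * measure P B" by (simp add: prob_occurrence[OF B])
  finally show "measure P (avoid B Y) \<le> measure P (avoid B X) + real (card (X - Y)) * measure P B" by simp
qed

lemma avoid_box_bounds:
  fixes f :: nat
  assumes B: "depends_on (cube n) (B :: 'd config set)" and h: "h > 0" and q: "q * (f + (n + h)) \<le> L"
  defines "e \<equiv> real f ^ CARD('d) * real (n + 1) ^ CARD('d) * (C1 * exp (- C2 * real h))"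
    and "g \<equiv> measure P (avoid B (box f))"
  shows "measure P (avoid B (box L)) \<le> (g + e) ^ (q ^ CARD('d))"
    and "\<bar>measure P (avoid B (box L)) - g ^ (q ^ CARD('d))\<bar>
      \<le> real q ^ CARD('d) * e + (real L ^ CARD('d) - (real q * real f) ^ CARD('d)) * measure P B"
proof -
  let ?U = "\<Union>b\<in>(box q :: 'd site set). block f (f + (n + h)) b"
  have sub: "?U \<subseteq> box L" by (rule UN_blocks_subset_box[OF q])
  have card: "card (box q :: 'd site set) = q ^ CARD('d)" by (rule card_box)
  note bl = avoid_blocks[OF B h finite_box, of f q, unfolded card, folded e_def g_def]
  note sb = avoid_subset_bounds[OF B finite_box sub]
  show "measure P (avoid B (box L)) \<le> (g + e) ^ (q ^ CARD('d))" using bl(1) sb(1) by linarith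
  have "card (box L - ?U) = card (box L :: 'd site set) - card ?U" using sub by (intro card_Diff_subset) auto
  moreover have "card ?U \<le> card (box L :: 'd site set)" using sub by (intro card_mono) auto
  ultimately have "real (card (box L - ?U)) = real L ^ CARD('d) - (real q * real f) ^ CARD('d)"
    by (simp add: card_UN_blocks card_box of_nat_diff power_mult_distrib)
  then show "\<bar>measure P (avoid B (box L)) - g ^ (q ^ CARD('d))\<bar>
      \<le> real q ^ CARD('d) * e + (real L ^ CARD('d) - (real q * real f) ^ CARD('d)) * measure P B"
    using bl(2) sb by (simp add: abs_le_iff)
qed


section \<open>Second moment of the number of occurrences\<close>

lemma occurrences_separated:
  assumes sep: "\<And>x. 0 < supnorm x \<Longrightarrow> real_of_int (supnorm x) \<le> a \<Longrightarrow> B \<inter> {\<sigma>. shift x \<sigma> \<in> B} = {}"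
    and "0 \<le> a"
  shows "separated (Suc (nat \<lfloor>a\<rfloor>)) {y \<in> X. shift y (\<sigma> :: 'd config) \<in> B}"
  unfolding separated_def
proof (intro ballI impI)
  fix x y assume x: "x \<in> {y \<in> X. shift y \<sigma> \<in> B}" and y: "y \<in> {y \<in> X. shift y \<sigma> \<in> B}" and "x \<noteq> y"
  let ?v = "vsub x y"
  have "shift ?v (shift y \<sigma>) = shift x \<sigma>" by (simp add: shift_vadd vadd_def vsub_def)
  then have "shift y \<sigma> \<in> B \<inter> {\<sigma>. shift ?v \<sigma> \<in> B}" using x y by simp
  moreover have "?v \<noteq> (\<lambda>_. 0)" using \<open>x \<noteq> y\<close> by (auto simp: vsub_def fun_eq_iff)
  then have "0 < supnorm ?v" by (rule supnorm_pos)
  ultimately have "\<not> real_of_int (supnorm ?v) \<le> a" using sep[of ?v] by blast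
  then have "\<lfloor>a\<rfloor> < supnorm ?v" by (simp add: floor_less_iff)
  then show "int (Suc (nat \<lfloor>a\<rfloor>)) \<le> supnorm ?v" using \<open>0 \<le> a\<close> by simp
qed

text \<open>For distance r > 2 n the windows are at least r - n apart, and r - n is at least n/2 +
  r/4. The first part of this decay compensates the window size (n + 1)^d, the second is summable
  over \<open>y\<close>.\<close>

lemma occurrences_far:
  assumes B: "depends_on (cube n) (B :: 'd config set)" and far: "2 * int n < supnorm (vsub y x)"
  shows "measure P ({\<sigma>. shift x \<sigma> \<in> B} \<inter> {\<sigma>. shift y \<sigma> \<in> B})
    \<le> measure P B * (measure P B +
        real (n + 1) ^ CARD('d) * exp (- (C2 / 2) * real n) * C1 * exp (- (C2 / 4) * real_of_int (supnorm (vsub y x))))"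
proof -
  let ?r = "real_of_int (supnorm (vsub y x))"
  let ?E = "\<lambda>x. {\<sigma>. shift x \<sigma> \<in> B}"
  have r: "2 * real n < ?r" using far by linarith
  have t: "translate (cube n) z = sumset_cube n {z}" for z :: "'d site" by (simp add: sumset_cube_def)
  have "setdist_ge (translate (cube n) y) (translate (cube n) x) (?r - real n)"
    unfolding t by (rule setdist_sumset_cube) simp
  then have "\<bar>measure P (?E y \<inter> ?E x) - measure P (?E y) * measure P (?E x)\<bar>
      \<le> measure P (?E x) * (real (card (translate (cube n) y)) * (C1 * exp (- C2 * (?r - real n))))"
    by (intro mixing_bound[OF _ _ _ _ depends_on_shift[OF B] depends_on_shift[OF B]]) (use r in auto)
  then have "measure P (?E x \<inter> ?E y) \<le> measure P B * (measure P B + real (n + 1) ^ CARD('d) * (C1 * exp (- C2 * (?r - real n))))"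
    by (simp add: prob_occurrence[OF B] card_translate card_cube Int_commute abs_le_iff algebra_simps)
  also have "\<dots> \<le> measure P B * (measure P B + real (n + 1) ^ CARD('d) * (C1 * exp (- (C2 / 2) * real n - (C2 / 4) * ?r)))"
  proof -
    have "C2 * (2 * real n) \<le> C2 * ?r" using r C2 by (intro mult_left_mono) auto
    then have "- C2 * (?r - real n) \<le> - (C2 / 2) * real n - (C2 / 4) * ?r" by (simp add: algebra_simps)
    then show ?thesis using C1 by (intro mult_left_mono add_left_mono) auto
  qed
  also have "\<dots> = measure P B * (measure P B +
        real (n + 1) ^ CARD('d) * exp (- (C2 / 2) * real n) * C1 * exp (- (C2 / 4) * ?r))"
  proof -
    have "exp (- (C2 / 2) * real n - (C2 / 4) * ?r) = exp (- (C2 / 2) * real n) * exp (- (C2 / 4) * ?r)"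
      by (simp add: exp_add[symmetric])
    then show ?thesis by (simp only: mult_ac)
  qed
  finally show ?thesis .
qed

text \<open>Pairs are not estimated one by one. In every configuration the occurrences are more than
  \<alpha> n apart, so at most (4/\<alpha> + 1)^d of them lie within distance 2 n of
  \<open>x\<close>; this pointwise count is integrated over an occurrence at
  \<open>x\<close>.\<close>

lemma occurrences_near:
  assumes B: "depends_on (cube n) (B :: 'd config set)" and X: "finite X"
    and \<alpha>: "\<alpha> > 0"
    and sep: "\<And>x. 0 < supnorm x \<Longrightarrow> real_of_int (supnorm x) \<le> \<alpha> * real n \<Longrightarrow> B \<inter> {\<sigma>. shift x \<sigma> \<in> B} = {}"
  shows "(\<Sum>y\<in>{y\<in>X. supnorm (vsub y x) \<le> 2 * int n}. measure P ({\<sigma>. shift x \<sigma> \<in> B} \<inter> {\<sigma>. shift y \<sigma> \<in> B}))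
    \<le> measure P B * (4 / \<alpha> + 1) ^ CARD('d)"
proof -
  let ?E = "\<lambda>x. {\<sigma>. shift x \<sigma> \<in> B}" and ?Y = "{y\<in>X. supnorm (vsub y x) \<le> 2 * int n}"
  let ?s = "Suc (nat \<lfloor>\<alpha> * real n\<rfloor>)"
  have count: "(\<Sum>y\<in>?Y. indicator (?E y) \<sigma> :: real) \<le> (4 / \<alpha> + 1) ^ CARD('d)" for \<sigma>
  proof -
    have "(\<Sum>y\<in>?Y. indicator (?E y) \<sigma> :: real) = real (card {y\<in>?Y. shift y \<sigma> \<in> B})"
      using X by (simp add: indicator_def sum.If_cases Int_def)
    also have "card {y\<in>?Y. shift y \<sigma> \<in> B} \<le> (2 * (2 * n) div ?s + 1) ^ CARD('d)"
      by (rule card_separated_le[where x=x])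
        (use occurrences_separated[OF sep, where X="?Y" and \<sigma>=\<sigma>] \<alpha> in auto)
    also have "real ((2 * (2 * n) div ?s + 1) ^ CARD('d)) \<le> (4 / \<alpha> + 1) ^ CARD('d)"
    proof -
      have s: "\<alpha> * real n < real ?s" by (simp add: \<alpha>) linarith
      have "real (2 * (2 * n) div ?s) \<le> real (2 * (2 * n)) / real ?s" by (rule of_nat_div_le_of_nat)
      also have "\<dots> \<le> 4 / \<alpha>"
      proof -
        have "4 * (\<alpha> * real n) \<le> 4 * real ?s" using s by (intro mult_left_mono) auto
        moreover have "real ?s > 0" by simp
        ultimately show ?thesis using \<alpha> by (simp add: field_simps del: of_nat_Suc)
      qed
      finally show ?thesis unfolding of_nat_power by (intro power_mono) auto
    qed
    finally show ?thesis by simp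
  qed
  have sets: "?E x \<inter> ?E y \<in> sets P" for x y using occurrence_sets[OF B] by blast
  have int: "integrable P (\<lambda>\<sigma>. indicator (?E x \<inter> ?E y) \<sigma> :: real)" for y
    using sets[of x y] by (simp add: integrable_real_indicator emeasure_finite less_top[symmetric])
  have "(\<Sum>y\<in>?Y. measure P (?E x \<inter> ?E y)) = (\<integral>\<sigma>. (\<Sum>y\<in>?Y. indicator (?E x \<inter> ?E y) \<sigma>) \<partial>P)"
    using sets by (subst Bochner_Integration.integral_sum[OF int]) simp
  also have "\<dots> \<le> (\<integral>\<sigma>. (4 / \<alpha> + 1) ^ CARD('d) * indicator (?E x) \<sigma> \<partial>P)"
  proof (rule integral_mono)
    show "integrable P (\<lambda>\<sigma>. \<Sum>y\<in>?Y. indicator (?E x \<inter> ?E y) \<sigma> :: real)"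
      by (intro Bochner_Integration.integrable_sum int)
    show "integrable P (\<lambda>\<sigma>. (4 / \<alpha> + 1) ^ CARD('d) * indicator (?E x) \<sigma>)"
      using occurrence_sets[OF B, of x] by (simp add: integrable_real_indicator emeasure_finite less_top[symmetric])
    fix \<sigma>
    show "(\<Sum>y\<in>?Y. indicator (?E x \<inter> ?E y) \<sigma> :: real) \<le> (4 / \<alpha> + 1) ^ CARD('d) * indicator (?E x) \<sigma>"
      using count[of \<sigma>] by (cases "\<sigma> \<in> ?E x") (simp_all add: indicator_inter_arith)
  qed
  also have "\<dots> = measure P B * (4 / \<alpha> + 1) ^ CARD('d)"
    using occurrence_sets[OF B, of x] prob_occurrence[OF B, of x] by simp
  finally show ?thesis .
qed

text \<open>Second moment method for the number N of occurrences in \<open>X\<close>: its mean is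
  |X| P(B), and E N^2 is at most |X| P(B) S with S = M + |X| P(B). In \<open>M\<close> the first
  summand counts near pairs, the second collects the correlations of far pairs.\<close>

lemma hit_probability_lower:
  assumes \<alpha>: "\<alpha> > 0"
  obtains M where "M > 0"
    "\<And>n B X. \<lbrakk>depends_on (cube n) (B :: 'd config set); finite (X :: 'd site set);
      \<And>x. 0 < supnorm x \<Longrightarrow> real_of_int (supnorm x) \<le> \<alpha> * real n \<Longrightarrow> B \<inter> {\<sigma>. shift x \<sigma> \<in> B} = {}\<rbrakk>
      \<Longrightarrow> real (card X) * measure P B / (M + real (card X) * measure P B) \<le> 1 - measure P (avoid B X)"
proof -
  let ?D = "CARD('d)"
  have "(\<lambda>n. real (n + 1) ^ ?D * exp (- (C2 / 2) * real n)) \<longlonglongrightarrow> 0"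
    using C2 by real_asymp
  then have "Bseq (\<lambda>n. real (n + 1) ^ ?D * exp (- (C2 / 2) * real n))"
    by (intro convergent_imp_Bseq convergentI)
  then obtain M2 where M2: "M2 > 0" "\<And>n. real (n + 1) ^ ?D * exp (- (C2 / 2) * real n) \<le> M2"
    unfolding Bseq_def by (metis abs_le_D1 real_norm_def)
  define M3 where "M3 = (2 / (1 - exp (- (C2 / 4) / real ?D))) ^ ?D"
  have M3: "M3 > 0" using C2 by (simp add: M3_def)
  define M where "M = (4 / \<alpha> + 1) ^ ?D + M2 * C1 * M3"
  have M: "M > 0" unfolding M_def using M2 M3 C1 \<alpha> by (intro add_pos_pos mult_pos_pos zero_less_power) auto
  show ?thesis
  proof (rule that[OF M])
    fix n and B :: "'d config set" and X :: "'d site set"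
    assume B: "depends_on (cube n) B" and X: "finite X"
      and sep: "\<And>x. 0 < supnorm x \<Longrightarrow> real_of_int (supnorm x) \<le> \<alpha> * real n \<Longrightarrow> B \<inter> {\<sigma>. shift x \<sigma> \<in> B} = {}"
    let ?E = "\<lambda>x. {\<sigma>. shift x \<sigma> \<in> B}" and ?\<rho> = "measure P B"
    define S where "S = M + real (card X) * ?\<rho>"
    have S: "S > 0" unfolding S_def using M by (intro add_pos_nonneg) auto
    have sets: "?E x \<in> sets P" "?E x \<inter> ?E y \<in> sets P" for x y using occurrence_sets[OF B] by blast+
    have pair: "(\<Sum>y\<in>X. measure P (?E x \<inter> ?E y)) \<le> ?\<rho> * S" for x
    proof -
      let ?N = "{y\<in>X. supnorm (vsub y x) \<le> 2 * int n}" and ?F = "{y\<in>X. \<not> supnorm (vsub y x) \<le> 2 * int n}"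
      have "(\<Sum>y\<in>?F. measure P (?E x \<inter> ?E y)) \<le> (\<Sum>y\<in>?F. ?\<rho> * (?\<rho> + M2 * C1 * exp (- (C2 / 4) * real_of_int (supnorm (vsub y x)))))"
      proof (rule sum_mono)
        fix y assume "y \<in> ?F"
        then have "2 * int n < supnorm (vsub y x)" by simp
        from occurrences_far[OF B this]
        show "measure P (?E x \<inter> ?E y) \<le> ?\<rho> * (?\<rho> + M2 * C1 * exp (- (C2 / 4) * real_of_int (supnorm (vsub y x))))"
          using C1 M2(2)[of n]
          by (elim order_trans) (intro mult_left_mono add_left_mono mult_right_mono, auto)
      qed
      also have "\<dots> \<le> (\<Sum>y\<in>X. ?\<rho> * (?\<rho> + M2 * C1 * exp (- (C2 / 4) * real_of_int (supnorm (vsub y x)))))"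
        using X C1 M2 by (intro sum_mono2 mult_nonneg_nonneg add_nonneg_nonneg) auto
      also have "\<dots> = ?\<rho> * (real (card X) * ?\<rho> + M2 * C1 * (\<Sum>y\<in>X. exp (- (C2 / 4) * real_of_int (supnorm (vsub y x)))))"
        by (simp add: sum_distrib_left[symmetric] sum.distrib)
      also have "\<dots> \<le> ?\<rho> * (real (card X) * ?\<rho> + M2 * C1 * M3)"
      proof -
        have "(\<Sum>y\<in>X. exp (- (C2 / 4) * real_of_int (supnorm (vsub y x))))
            = (\<Sum>z\<in>(\<lambda>y. vsub y x) ` X. exp (- (C2 / 4) * real_of_int (supnorm z)))"
          by (subst sum.reindex) (auto simp: inj_on_def vsub_def fun_eq_iff)
        also have "\<dots> \<le> M3" unfolding M3_def by (rule sum_exp_supnorm_le) (use C2 X in auto)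
        finally show ?thesis using M2 C1 by (intro mult_left_mono add_left_mono) auto
      qed
      finally have F: "(\<Sum>y\<in>?F. measure P (?E x \<inter> ?E y)) \<le> ?\<rho> * (real (card X) * ?\<rho> + M2 * C1 * M3)" .
      have "(\<Sum>y\<in>X. measure P (?E x \<inter> ?E y)) = (\<Sum>y\<in>?N \<union> ?F. measure P (?E x \<inter> ?E y))"
        by (rule sum.cong) auto
      also have "\<dots> = (\<Sum>y\<in>?N. measure P (?E x \<inter> ?E y)) + (\<Sum>y\<in>?F. measure P (?E x \<inter> ?E y))"
        using X by (intro sum.union_disjoint) auto
      finally show ?thesis
        using F occurrences_near[OF B X \<alpha> sep, of x] by (simp add: S_def M_def algebra_simps)
    qed
    let ?N = "\<lambda>\<sigma>. \<Sum>x\<in>X. indicator (?E x) \<sigma> :: real"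
    have int1: "integrable P (\<lambda>\<sigma>. indicator (?E x) \<sigma> :: real)" for x
      using sets(1)[of x] by (simp add: integrable_real_indicator emeasure_finite less_top[symmetric])
    have int2: "integrable P (\<lambda>\<sigma>. indicator (?E x \<inter> ?E y) \<sigma> :: real)" for x y
      using sets(2)[of x y] by (simp add: integrable_real_indicator emeasure_finite less_top[symmetric])
    have sq: "(?N \<sigma>)\<^sup>2 = (\<Sum>x\<in>X. \<Sum>y\<in>X. indicator (?E x \<inter> ?E y) \<sigma>)" for \<sigma>
      unfolding power2_eq_square indicator_inter_arith by (rule sum_product)
    have E1: "(\<integral>\<sigma>. ?N \<sigma> \<partial>P) = real (card X) * ?\<rho>"
      using sets(1) by (subst Bochner_Integration.integral_sum[OF int1]) (simp add: prob_occurrence[OF B])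
    have E2: "(\<integral>\<sigma>. (?N \<sigma>)\<^sup>2 \<partial>P) \<le> real (card X) * ?\<rho> * S"
    proof -
      have "(\<integral>\<sigma>. (?N \<sigma>)\<^sup>2 \<partial>P) = (\<Sum>x\<in>X. \<Sum>y\<in>X. measure P (?E x \<inter> ?E y))"
        unfolding sq using sets(2)
        by (subst Bochner_Integration.integral_sum, intro Bochner_Integration.integrable_sum int2)
          (subst Bochner_Integration.integral_sum[OF int2], simp)
      also have "\<dots> \<le> (\<Sum>x\<in>X. ?\<rho> * S)" by (intro sum_mono pair)
      finally show ?thesis by simp
    qed
    have intN: "integrable P ?N" by (intro Bochner_Integration.integrable_sum int1)
    have intN2: "integrable P (\<lambda>\<sigma>. (?N \<sigma>)\<^sup>2)" unfolding sq by (intro Bochner_Integration.integrable_sum int2)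
    have A: "avoid B X \<in> sets P" by (rule avoid_sets[OF B X])
    \<comment> \<open>In place of the Cauchy-Schwarz inequality, the pointwise bound 2 N/S - (N/S)^2
      = 1 - (1 - N/S)^2 is integrated; it is 0 for N = 0 and at most 1 otherwise.\<close>
    have "2 / S * (real (card X) * ?\<rho>) - 1 / S\<^sup>2 * (real (card X) * ?\<rho> * S)
        \<le> (\<integral>\<sigma>. 2 / S * ?N \<sigma> - 1 / S\<^sup>2 * (?N \<sigma>)\<^sup>2 \<partial>P)"
    proof -
      have "(\<integral>\<sigma>. 2 / S * ?N \<sigma> - 1 / S\<^sup>2 * (?N \<sigma>)\<^sup>2 \<partial>P) = 2 / S * (real (card X) * ?\<rho>) - 1 / S\<^sup>2 * (\<integral>\<sigma>. (?N \<sigma>)\<^sup>2 \<partial>P)"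
        using intN intN2 E1 by (subst Bochner_Integration.integral_diff) auto
      then show ?thesis using mult_left_mono[OF E2, of "1 / S\<^sup>2"] by simp
    qed
    also have "\<dots> \<le> (\<integral>\<sigma>. 1 - indicator (avoid B X) \<sigma> \<partial>P)"
    proof (rule integral_mono)
      show "integrable P (\<lambda>\<sigma>. 2 / S * ?N \<sigma> - 1 / S\<^sup>2 * (?N \<sigma>)\<^sup>2)" using intN intN2 by simp
      show "integrable P (\<lambda>\<sigma>. 1 - indicator (avoid B X) \<sigma> :: real)"
        using A by (simp add: integrable_real_indicator emeasure_finite less_top[symmetric])
      fix \<sigma>
      show "2 / S * ?N \<sigma> - 1 / S\<^sup>2 * (?N \<sigma>)\<^sup>2 \<le> 1 - indicator (avoid B X) \<sigma>"
      proof (cases "\<sigma> \<in> avoid B X")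
        case True
        then have "?N \<sigma> = 0" by (auto simp: avoid_def)
        then show ?thesis using True by simp
      next
        case False
        have "0 \<le> (1 - ?N \<sigma> / S)\<^sup>2" by simp
        then show ?thesis using False by (simp add: power2_eq_square algebra_simps)
      qed
    qed
    also have "\<dots> = 1 - measure P (avoid B X)"
      using A prob_space by (subst Bochner_Integration.integral_diff)
        (auto simp: integrable_real_indicator emeasure_finite less_top[symmetric])
    also have "2 / S * (real (card X) * ?\<rho>) - 1 / S\<^sup>2 * (real (card X) * ?\<rho> * S) = real (card X) * ?\<rho> / S"
      using S by (simp add: power2_eq_square field_simps)
    finally show "real (card X) * ?\<rho> / (M + real (card X) * ?\<rho>) \<le> 1 - measure P (avoid B X)"
      by (simp add: S_def)
  qed
qed

end

section \<open>The hitting time as an avoidance event\<close>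

lemma translate_cube_subset_iff:
  "translate (cube n) x \<subseteq> (cube k :: ('d::finite) site set) \<longleftrightarrow> x \<in> box (Suc k - n)"
proof
  assume *: "translate (cube n) x \<subseteq> (cube k :: 'd site set)"
  have "0 \<le> x i \<and> x i < int (Suc k - n)" for i
  proof -
    have c: "vadd c x \<in> (cube k :: 'd site set)" if "c \<in> cube n" for c
      using * that unfolding translate_def by blast
    have "0 \<le> x i" "int n + x i \<le> int k"
      using c[of "\<lambda>_. 0"] c[of "\<lambda>_. int n"] by (simp_all add: cube_def vadd_def)
    then show ?thesis by linarith
  qed
  then show "x \<in> box (Suc k - n)" by (simp add: box_def)
next
  assume x: "x \<in> box (Suc k - n)"
  show "translate (cube n) x \<subseteq> cube k"
  proof
    fix y assume "y \<in> translate (cube n) x"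
    then have y: "0 \<le> y i - x i \<and> y i - x i \<le> int n" for i
      by (auto simp: mem_translate cube_def vsub_def)
    have "0 \<le> y i \<and> y i \<le> int k" for i
    proof -
      have "0 \<le> x i" "x i < int (Suc k - n)" using x unfolding box_def by blast+
      then show ?thesis using y[of i] by linarith
    qed
    then show "y \<in> cube k" by (simp add: cube_def)
  qed
qed

text \<open>The cube of index k has at most \<open>s\<close> sites iff k + 1 is at most the integer
  part r of the d-th root of \<open>s\<close>. The largest such cube leaves \<open>r - n\<close>
  positions per coordinate; truncated subtraction makes the box empty when the pattern does not
  fit.\<close>

lemma hit_time_gt_iff:
  fixes A \<sigma> :: "('d::finite) config"
  assumes n: "n \<ge> 1" and s: "s \<ge> 0"
  shows "ereal s < ereal_of_enat (hit_time n \<epsilon> A \<sigma>)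
    \<longleftrightarrow> \<sigma> \<in> avoid (approx_ball n \<epsilon> A) (box (nat \<lfloor>root CARD('d) s\<rfloor> - n))"
proof -
  let ?D = "CARD('d)" and ?r = "nat \<lfloor>root CARD('d) s\<rfloor>"
  define Hk where "Hk = {k. k > 0 \<and> (\<exists>x\<in>box (Suc k - n). shift x \<sigma> \<in> approx_ball n \<epsilon> A)}"
  have size: "real (card (cube k :: 'd site set)) \<le> s \<longleftrightarrow> Suc k \<le> ?r" for k
  proof -
    have "real (card (cube k :: 'd site set)) \<le> s \<longleftrightarrow> real (Suc k) ^ ?D \<le> root ?D s ^ ?D"
      using s by (simp add: card_cube add.commute)
    also have "\<dots> \<longleftrightarrow> real (Suc k) \<le> root ?D s"
      using s by (intro power_mono_iff) auto
    also have "\<dots> \<longleftrightarrow> Suc k \<le> ?r"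
      using s by (simp add: le_nat_iff le_floor_iff)
    finally show ?thesis .
  qed
  have "hit_time n \<epsilon> A \<sigma> = Inf ((\<lambda>k. enat (card (cube k :: 'd site set))) ` Hk)"
    unfolding hit_time_def Hk_def translate_cube_subset_iff shifted_ball_def
    by (intro arg_cong[where f=Inf]) auto
  also have "ereal s < ereal_of_enat \<dots> \<longleftrightarrow> (\<forall>k\<in>Hk. s < real (card (cube k :: 'd site set)))"
  proof (cases "Hk = {}")
    case True
    then show ?thesis by (simp add: top_enat_def)
  next
    case False
    let ?S = "(\<lambda>k. enat (card (cube k :: 'd site set))) ` Hk"
    have "Inf ?S \<in> ?S" using False unfolding Inf_enat_def by (auto intro: LeastI)
    then obtain k0 where k0: "k0 \<in> Hk" "Inf ?S = enat (card (cube k0 :: 'd site set))" by blast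
    have "card (cube k0 :: 'd site set) \<le> card (cube k :: 'd site set)" if "k \<in> Hk" for k
      using Inf_lower[of "enat (card (cube k :: 'd site set))" ?S] that unfolding k0(2) by simp
    then have "real (card (cube k0 :: 'd site set)) \<le> real (card (cube k :: 'd site set))" if "k \<in> Hk" for k
      using that by simp
    then have "(s < real (card (cube k0 :: 'd site set))) = (\<forall>k\<in>Hk. s < real (card (cube k :: 'd site set)))"
      using k0(1) by (meson order.strict_trans2)
    then show ?thesis unfolding k0(2) by simp
  qed
  also have "\<dots> \<longleftrightarrow> (\<forall>k\<in>Hk. \<not> Suc k \<le> ?r)" using size by (meson not_le)
  also have "\<dots> \<longleftrightarrow> \<sigma> \<in> avoid (approx_ball n \<epsilon> A) (box (?r - n))"
  proof
    assume *: "\<forall>k\<in>Hk. \<not> Suc k \<le> ?r"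
    show "\<sigma> \<in> avoid (approx_ball n \<epsilon> A) (box (?r - n))"
      unfolding avoid_def
    proof (rule CollectI, rule ballI, rule notI)
      fix x :: "'d site" assume x: "x \<in> box (?r - n)" "shift x \<sigma> \<in> approx_ball n \<epsilon> A"
      \<comment> \<open>Any coordinate serves here: a point in the box shows that its side is
        positive.\<close>
      have "0 \<le> x undefined" "x undefined < int (?r - n)" using x(1) unfolding box_def by blast+
      then have r: "n < ?r" by linarith
      obtain k where k: "?r = Suc k" using gr0_implies_Suc[OF le_less_trans[OF le0 r]] by blast
      \<comment> \<open>The premise \<open>n \<ge> 1\<close> excludes the index 0, which the hitting
        time does not admit.\<close>
      have "k > 0" using n r unfolding k by linarith
      then have "k \<in> Hk" "Suc k \<le> ?r" using x unfolding k by (auto simp: Hk_def)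
      then show False using * by blast
    qed
  next
    assume *: "\<sigma> \<in> avoid (approx_ball n \<epsilon> A) (box (?r - n))"
    show "\<forall>k\<in>Hk. \<not> Suc k \<le> ?r"
    proof (intro ballI notI)
      fix k assume "k \<in> Hk" "Suc k \<le> ?r"
      then obtain x where "x \<in> box (Suc k - n)" "shift x \<sigma> \<in> approx_ball n \<epsilon> A" by (auto simp: Hk_def)
      moreover have "box (Suc k - n) \<subseteq> (box (?r - n) :: 'd site set)"
      proof -
        have "int (Suc k - n) \<le> int (?r - n)" using \<open>Suc k \<le> ?r\<close> by linarith
        then show ?thesis unfolding box_def by (auto intro: order.strict_trans2)
      qed
      ultimately show False using * by (auto simp: avoid_def)
    qed
  qed
  finally show ?thesis .
qed

section \<open>The exponential law\<close>

lemma power_diff_le: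
  fixes x y :: real
  assumes "0 \<le> y" "y \<le> x"
  shows "x ^ D - y ^ D \<le> real D * x ^ (D - 1) * (x - y)"
proof -
  have "(\<Sum>i<D. y ^ (D - Suc i) * x ^ i) \<le> (\<Sum>i<D. x ^ (D - 1))"
  proof (rule sum_mono)
    fix i assume "i \<in> {..<D}"
    then have "x ^ (D - 1) = x ^ (D - Suc i) * x ^ i" by (simp flip: power_add)
    moreover have "y ^ (D - Suc i) * x ^ i \<le> x ^ (D - Suc i) * x ^ i"
      using assms by (intro mult_right_mono power_mono) auto
    ultimately show "y ^ (D - Suc i) * x ^ i \<le> x ^ (D - 1)" by simp
  qed
  then have "(x - y) * (\<Sum>i<D. y ^ (D - Suc i) * x ^ i) \<le> (x - y) * (real D * x ^ (D - 1))"
    using assms by (intro mult_left_mono) auto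
  then show ?thesis by (simp add: power_diff_sumr2 mult_ac)
qed

lemma exp_neg_diff_le:
  fixes a b :: real
  assumes "0 \<le> a" "a \<le> b"
  shows "\<bar>exp (- a) - exp (- b)\<bar> \<le> b - a"
proof -
  have "1 - exp (- (b - a)) \<le> b - a" using exp_ge_add_one_self[of "- (b - a)"] by linarith
  then have "exp (- a) * (1 - exp (- (b - a))) \<le> 1 * (b - a)"
    using assms by (intro mult_mono) auto
  moreover have "exp (- a) * (1 - exp (- (b - a))) = exp (- a) - exp (- b)"
    by (simp add: algebra_simps flip: exp_add)
  moreover have "exp (- b) \<le> exp (- a)" using assms by simp
  ultimately show ?thesis by simp
qed

lemma ln_one_minus_bounds:
  fixes x :: real
  assumes "0 \<le> x" "x \<le> 1 / 2"
  shows "x \<le> - ln (1 - x)" "- ln (1 - x) \<le> 2 * x"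
proof -
  show "x \<le> - ln (1 - x)" using ln_le_minus_one[of "1 - x"] assms by simp
  have "ln (1 / (1 - x)) \<le> 1 / (1 - x) - 1" using assms by (intro ln_le_minus_one) auto
  also have "\<dots> \<le> 2 * x"
  proof -
    have "x * x \<le> x * (1 / 2)" using assms by (intro mult_left_mono) auto
    then show ?thesis using assms by (simp add: field_simps)
  qed
  finally show "- ln (1 - x) \<le> 2 * x" using assms by (simp add: ln_div)
qed

text \<open>Here \<open>u\<close> is the \<open>4 D\<close>-th root of the probability \<open>\<rho>\<close> of the pattern, blocks have side \<open>f \<approx> u\<^sup>-\<^sup>2\<close>,
  and the window has side \<open>x = (t / (\<Lambda> \<rho>))\<^sup>1\<^sup>/\<^sup>D\<close>, so that the part of the window not covered by blocks
  contributes an expected number of hits of order \<open>u (1 + t)\<close>.\<close>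

lemma uncovered_volume:
  fixes u x c :: real and D f m n L q :: nat
  assumes D: "D \<ge> 1" and u: "0 < u" "u \<le> 1" and c: "c \<ge> 0"
    and n: "real (n + 1) \<le> c / u" "real m \<le> c / u"
    and f: "1 / u\<^sup>2 \<le> real f" "real f \<le> 2 / u\<^sup>2"
    and x: "real L \<le> x" "x < real (L + n + 1)" and q: "q = L div (f + m)"
  shows "real q * real f \<le> x"
    and "u ^ (4 * D) * (x ^ D - (real q * real f) ^ D) \<le> real D * (3 * c + 2) * u * (1 + (x * u ^ 4) ^ D)"
proof -
  have x0: "x \<ge> 0" using x(1) by linarith
  have f0: "real f > 0" using f(1) u by (smt (verit) divide_pos_pos zero_less_power)
  have "q * (f + m) \<le> L" unfolding q by simp
  then have qL: "real q * real f + real q * real m \<le> real L"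
    by (metis distrib_left of_nat_add of_nat_le_iff of_nat_mult)
  moreover have "0 \<le> real q * real m" by simp
  ultimately show qf: "real q * real f \<le> x" using x(1) by linarith
  have "f + m > 0" using f0 by auto
  then have "L < q * (f + m) + (f + m)"
    unfolding q by (metis add.commute dividend_less_div_times mult.commute)
  then have "real L < real (q * (f + m) + (f + m))" by (simp only: of_nat_less_iff)
  then have Lq: "real L < real q * real f + real q * real m + real f + real m" by (simp add: algebra_simps)
  have uu: "1 / u \<le> 1 / u\<^sup>2" using u by (intro divide_left_mono) (auto simp: power2_eq_square mult_le_one)
  then have cuu: "c / u \<le> c / u\<^sup>2" using c mult_left_mono[of "1 / u" "1 / u\<^sup>2" c] by simp
  have "real q \<le> x * u\<^sup>2"
  proof -
    have "real q * (1 / u\<^sup>2) \<le> real q * real f" using f(1) by (intro mult_left_mono) auto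
    then have "real q * (1 / u\<^sup>2) \<le> x" using qf by linarith
    then show ?thesis using u by (simp add: divide_le_eq)
  qed
  then have "real q * real m \<le> (x * u\<^sup>2) * (c / u)" using n(2) x0 by (intro mult_mono) auto
  also have "\<dots> = c * x * u" using u by (simp add: power2_eq_square)
  \<comment> \<open>Uncovered length per coordinate: the \<open>q\<close> corridors give
    \<open>c * x * u\<close>; the incomplete last period, the rounding and the margin
    \<open>n\<close> give the term of order 1/u^2.\<close>
  finally have gap: "x - real q * real f \<le> (2 * c + 2) / u\<^sup>2 + c * x * u"
    using Lq x(2) n f(2) cuu by (simp add: add_divide_distrib)
  \<comment> \<open>Since u^(4 D) is the pattern probability, \<open>?z ^ D\<close> is the expected
    number of occurrences in the window.\<close>
  let ?z = "x * u ^ 4"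
  have z0: "?z \<ge> 0" using x0 by simp
  have zle: "?z ^ (D - 1) \<le> 1 + ?z ^ D"
  proof (cases "?z \<le> 1")
    case True
    then have "?z ^ (D - 1) \<le> 1" using z0 by (intro power_le_one) auto
    then show ?thesis using zero_le_power[OF z0, of D] by linarith
  next
    case False
    then have "?z ^ (D - 1) \<le> ?z ^ D" by (intro power_increasing) auto
    then show ?thesis by linarith
  qed
  have uD: "u ^ (4 * D) = (u ^ 4) ^ (D - 1) * u ^ 4" "x ^ D = x ^ (D - 1) * x"
    using D power_minus_mult[of D "u ^ 4"] power_minus_mult[of D x] by (simp_all add: power_mult)
  have e1: "u ^ (4 * D) * x ^ (D - 1) * (1 / u\<^sup>2) = ?z ^ (D - 1) * u\<^sup>2"
    unfolding uD using u by (simp add: power_mult_distrib field_simps flip: power_add)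
  have e2: "u ^ (4 * D) * x ^ (D - 1) * (x * u) = ?z ^ D * u"
    unfolding power_mult_distrib uD(2) power_mult by (simp add: mult_ac)
  have "x ^ D - (real q * real f) ^ D \<le> real D * x ^ (D - 1) * (x - real q * real f)"
    by (rule power_diff_le) (use qf in auto)
  also have "\<dots> \<le> real D * x ^ (D - 1) * ((2 * c + 2) / u\<^sup>2 + c * x * u)"
    using x0 by (intro mult_left_mono gap) auto
  finally have "u ^ (4 * D) * (x ^ D - (real q * real f) ^ D)
      \<le> u ^ (4 * D) * (real D * x ^ (D - 1) * ((2 * c + 2) / u\<^sup>2 + c * x * u))"
    using u by (intro mult_left_mono) auto
  also have "\<dots> = real D * ((2 * c + 2) * (u ^ (4 * D) * x ^ (D - 1) * (1 / u\<^sup>2)) + c * (u ^ (4 * D) * x ^ (D - 1) * (x * u)))"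
    by (simp add: algebra_simps)
  also have "\<dots> = real D * ((2 * c + 2) * (?z ^ (D - 1) * u\<^sup>2) + c * (?z ^ D * u))"
    unfolding e1 e2 ..
  also have "\<dots> \<le> real D * ((2 * c + 2) * ((1 + ?z ^ D) * u) + c * ((1 + ?z ^ D) * u))"
  proof -
    have "?z ^ (D - 1) * u\<^sup>2 \<le> (1 + ?z ^ D) * u"
      using zle z0 u by (intro mult_mono) (auto simp: power2_eq_square mult_le_one intro!: mult_left_le)
    moreover have "?z ^ D * u \<le> (1 + ?z ^ D) * u" using u by (intro mult_right_mono) auto
    ultimately show ?thesis using c by (intro mult_left_mono add_mono) auto
  qed
  also have "\<dots> = real D * (3 * c + 2) * u * (1 + ?z ^ D)" by (simp add: algebra_simps)
  finally show "u ^ (4 * D) * (x ^ D - (real q * real f) ^ D) \<le> real D * (3 * c + 2) * u * (1 + ?z ^ D)" .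
qed

text \<open>\<open>G\<close> is the no-hit probability and \<tau> the hitting probability of one
  block. The equation for \<Lambda> turns (1 - \<tau>)^(q^D) into exp (- \<Lambda> \<rho> (q f)^D)
  exactly, with \<rho> = u^(4 D), so that only the uncovered volume separates it from exp (-
  t).\<close>

lemma exponential_law_estimate:
  fixes u x c c1 G \<tau> e \<Lambda> \<kappa> t :: real and D f m n L q :: nat
  assumes D: "D \<ge> 1" and u: "0 < u" "u \<le> 1" and c: "c \<ge> 0" "c1 \<ge> 0" and \<kappa>: "0 < \<kappa>" "\<kappa> \<le> 1"
    and n: "real (n + 1) \<le> c / u" "real m \<le> c / u"
    and f: "1 / u\<^sup>2 \<le> real f" "real f \<le> 2 / u\<^sup>2"
    and x: "real L \<le> x" "x < real (L + n + 1)" and q: "q = L div (f + m)"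
    and \<tau>: "\<kappa> * (real f ^ D * u ^ (4 * D)) \<le> \<tau>" "\<tau> < 1"
    and e: "0 \<le> e" "e \<le> real f ^ D * u ^ (4 * D) * (c1 * u)" "e \<le> \<tau> / 2"
    and \<Lambda>: "\<Lambda> * (real f ^ D * u ^ (4 * D)) = - ln (1 - \<tau>)" "\<kappa> \<le> \<Lambda>" "\<Lambda> \<le> 2"
    and t: "t = \<Lambda> * (x * u ^ 4) ^ D" "t > 0"
    and small: "real D * (3 * c + 2) * u \<le> 1 / 2"
    and G: "0 \<le> G" "G \<le> (1 - \<tau> + e) ^ (q ^ D)"
      "\<bar>G - (1 - \<tau>) ^ (q ^ D)\<bar> \<le> real q ^ D * e + (real L ^ D - (real q * real f) ^ D) * u ^ (4 * D)"
  shows "\<bar>G - exp (- t)\<bar> \<le> sqrt (48 * (c1 + 3 * (real D * (3 * c + 2))) * (1 + 1 / \<kappa>) / \<kappa>) * exp (- (\<kappa> / 32) * t) * sqrt u"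
proof -
  define \<rho> where "\<rho> = u ^ (4 * D)"
  define c5 where "c5 = real D * (3 * c + 2)"
  define Z where "Z = (x * u ^ 4) ^ D"
  have \<rho>: "\<rho> > 0" using u by (simp add: \<rho>_def)
  have c5: "c5 \<ge> 0" using c by (simp add: c5_def)
  have x0: "x \<ge> 0" using x(1) by linarith
  have Z0: "Z \<ge> 0" using x0 u by (simp add: Z_def)
  have Z: "\<rho> * x ^ D = Z" unfolding Z_def \<rho>_def power_mult_distrib power_mult by (rule mult.commute)
  have f0: "real f > 0" using f(1) u by (smt (verit) divide_pos_pos zero_less_power)
  have Zt: "Z = t / \<Lambda>" "Z \<le> t / \<kappa>" "t / 2 \<le> Z"
  proof -
    have "\<Lambda> > 0" using \<kappa> \<Lambda> by linarith
    then show 1: "Z = t / \<Lambda>" using t(1) by (simp add: Z_def)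
    show "Z \<le> t / \<kappa>" unfolding 1 using t(2) \<kappa> \<Lambda> by (intro divide_left_mono) auto
    show "t / 2 \<le> Z" unfolding 1 using t(2) \<kappa> \<Lambda> by (intro divide_left_mono) auto
  qed
  note uv = uncovered_volume[OF D u c(1) n f x q, folded \<rho>_def c5_def Z_def]
  define E where "E = \<rho> * (x ^ D - (real q * real f) ^ D)"
  have E: "E \<le> c5 * u * (1 + Z)" using uv(2) by (simp add: E_def)
  have qfx: "(real q * real f) ^ D \<le> x ^ D" using uv(1) by (intro power_mono) auto
  have E0: "0 \<le> E" unfolding E_def using \<rho> qfx by simp
  have \<Lambda>0: "0 \<le> \<Lambda>" using \<kappa> \<Lambda> by linarith
  have main: "\<bar>G - exp (- t)\<bar> \<le> (c1 + 3 * c5) * u * (1 + Z)"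
  proof -
    have "real q ^ D * e \<le> real q ^ D * (real f ^ D * \<rho> * (c1 * u))"
      using e(2) by (intro mult_left_mono) (auto simp: \<rho>_def)
    also have "\<dots> = (real q * real f) ^ D * (\<rho> * (c1 * u))" by (simp add: power_mult_distrib)
    also have "\<dots> \<le> x ^ D * (\<rho> * (c1 * u))" using \<rho> c u by (intro mult_right_mono qfx) auto
    also have "\<dots> = c1 * u * Z" unfolding Z[symmetric] by (simp add: mult_ac)
    finally have a: "real q ^ D * e \<le> c1 * u * Z" .
    have b: "(real L ^ D - (real q * real f) ^ D) * \<rho> \<le> E"
    proof -
      have "real L ^ D \<le> x ^ D" using x(1) by (intro power_mono) auto
      then show ?thesis unfolding E_def using \<rho> by (simp add: mult.commute)
    qed
    have "(1 - \<tau>) ^ (q ^ D) = exp (ln (1 - \<tau>)) ^ (q ^ D)" using \<tau>(2) by simp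
    also have "\<dots> = exp (real (q ^ D) * ln (1 - \<tau>))" by (rule exp_of_nat_mult[symmetric])
    also have "real (q ^ D) * ln (1 - \<tau>) = - (\<Lambda> * (\<rho> * (real q * real f) ^ D))"
    proof -
      have l: "ln (1 - \<tau>) = - (\<Lambda> * (real f ^ D * \<rho>))" using \<Lambda>(1) by (simp add: \<rho>_def)
      show ?thesis unfolding l by (simp add: power_mult_distrib)
    qed
    finally have p: "(1 - \<tau>) ^ (q ^ D) = exp (- (\<Lambda> * (\<rho> * (real q * real f) ^ D)))" .
    have tE: "t - \<Lambda> * (\<rho> * (real q * real f) ^ D) = \<Lambda> * E"
      unfolding E_def t(1) Z_def[symmetric] Z[symmetric] by (simp add: algebra_simps)
    have "\<bar>exp (- (\<Lambda> * (\<rho> * (real q * real f) ^ D))) - exp (- t)\<bar> \<le> \<Lambda> * E"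
      unfolding tE[symmetric]
    proof (rule exp_neg_diff_le)
      show "0 \<le> \<Lambda> * (\<rho> * (real q * real f) ^ D)" using \<Lambda>0 \<rho> by simp
      show "\<Lambda> * (\<rho> * (real q * real f) ^ D) \<le> t" using tE mult_nonneg_nonneg[OF \<Lambda>0 E0] by linarith
    qed
    also have "\<dots> \<le> 2 * E" using \<Lambda>(3) E0 by (intro mult_right_mono) auto
    finally have "\<bar>G - exp (- t)\<bar> \<le> c1 * u * Z + E + 2 * E"
      using G(3) a b unfolding p \<rho>_def[symmetric] by linarith
    also have "\<dots> \<le> c1 * u * (1 + Z) + 3 * (c5 * u * (1 + Z))"
    proof -
      have "c1 * u * Z \<le> c1 * u * (1 + Z)" using c u by (intro mult_left_mono) auto
      then show ?thesis using E by linarith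
    qed
    finally show ?thesis by (simp add: algebra_simps)
  qed
  have "(c1 + 3 * c5) * u * (1 + Z) \<le> (c1 + 3 * c5) * u * ((1 + 1 / \<kappa>) * (1 + t))"
  proof -
    have "1 + Z \<le> (1 + 1 / \<kappa>) * (1 + t)" 
    proof -
      have "0 \<le> 1 / \<kappa>" using \<kappa> by simp
      moreover have "(1 + 1 / \<kappa>) * (1 + t) = 1 + t + 1 / \<kappa> + t / \<kappa>"
        by (simp add: algebra_simps add_divide_distrib)
      ultimately show ?thesis using Zt(2) t(2) by linarith
    qed
    then show ?thesis using c c5 u by (intro mult_left_mono) auto
  qed
  \<comment> \<open>The linear factor is traded for growth at rate \<kappa>/16, half the decay rate
    \<kappa>/8 of \<open>bound2\<close>. The product of the two bounds then decays at rate
    \<kappa>/16 and its square root at \<kappa>/32.\<close>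
  also have "\<dots> \<le> (c1 + 3 * c5) * u * ((1 + 1 / \<kappa>) * (16 / \<kappa> * exp (\<kappa> / 16 * t)))"
  proof -
    have "1 + t \<le> 16 / \<kappa> * (1 + \<kappa> / 16 * t)" using \<kappa> by (simp add: field_simps)
    also have "\<dots> \<le> 16 / \<kappa> * exp (\<kappa> / 16 * t)"
      using \<kappa> exp_ge_add_one_self[of "\<kappa> / 16 * t"] by (intro mult_left_mono) auto
    finally show ?thesis using c c5 u \<kappa> by (intro mult_left_mono) auto
  qed
  finally have bound1: "\<bar>G - exp (- t)\<bar> \<le> (c1 + 3 * c5) * u * ((1 + 1 / \<kappa>) * (16 / \<kappa> * exp (\<kappa> / 16 * t)))"
    using main by linarith
  \<comment> \<open>As \<open>e\<close> is at most \<tau>/2, \<open>G\<close> is at most exp (-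
    \<tau> q^D / 2). By \<open>small\<close> the covered part keeps at least (Z - 1)/2 expected
    occurrences, so \<tau> q^D is at least \<kappa> (t/4 - 1/2).\<close>
  have bound2: "\<bar>G - exp (- t)\<bar> \<le> 3 * exp (- (\<kappa> / 8) * t)"
  proof -
    have \<tau>0: "0 \<le> \<tau>" using e by linarith
    have "G \<le> (1 - \<tau> / 2) ^ (q ^ D)"
      using \<tau> e by (intro order_trans[OF G(2)] power_mono) auto
    also have "\<dots> \<le> exp (- (\<tau> / 2)) ^ (q ^ D)"
      using \<tau>(2) exp_ge_add_one_self[of "- (\<tau> / 2)"] by (intro power_mono) auto
    also have "\<dots> = exp (real (q ^ D) * (- (\<tau> / 2)))" by (rule exp_of_nat_mult[symmetric])
    also have "\<dots> \<le> exp (1 / 4 - \<kappa> / 8 * t)"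
    proof -
      have "\<kappa> * (\<rho> * (real q * real f) ^ D) = real q ^ D * (\<kappa> * (real f ^ D * \<rho>))"
        by (simp add: power_mult_distrib)
      also have "\<dots> \<le> real q ^ D * \<tau>" using \<tau>(1) by (intro mult_left_mono) (auto simp: \<rho>_def)
      finally have 1: "\<kappa> * (\<rho> * (real q * real f) ^ D) \<le> real q ^ D * \<tau>" .
      have "c5 * u * (1 + Z) \<le> 1 / 2 * (1 + Z)" using small Z0 by (intro mult_right_mono) (auto simp: c5_def)
      then have "Z / 2 - 1 / 2 \<le> \<rho> * (real q * real f) ^ D"
        using E unfolding E_def by (simp add: right_diff_distrib Z)
      then have "\<kappa> * (t / 4 - 1 / 2) \<le> \<kappa> * (\<rho> * (real q * real f) ^ D)"
        using Zt(3) \<kappa> by (intro mult_left_mono) auto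
      then show ?thesis using 1 \<kappa>(2) by (simp add: algebra_simps)
    qed
    also have "\<dots> = exp (1 / 4) * exp (- (\<kappa> / 8) * t)" by (simp flip: exp_add)
    also have "\<dots> \<le> 2 * exp (- (\<kappa> / 8) * t)"
    proof -
      have "exp (1 / 4 :: real) \<le> 1 + 1 / 4 + (1 / 4)\<^sup>2" by (rule exp_bound) auto
      also have "\<dots> \<le> 2" by (simp add: power2_eq_square)
      finally show ?thesis by (intro mult_right_mono) auto
    qed
    finally have "G \<le> 2 * exp (- (\<kappa> / 8) * t)" .
    moreover have "exp (- t) \<le> exp (- (\<kappa> / 8) * t)" using \<kappa> t(2) by simp
    ultimately show ?thesis using G(1) exp_gt_zero[of "- t"] by linarith
  qed
  let ?C = "48 * (c1 + 3 * c5) * (1 + 1 / \<kappa>) / \<kappa>"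
  have "\<bar>G - exp (- t)\<bar>\<^sup>2
      \<le> ((c1 + 3 * c5) * u * ((1 + 1 / \<kappa>) * (16 / \<kappa> * exp (\<kappa> / 16 * t)))) * (3 * exp (- (\<kappa> / 8) * t))"
    unfolding power2_eq_square by (rule mult_mono[OF bound1 bound2]) (use c c5 u \<kappa> in auto)
  also have "\<dots> = ?C * u * (exp (\<kappa> / 16 * t) * exp (- (\<kappa> / 8) * t))"
    by (simp add: algebra_simps add_divide_distrib)
  also have "exp (\<kappa> / 16 * t) * exp (- (\<kappa> / 8) * t) = (exp (- (\<kappa> / 32) * t))\<^sup>2"
    by (simp add: power2_eq_square flip: exp_add)
  finally have "\<bar>G - exp (- t)\<bar> \<le> sqrt (?C * u * (exp (- (\<kappa> / 32) * t))\<^sup>2)" by (rule real_le_rsqrt)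
  moreover have "sqrt (?C * u * (exp (- (\<kappa> / 32) * t))\<^sup>2) = sqrt ?C * exp (- (\<kappa> / 32) * t) * sqrt u"
    unfolding real_sqrt_mult[of "?C * u"] real_sqrt_mult[of ?C u] real_sqrt_abs by simp
  ultimately show ?thesis unfolding c5_def by (simp only:)
qed

section \<open>Choice of scales, and assembly over all pattern sizes\<close>

context stationary_mixing_field
begin

lemma exponential_law_rare:
  assumes \<alpha>: "\<alpha> > 0" and K: "K > 0"
  obtains n1 \<kappa> C c where "0 < \<kappa>" "\<kappa> \<le> 1" "0 < C" "0 < c"
    "\<And>n B. \<lbrakk>n \<ge> n1; depends_on (cube n) (B :: 'd config set); 0 < measure P B;
      measure P B \<le> exp (- K * real n ^ CARD('d));
      \<And>x. 0 < supnorm x \<Longrightarrow> real_of_int (supnorm x) \<le> \<alpha> * real n \<Longrightarrow> B \<inter> {\<sigma>. shift x \<sigma> \<in> B} = {}\<rbrakk>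
      \<Longrightarrow> \<exists>\<Lambda>. \<kappa> \<le> \<Lambda> \<and> \<Lambda> \<le> 2 \<and> (\<forall>t>0. \<bar>measure P (avoid B (box (nat \<lfloor>root CARD('d) (t / (\<Lambda> * measure P B))\<rfloor> - n)))
           - exp (- t)\<bar> \<le> C * exp (- c * t) * exp (- (K / (8 * real CARD('d))) * real n ^ CARD('d)))"
proof -
  let ?D = "CARD('d)"
  have D: "?D \<ge> 1" by (simp add: Suc_leI)
  obtain M where M: "M > 0" "\<And>n B X. \<lbrakk>depends_on (cube n) (B :: 'd config set); finite (X :: 'd site set);
      \<And>x. 0 < supnorm x \<Longrightarrow> real_of_int (supnorm x) \<le> \<alpha> * real n \<Longrightarrow> B \<inter> {\<sigma>. shift x \<sigma> \<in> B} = {}\<rbrakk>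
      \<Longrightarrow> real (card X) * measure P B / (M + real (card X) * measure P B) \<le> 1 - measure P (avoid B X)"
    using hit_probability_lower[OF \<alpha>] by blast
  \<comment> \<open>For blocks with expected number of occurrences V at most 1, the second moment
    bound V / (M + V) is at least \<kappa> V.\<close>
  define \<kappa> where "\<kappa> = 1 / (M + 1)"
  have \<kappa>: "0 < \<kappa>" "\<kappa> \<le> 1" using M(1) by (auto simp: \<kappa>_def)
  \<comment> \<open>Chosen so that \<open>c / u\<close> bounds \<open>n + 1\<close> and
    \<open>n + h\<close>: with \<mu> = ln (1/u) at most 1/u, the first summand comes from K n \<le>
    4 d \<mu>, the second from \<open>h\<close> being about 8 d \<mu> / C2, and the 3 covers
    rounding.\<close>
  define c where "c = 4 * real ?D / K + 8 * real ?D / C2 + 3"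
  have c: "c \<ge> 1" using K C2 by (simp add: c_def)
  define c1 where "c1 = C1 * c ^ ?D"
  have c1: "c1 > 0" using C1 c by (simp add: c1_def)
  \<comment> \<open>The four entries give, in order: u \<le> 1, at most 1/2 expected occurrences per
    block, \<open>e \<le> \<tau> / 2\<close>, and the premise \<open>small\<close> of
    \<open>exponential_law_estimate\<close>.\<close>
  define u0 where "u0 = Min {1, 1 / 2 ^ (?D + 1), \<kappa> / (2 * c1), 1 / (2 * (real ?D * (3 * c + 2)))}"
  have u0: "u0 > 0" using \<kappa> c1 c by (simp add: u0_def zero_less_mult_iff)
  \<comment> \<open>For \<open>n \<ge> n1\<close> the bound exp (- K n^d) on the pattern probability
    forces u \<le> u0.\<close>
  define n1 where "n1 = Suc (nat \<lceil>- (4 * real ?D / K) * ln u0\<rceil>)"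
  define C where "C = sqrt (48 * (c1 + 3 * (real ?D * (3 * c + 2))) * (1 + 1 / \<kappa>) / \<kappa>)"
  have C: "C > 0" unfolding C_def using c1 c \<kappa> by (auto intro!: mult_pos_pos add_pos_nonneg divide_pos_pos)
  show ?thesis
  proof (rule that[OF \<kappa> C])
    show "0 < \<kappa> / 32" using \<kappa> by simp
    fix n and B :: "'d config set"
    assume n: "n \<ge> n1" and B: "depends_on (cube n) B" and \<rho>0: "0 < measure P B"
      and \<rho>K: "measure P B \<le> exp (- K * real n ^ ?D)"
      and sep: "\<And>x. 0 < supnorm x \<Longrightarrow> real_of_int (supnorm x) \<le> \<alpha> * real n \<Longrightarrow> B \<inter> {\<sigma>. shift x \<sigma> \<in> B} = {}"
    define \<rho> where "\<rho> = measure P B"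
    define u where "u = exp (ln \<rho> / (4 * real ?D))"
    have \<rho>: "\<rho> > 0" using \<rho>0 by (simp add: \<rho>_def)
    have u: "u > 0" by (simp add: u_def)
    have u\<rho>: "u ^ (4 * ?D) = \<rho>"
    proof -
      have "u ^ (4 * ?D) = exp (real (4 * ?D) * (ln \<rho> / (4 * real ?D)))" unfolding u_def by (rule exp_of_nat_mult[symmetric])
      also have "real (4 * ?D) * (ln \<rho> / (4 * real ?D)) = ln \<rho>" by simp
      finally show ?thesis using \<rho> by simp
    qed
    define \<mu> where "\<mu> = ln (1 / u)"
    have \<mu>: "ln \<rho> = - (4 * real ?D * \<mu>)" using u by (simp add: \<mu>_def ln_div u_def)
    have n1: "n \<ge> 1" using n by (simp add: n1_def)
    have nD: "real n \<le> real n ^ ?D" using n1 by (intro self_le_power) auto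
    have "ln \<rho> \<le> ln (exp (- K * real n ^ ?D))" using \<rho>K \<rho> by (subst ln_le_cancel_iff) (auto simp: \<rho>_def)
    then have Kn: "K * real n ^ ?D \<le> 4 * real ?D * \<mu>" unfolding \<mu> by simp
    have "K * real n \<le> K * real n ^ ?D" using nD K by simp
    then have Kn': "K * real n \<le> 4 * real ?D * \<mu>" using Kn by linarith
    have \<mu>0: "\<mu> \<ge> 0"
    proof -
      have "0 \<le> K * real n" using K by simp
      then have "0 \<le> 4 * real ?D * \<mu>" using Kn' by linarith
      then show ?thesis by (simp add: zero_le_mult_iff)
    qed
    have uu0: "u \<le> u0"
    proof -
      have "- (4 * real ?D / K) * ln u0 \<le> real n" using n unfolding n1_def by linarith
      then have "K * (- (4 * real ?D / K) * ln u0) \<le> K * real n" using K by (intro mult_left_mono) auto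
      moreover have "K * (- (4 * real ?D / K) * ln u0) = 4 * real ?D * (- ln u0)" using K by simp
      ultimately have "4 * real ?D * (- ln u0) \<le> 4 * real ?D * \<mu>" using Kn' by linarith
      then have "- ln u0 \<le> \<mu>" using mult_le_cancel_left_pos[of "4 * real ?D" "- ln u0" \<mu>] by simp
      then have "ln u \<le> ln u0" using u by (simp add: \<mu>_def ln_div)
      then show ?thesis using u u0 by simp
    qed
    have usm: "u \<le> 1" "u \<le> 1 / 2 ^ (?D + 1)" "u \<le> \<kappa> / (2 * c1)" "u \<le> 1 / (2 * (real ?D * (3 * c + 2)))"
      using uu0 unfolding u0_def by auto
    have \<mu>u: "\<mu> \<le> 1 / u" unfolding \<mu>_def using u by (intro ln_bound) auto
    have u1: "1 \<le> 1 / u" using u usm(1) by simp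
    have nb: "real n \<le> 4 * real ?D / K * (1 / u)"
    proof -
      have "K * real n \<le> 4 * real ?D * (1 / u)"
        using Kn' \<mu>u by (meson mult_left_mono order_trans of_nat_0_le_iff mult_nonneg_nonneg zero_le_numeral)
      then have "real n \<le> 4 * real ?D * (1 / u) / K" using K by (simp only: pos_le_divide_eq mult.commute)
      then show ?thesis by (simp add: mult.commute)
    qed
    \<comment> \<open>Corridor width: 8 d \<mu> = - 2 ln \<rho>, so mixing across it costs at most
      \<rho>^2 per site.\<close>
    define h where "h = Suc (nat \<lceil>8 * real ?D / C2 * \<mu>\<rceil>)"
    have h: "h > 0" "8 * real ?D / C2 * \<mu> \<le> real h" "real h \<le> 8 * real ?D / C2 * \<mu> + 2"
    proof -
      have "0 \<le> 8 * real ?D / C2 * \<mu>" using C2 \<mu>0 by simp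
      then show "h > 0" "8 * real ?D / C2 * \<mu> \<le> real h" "real h \<le> 8 * real ?D / C2 * \<mu> + 2"
        unfolding h_def by linarith+
    qed
    have hb: "real h \<le> 8 * real ?D / C2 * (1 / u) + 2"
    proof -
      have "8 * real ?D / C2 * \<mu> \<le> 8 * real ?D / C2 * (1 / u)" using C2 \<mu>u by (intro mult_left_mono) auto
      then show ?thesis using h(3) by linarith
    qed
    have cu: "c / u = 4 * real ?D / K * (1 / u) + 8 * real ?D / C2 * (1 / u) + 3 * (1 / u)"
      by (simp add: c_def add_divide_distrib)
    have pos: "0 \<le> 8 * real ?D / C2 * (1 / u)" using C2 u by simp
    have nc: "real (n + 1) \<le> c / u" "real (n + h) \<le> c / u"
      using nb hb u1 pos unfolding cu by (simp_all del: times_divide_eq_right times_divide_eq_left)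
    have exph: "exp (- C2 * real h) \<le> \<rho>\<^sup>2"
    proof -
      have "C2 * (8 * real ?D / C2 * \<mu>) \<le> C2 * real h" using C2 h(2) by (intro mult_left_mono) auto
      moreover have "C2 * (8 * real ?D / C2 * \<mu>) = 8 * real ?D * \<mu>" using C2 by simp
      ultimately have "- C2 * real h \<le> ln \<rho> + ln \<rho>" unfolding \<mu> by linarith
      then have "exp (- C2 * real h) \<le> exp (ln \<rho> + ln \<rho>)" by (simp only: exp_le_cancel_iff)
      also have "\<dots> = \<rho>\<^sup>2" using \<rho> by (simp only: exp_add exp_ln power2_eq_square)
      finally show ?thesis .
    qed
    define f where "f = nat \<lceil>1 / u\<^sup>2\<rceil>"
    have u2: "1 \<le> 1 / u\<^sup>2" using u usm(1) by (simp add: power_le_one)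
    have f: "1 / u\<^sup>2 \<le> real f" "real f \<le> 2 / u\<^sup>2"
    proof -
      have "real f = of_int \<lceil>1 / u\<^sup>2\<rceil>" unfolding f_def using u2 by linarith
      then show "1 / u\<^sup>2 \<le> real f" by simp
      have "real f \<le> 1 / u\<^sup>2 + 1" unfolding f_def using u2 by linarith
      also have "\<dots> \<le> 1 / u\<^sup>2 + 1 / u\<^sup>2" using u2 by simp
      finally show "real f \<le> 2 / u\<^sup>2" by simp
    qed
    have f0: "real f > 0" using f(1) u2 by linarith
    \<comment> \<open>Expected number of occurrences in one block, of order u^(2 d).\<close>
    let ?V = "real f ^ ?D * \<rho>"
    have V0: "?V > 0" using f0 \<rho> by simp
    have V: "?V \<le> 1 / 2"
    proof -
      have "?V \<le> (2 / u\<^sup>2) ^ ?D * u ^ (4 * ?D)" unfolding u\<rho>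
        using f(2) \<rho> by (intro mult_right_mono power_mono) auto
      also have "\<dots> = (2 / u\<^sup>2 * u ^ 4) ^ ?D" by (simp only: power_mult_distrib power_mult)
      also have "2 / u\<^sup>2 * u ^ 4 = 2 * u\<^sup>2" using u by (simp add: power4_eq_xxxx power2_eq_square)
      also have "(2 * u\<^sup>2) ^ ?D = 2 ^ ?D * (u\<^sup>2) ^ ?D" by (rule power_mult_distrib)
      also have "(u\<^sup>2) ^ ?D \<le> u"
      proof -
        have "(u\<^sup>2) ^ ?D = u ^ (2 * ?D)" by (rule power_mult[symmetric])
        also have "\<dots> \<le> u ^ 1" using u usm(1) D by (intro power_decreasing) auto
        finally show ?thesis by simp
      qed
      also have "2 ^ ?D * u \<le> 2 ^ ?D * (1 / 2 ^ (?D + 1))" using usm(2) by (intro mult_left_mono) auto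
      finally show ?thesis by simp
    qed
    define g where "g = measure P (avoid B (box f))"
    define \<tau> where "\<tau> = 1 - g"
    have cardf: "real (card (box f :: 'd site set)) = real f ^ ?D" by (simp add: card_box)
    have \<tau>V: "\<tau> \<le> ?V"
    proof -
      have "avoid B {} = space P" by (simp add: avoid_def)
      then have "1 \<le> g + ?V"
        using avoid_subset_bounds(2)[OF B finite_box empty_subsetI, of f] prob_space cardf
        by (simp add: g_def \<rho>_def)
      then show ?thesis by (simp add: \<tau>_def)
    qed
    have \<tau>l: "\<kappa> * ?V \<le> \<tau>"
    proof -
      have "?V / (M + ?V) \<le> \<tau>"
        using M(2)[OF B finite_box sep, of f] unfolding cardf \<rho>_def \<tau>_def g_def by blast
      moreover have "?V / (M + 1) \<le> ?V / (M + ?V)" using V V0 M(1) by (intro divide_left_mono) auto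
      ultimately show ?thesis by (simp add: \<kappa>_def)
    qed
    have \<tau>0: "0 < \<tau>" using \<tau>l mult_pos_pos[OF \<kappa>(1) V0] by linarith
    have \<tau>h: "\<tau> \<le> 1 / 2" using \<tau>V V by linarith
    define e where "e = real f ^ ?D * real (n + 1) ^ ?D * (C1 * exp (- C2 * real h))"
    have e0: "0 \<le> e" using C1 by (simp add: e_def)
    \<comment> \<open>One factor \<rho> of \<rho>^2 goes into \<open>?V\<close>; the other, u^(4 d),
      outweighs the window size (c/u)^d.\<close>
    have eV: "e \<le> ?V * (c1 * u)"
    proof -
      have "e \<le> real f ^ ?D * (c / u) ^ ?D * (C1 * \<rho>\<^sup>2)"
        unfolding e_def using nc(1) exph C1 by (intro mult_mono power_mono) auto
      also have "\<dots> = ?V * (c1 * (u ^ (4 * ?D) / u ^ ?D))"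
        by (simp add: c1_def power_divide power2_eq_square u\<rho>)
      also have "u ^ (4 * ?D) / u ^ ?D = u ^ (3 * ?D)"
        using u by (simp add: field_simps flip: power_add)
      also have "?V * (c1 * u ^ (3 * ?D)) \<le> ?V * (c1 * u ^ 1)"
        using V0 c1 u usm(1) D by (intro mult_left_mono power_decreasing) auto
      finally show ?thesis by simp
    qed
    have e\<tau>: "e \<le> \<tau> / 2"
    proof -
      have "c1 * u \<le> \<kappa> / 2" using usm(3) c1 by (simp add: field_simps)
      then have "?V * (c1 * u) \<le> ?V * (\<kappa> / 2)" using V0 by (intro mult_left_mono) auto
      then show ?thesis using eV \<tau>l by (simp add: mult.commute)
    qed
    \<comment> \<open>Exponential rate of a block per expected occurrence: the block is avoided with
      probability exactly exp (- \<Lambda> V). The bounds on \<tau> confine \<Lambda> to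
      [\<kappa>, 2].\<close>
    define \<Lambda> where "\<Lambda> = - ln (1 - \<tau>) / ?V"
    have \<Lambda>V: "\<Lambda> * ?V = - ln (1 - \<tau>)"
      using nonzero_eq_divide_eq[of ?V \<Lambda> "- ln (1 - \<tau>)", OF less_imp_neq[OF V0, symmetric]] \<Lambda>_def by blast
    have ln: "\<tau> \<le> - ln (1 - \<tau>)" "- ln (1 - \<tau>) \<le> 2 * \<tau>"
      using ln_one_minus_bounds[of \<tau>] \<tau>0 \<tau>h by auto
    have \<Lambda>b: "\<kappa> \<le> \<Lambda>" "\<Lambda> \<le> 2"
    proof -
      have "\<kappa> * ?V \<le> \<Lambda> * ?V" unfolding \<Lambda>V using \<tau>l ln(1) by linarith
      then show "\<kappa> \<le> \<Lambda>" using V0 by (simp add: mult_le_cancel_right)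
      have "\<Lambda> * ?V \<le> 2 * ?V" unfolding \<Lambda>V using \<tau>V ln(2) by linarith
      then show "\<Lambda> \<le> 2" using V0 by (simp add: mult_le_cancel_right)
    qed
    have \<Lambda>0: "\<Lambda> > 0" using \<Lambda>b(1) \<kappa>(1) by linarith
    have su: "sqrt u \<le> exp (- (K / (8 * real ?D)) * real n ^ ?D)"
    proof (rule real_le_lsqrt)
      have "u = exp (- \<mu>)" using u by (simp add: \<mu>_def ln_div)
      also have "\<dots> \<le> exp (- (K / (4 * real ?D)) * real n ^ ?D)"
        using Kn D by (simp add: field_simps)
      also have "\<dots> = (exp (- (K / (8 * real ?D)) * real n ^ ?D))\<^sup>2"
        by (simp add: power2_eq_square flip: exp_add)
      finally show "u \<le> (exp (- (K / (8 * real ?D)) * real n ^ ?D))\<^sup>2" .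
    qed auto
    have "\<bar>measure P (avoid B (box (nat \<lfloor>root ?D (t / (\<Lambda> * measure P B))\<rfloor> - n))) - exp (- t)\<bar>
        \<le> C * exp (- (\<kappa> / 32) * t) * exp (- (K / (8 * real ?D)) * real n ^ ?D)" if t: "t > 0" for t
    proof -
      define x where "x = root ?D (t / (\<Lambda> * \<rho>))"
      define L where "L = nat \<lfloor>x\<rfloor> - n"
      define q where "q = L div (f + (n + h))"
      have s0: "0 \<le> t / (\<Lambda> * \<rho>)" using t \<Lambda>0 \<rho> by simp
      have x0: "0 \<le> x" unfolding x_def using s0 by simp
      have xD: "x ^ ?D = t / (\<Lambda> * \<rho>)" unfolding x_def using s0 by (intro real_root_pow_pos2) auto
      have L: "real L \<le> x" "x < real (L + n + 1)" unfolding L_def using x0 by linarith+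
      have qL: "q * (f + (n + h)) \<le> L" unfolding q_def by simp
      have tx: "t = \<Lambda> * (x * u ^ 4) ^ ?D"
        unfolding power_mult_distrib power_mult[symmetric] u\<rho> xD using \<Lambda>0 \<rho> by simp
      let ?G = "measure P (avoid B (box L))"
      note bb = avoid_box_bounds[OF B h(1) qL, folded e_def g_def]
      have "\<bar>?G - exp (- t)\<bar> \<le> sqrt (48 * (c1 + 3 * (real ?D * (3 * c + 2))) * (1 + 1 / \<kappa>) / \<kappa>) * exp (- (\<kappa> / 32) * t) * sqrt u"
      proof (rule exponential_law_estimate[where f=f and m="n + h" and n=n and L=L and q=q and \<tau>=\<tau> and e=e and \<Lambda>=\<Lambda> and x=x])
        show "?D \<ge> 1" by (rule D)
        show "c \<ge> 0" "c1 \<ge> 0" using c c1 by auto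
        show "real ?D * (3 * c + 2) * u \<le> 1 / 2"
        proof -
          have "real ?D * (3 * c + 2) > 0" using D c by (intro mult_pos_pos) auto
          then show ?thesis using usm(4) by (simp add: field_simps)
        qed
        show "\<kappa> * (real f ^ ?D * u ^ (4 * ?D)) \<le> \<tau>" unfolding u\<rho> by (rule \<tau>l)
        show "e \<le> real f ^ ?D * u ^ (4 * ?D) * (c1 * u)" unfolding u\<rho> by (rule eV)
        show "\<Lambda> * (real f ^ ?D * u ^ (4 * ?D)) = - ln (1 - \<tau>)" unfolding u\<rho> by (rule \<Lambda>V)
        show "?G \<le> (1 - \<tau> + e) ^ (q ^ ?D)" using bb(1) by (simp add: \<tau>_def)
        show "\<bar>?G - (1 - \<tau>) ^ (q ^ ?D)\<bar> \<le> real q ^ ?D * e + (real L ^ ?D - (real q * real f) ^ ?D) * u ^ (4 * ?D)"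
          unfolding u\<rho> using bb(2) by (simp add: \<tau>_def \<rho>_def)
        show "\<tau> < 1" using \<tau>h by simp
      qed (use u usm(1) \<kappa> nc f L q_def e0 e\<tau> \<Lambda>b tx t in auto)
      also have "\<dots> \<le> C * exp (- (\<kappa> / 32) * t) * exp (- (K / (8 * real ?D)) * real n ^ ?D)"
        unfolding C_def[symmetric] using C by (intro mult_left_mono su) auto
      finally show ?thesis by (simp add: L_def x_def \<rho>_def)
    qed
    then show "\<exists>\<Lambda>. \<kappa> \<le> \<Lambda> \<and> \<Lambda> \<le> 2 \<and> (\<forall>t>0. \<bar>measure P (avoid B (box (nat \<lfloor>root ?D (t / (\<Lambda> * measure P B))\<rfloor> - n))) - exp (- t)\<bar>
        \<le> C * exp (- (\<kappa> / 32) * t) * exp (- (K / (8 * real ?D)) * real n ^ ?D))"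
      using \<Lambda>b by blast
  qed
qed

text \<open>Blocks are single positions here, so one block is avoided with probability exactly 1 -
  P(B), and a fixed corridor keeps the mixing error below P(B)/2. The constants depend on
  \<open>B\<close>, which is harmless for finitely many patterns. The factor 1 in the time scale is
  the value of \<Lambda> for these.\<close>

lemma exponential_tail:
  assumes B: "depends_on (cube n) (B :: 'd config set)" and \<rho>0: "0 < measure P B"
  obtains C c where "0 < C" "0 < c"
    "\<And>t. t > 0 \<Longrightarrow> \<bar>measure P (avoid B (box (nat \<lfloor>root CARD('d) (t / (1 * measure P B))\<rfloor> - n))) - exp (- t)\<bar> \<le> C * exp (- c * t)"
proof -
  let ?D = "CARD('d)" and ?\<rho> = "measure P B"
  have "(\<lambda>h. real (n + 1) ^ ?D * (C1 * exp (- C2 * real h))) \<longlonglongrightarrow> 0"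
    using C2 by real_asymp
  then have "\<forall>\<^sub>F h in sequentially. real (n + 1) ^ ?D * (C1 * exp (- C2 * real h)) < ?\<rho> / 2"
    by (rule order_tendstoD(2)) (use \<rho>0 in simp)
  then obtain h0 where h0: "\<And>h. h \<ge> h0 \<Longrightarrow> real (n + 1) ^ ?D * (C1 * exp (- C2 * real h)) < ?\<rho> / 2"
    by (auto simp: eventually_sequentially)
  define h where "h = Suc h0"
  have h: "h > 0" "real (n + 1) ^ ?D * (C1 * exp (- C2 * real h)) \<le> ?\<rho> / 2"
    using h0[of h] by (auto simp: h_def)
  have box1: "box 1 = {(\<lambda>_. 0) :: 'd site}"
  proof -
    have "0 \<le> a \<and> a < int 1 \<longleftrightarrow> a = 0" for a by auto
    then show ?thesis unfolding box_def by (auto simp: fun_eq_iff)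
  qed
  have "shift (\<lambda>_. 0) \<sigma> = \<sigma>" for \<sigma> :: "'d config" by (simp add: shift_def vadd_def)
  then have "avoid B (box 1) = space P - B" unfolding box1 by (auto simp: avoid_def)
  then have g: "measure P (avoid B (box 1)) = 1 - ?\<rho>"
    using prob_compl[OF depends_on_sets_P[OF finite_cube B]] by simp
  \<comment> \<open>The window side is at most q + 1 enlarged periods, and (q + 1)^d \<le> 2^d (q^d
    + 1); so its volume t / P(B) is at most W (q^d + 1).\<close>
  define W where "W = (2 * real (1 + (n + h) + n + 1)) ^ ?D"
  have W: "W \<ge> 1" unfolding W_def by (intro one_le_power) auto
  show ?thesis
  proof (rule that[of 4 "1 / (2 * W)"])
    show "0 < 1 / (2 * W)" using W by simp
    fix t :: real assume t: "t > 0"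
    define x where "x = root ?D (t / ?\<rho>)"
    define L where "L = nat \<lfloor>x\<rfloor> - n"
    define q where "q = L div (1 + (n + h))"
    have s0: "0 \<le> t / ?\<rho>" using t \<rho>0 by simp
    have x0: "0 \<le> x" unfolding x_def using s0 by simp
    have xD: "x ^ ?D = t / ?\<rho>" unfolding x_def using s0 by (intro real_root_pow_pos2) auto
    have xL: "x < real (L + n + 1)" unfolding L_def using x0 by linarith
    have qL: "q * (1 + (n + h)) \<le> L" unfolding q_def by (rule div_times_less_eq_dividend)
    let ?G = "measure P (avoid B (box L))"
    have "?G \<le> (1 - ?\<rho> + real (n + 1) ^ ?D * (C1 * exp (- C2 * real h))) ^ (q ^ ?D)"
      using avoid_box_bounds(1)[OF B h(1) qL] unfolding g by simp
    also have "\<dots> \<le> (1 - ?\<rho> / 2) ^ (q ^ ?D)"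
      using h(2) prob_le_1[of B] C1 by (intro power_mono) (auto intro!: add_nonneg_nonneg)
    also have "\<dots> \<le> exp (- (?\<rho> / 2)) ^ (q ^ ?D)"
    proof (rule power_mono)
      show "1 - ?\<rho> / 2 \<le> exp (- (?\<rho> / 2))" using exp_ge_add_one_self[of "- (?\<rho> / 2)"] by linarith
      show "0 \<le> 1 - ?\<rho> / 2" using prob_le_1[of B] by linarith
    qed
    also have "\<dots> = exp (real (q ^ ?D) * (- (?\<rho> / 2)))" by (rule exp_of_nat_mult[symmetric])
    also have "\<dots> \<le> exp (1 / 2 - 1 / (2 * W) * t)"
    proof -
      have "L < q * (1 + (n + h)) + (1 + (n + h))"
        unfolding q_def by (metis add.commute add_gr_0 dividend_less_div_times mult.commute zero_less_one)
      then have "L + n + 1 \<le> (q + 1) * (1 + (n + h) + n + 1)" by (simp add: algebra_simps)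
      then have "real (L + n + 1) \<le> real ((q + 1) * (1 + (n + h) + n + 1))" by (simp only: of_nat_le_iff)
      then have "x \<le> real (q + 1) * real (1 + (n + h) + n + 1)" using xL by (simp only: of_nat_mult)
      then have "x ^ ?D \<le> (real (q + 1) * real (1 + (n + h) + n + 1)) ^ ?D" using x0 by (intro power_mono)
      also have "\<dots> = real (q + 1) ^ ?D * real (1 + (n + h) + n + 1) ^ ?D" by (rule power_mult_distrib)
      also have "\<dots> \<le> (2 ^ ?D * (real q ^ ?D + 1)) * real (1 + (n + h) + n + 1) ^ ?D"
      proof (intro mult_right_mono)
        show "real (q + 1) ^ ?D \<le> 2 ^ ?D * (real q ^ ?D + 1)"
        proof (cases "q = 0")
          case True
          have z: "(0 :: real) ^ ?D = 0" by (rule zero_power) simp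
          show ?thesis unfolding True by (simp add: z one_le_power)
        next
          case False
          then have "real (q + 1) ^ ?D \<le> (2 * real q) ^ ?D" by (intro power_mono) auto
          then show ?thesis by (simp add: power_mult_distrib algebra_simps add_increasing)
        qed
      qed simp
      also have "\<dots> = W * (real q ^ ?D + 1)" unfolding W_def power_mult_distrib by (simp only: mult_ac)
      finally have "t / ?\<rho> \<le> W * (real q ^ ?D + 1)" unfolding xD .
      then have "t / W \<le> ?\<rho> * (real q ^ ?D + 1)" using \<rho>0 W by (simp add: field_simps)
      also have "\<dots> = real q ^ ?D * ?\<rho> + ?\<rho>" by (simp add: algebra_simps)
      finally have "real q ^ ?D * ?\<rho> \<ge> t / W - 1" using prob_le_1[of B] by linarith
      then show ?thesis using W by (simp add: field_simps)
    qed
    also have "\<dots> = exp (1 / 2) * exp (- (1 / (2 * W)) * t)" by (simp flip: exp_add)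
    also have "\<dots> \<le> 3 * exp (- (1 / (2 * W)) * t)"
    proof -
      have "exp (1 / 2 :: real) \<le> 1 + 1 / 2 + (1 / 2)\<^sup>2" by (rule exp_bound) auto
      also have "\<dots> \<le> 3" by (simp add: power2_eq_square)
      finally show ?thesis by (intro mult_right_mono) auto
    qed
    finally have "?G \<le> 3 * exp (- (1 / (2 * W)) * t)" .
    moreover have "exp (- t) \<le> exp (- (1 / (2 * W)) * t)"
    proof -
      have "1 / (2 * W) * t \<le> 1 * t" using W t by (intro mult_right_mono) auto
      then show ?thesis by simp
    qed
    moreover have "0 \<le> ?G" by simp
    ultimately have "\<bar>?G - exp (- t)\<bar> \<le> 4 * exp (- (1 / (2 * W)) * t)"
      using exp_gt_zero[of "- t"] by linarith
    then show "\<bar>measure P (avoid B (box (nat \<lfloor>root ?D (t / (1 * ?\<rho>))\<rfloor> - n))) - exp (- t)\<bar> \<le> 4 * exp (- (1 / (2 * W)) * t)"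
      by (simp add: L_def x_def)
  qed simp
qed

lemma approx_ball_pos:
  assumes "0 \<le> \<epsilon>" shows "0 < measure P (approx_ball n \<epsilon> A)"
proof -
  have "cylinder (cube n) A \<subseteq> approx_ball n \<epsilon> A"
  proof
    fix \<sigma> assume "\<sigma> \<in> cylinder (cube n) A"
    then have "Delta (cube n) \<sigma> A = 0" by (simp add: cylinder_def Delta_def)
    then show "\<sigma> \<in> approx_ball n \<epsilon> A" using assms by (simp add: approx_ball_def)
  qed
  then have "measure P (cylinder (cube n) A) \<le> measure P (approx_ball n \<epsilon> A)"
    using depends_on_sets_P[OF finite_cube depends_on_approx_ball] by (intro finite_measure_mono) auto
  then show ?thesis using cylinder_pos[OF finite_cube, of n A] by linarith
qed

lemma exponential_law_good:
  assumes \<alpha>: "0 < \<alpha>" and \<epsilon>: "0 \<le> \<epsilon>"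
  obtains \<Lambda>1 \<Lambda>2 C c K and \<Lambda> :: "nat \<Rightarrow> 'd config \<Rightarrow> real"
  where "0 < \<Lambda>1" "0 < \<Lambda>2" "0 < C" "0 < c" "0 < K"
    "\<And>n A. \<Lambda>1 \<le> \<Lambda> n A \<and> \<Lambda> n A \<le> \<Lambda>2"
    "\<And>t n A. \<lbrakk>t > 0; n \<ge> 1; good n \<epsilon> \<alpha> A\<rbrakk> \<Longrightarrow>
      \<bar>measure P (avoid (approx_ball n \<epsilon> A) (box (nat \<lfloor>root CARD('d) (t / (\<Lambda> n A * measure P (approx_ball n \<epsilon> A)))\<rfloor> - n)))
        - exp (- t)\<bar> \<le> C * exp (- c * t) * exp (- K * real n ^ CARD('d))"
proof -
  let ?D = "CARD('d)" and ?B = "\<lambda>n A. approx_ball n \<epsilon> A :: 'd config set"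
  let ?err = "\<lambda>n A l t. \<bar>measure P (avoid (?B n A) (box (nat \<lfloor>root ?D (t / (l * measure P (?B n A)))\<rfloor> - n))) - exp (- t)\<bar>"
  obtain K0 n0 where K0: "K0 > 0"
    "\<And>n A. n \<ge> n0 \<Longrightarrow> good n \<epsilon> \<alpha> A \<Longrightarrow> measure P (?B n A) \<le> exp (- K0 * real n ^ ?D)"
    using good_ball_small[OF \<alpha>] by blast
  obtain n1 \<kappa> C0 c0 where r: "0 < \<kappa>" "\<kappa> \<le> 1" "0 < C0" "0 < c0"
    "\<And>n B. \<lbrakk>n \<ge> n1; depends_on (cube n) (B :: 'd config set); 0 < measure P B;
      measure P B \<le> exp (- K0 * real n ^ ?D);
      \<And>x. 0 < supnorm x \<Longrightarrow> real_of_int (supnorm x) \<le> \<alpha> * real n \<Longrightarrow> B \<inter> {\<sigma>. shift x \<sigma> \<in> B} = {}\<rbrakk>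
      \<Longrightarrow> \<exists>\<Lambda>. \<kappa> \<le> \<Lambda> \<and> \<Lambda> \<le> 2 \<and> (\<forall>t>0. \<bar>measure P (avoid B (box (nat \<lfloor>root ?D (t / (\<Lambda> * measure P B))\<rfloor> - n)))
           - exp (- t)\<bar> \<le> C0 * exp (- c0 * t) * exp (- (K0 / (8 * real ?D)) * real n ^ ?D))"
    using exponential_law_rare[OF \<alpha> K0(1)] by metis
  define K where "K = K0 / (8 * real ?D)"
  have K: "K > 0" using K0(1) by (simp add: K_def)
  define N where "N = max n0 n1"
  have large: "\<exists>l. \<kappa> \<le> l \<and> l \<le> 2 \<and> (\<forall>t>0. ?err n A l t \<le> C0 * exp (- c0 * t) * exp (- K * real n ^ ?D))"
    if "n \<ge> N" "good n \<epsilon> \<alpha> A" for n A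
    unfolding K_def
  proof (rule r(5))
    show "n \<ge> n1" "measure P (?B n A) \<le> exp (- K0 * real n ^ ?D)" using that K0(2) by (auto simp: N_def)
    show "?B n A \<inter> {\<sigma>. shift x \<sigma> \<in> ?B n A} = {}" if "0 < supnorm x" "real_of_int (supnorm x) \<le> \<alpha> * real n" for x
      using \<open>good n \<epsilon> \<alpha> A\<close> that unfolding good_def shifted_ball_def by blast
  qed (rule depends_on_approx_ball approx_ball_pos[OF \<epsilon>])+
  have "\<forall>n A. \<exists>l. \<kappa> \<le> l \<and> l \<le> 2 \<and> (n \<ge> N \<longrightarrow> good n \<epsilon> \<alpha> A \<longrightarrow> (\<forall>t>0. ?err n A l t \<le> C0 * exp (- c0 * t) * exp (- K * real n ^ ?D)))"
  proof (intro allI)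
    fix n and A :: "'d config"
    show "\<exists>l. \<kappa> \<le> l \<and> l \<le> 2 \<and> (n \<ge> N \<longrightarrow> good n \<epsilon> \<alpha> A \<longrightarrow> (\<forall>t>0. ?err n A l t \<le> C0 * exp (- c0 * t) * exp (- K * real n ^ ?D)))"
    proof (cases "n \<ge> N \<and> good n \<epsilon> \<alpha> A")
      case True
      then show ?thesis using large[of n A] by blast
    next
      case False
      then show ?thesis using r(2) by (intro exI[of _ 1]) auto
    qed
  qed
  then obtain l where l: "\<And>n A. \<kappa> \<le> l n A" "\<And>n A. l n A \<le> 2"
    "\<And>n A t. \<lbrakk>n \<ge> N; good n \<epsilon> \<alpha> A; t > 0\<rbrakk> \<Longrightarrow> ?err n A (l n A) t \<le> C0 * exp (- c0 * t) * exp (- K * real n ^ ?D)"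
    by metis
  have "\<forall>n A. \<exists>C c. 0 < C \<and> 0 < c \<and> (\<forall>t>0. ?err n A 1 t \<le> C * exp (- c * t))"
  proof (intro allI)
    fix n and A :: "'d config"
    obtain C c where "0 < C" "0 < c" "\<And>t. t > 0 \<Longrightarrow> ?err n A 1 t \<le> C * exp (- c * t)"
      using exponential_tail[OF depends_on_approx_ball approx_ball_pos[OF \<epsilon>]] by blast
    then show "\<exists>C c. 0 < C \<and> 0 < c \<and> (\<forall>t>0. ?err n A 1 t \<le> C * exp (- c * t))" by blast
  qed
  then obtain Cs cs where cs: "\<And>n A. 0 < Cs n A" "\<And>n A. 0 < cs n A"
    "\<And>n A t. t > 0 \<Longrightarrow> ?err n A 1 t \<le> Cs n A * exp (- cs n A * t)"
    by metis
  \<comment> \<open>Good patterns vanish off their cube, so this finite set contains all of them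
    with \<open>n < N\<close>.\<close>
  define S where "S = Sigma {..<N} (\<lambda>n. pats n :: 'd config set)"
  have fS: "finite S"
  proof -
    have "pats n = (local_confs (cube n) :: 'd config set)" for n by (auto simp: pats_def local_confs_def)
    then have "finite (pats n :: 'd config set)" for n using finite_local_confs[OF finite_cube] by simp
    then show ?thesis by (auto simp: S_def)
  qed
  \<comment> \<open>The exponential of K N^d compensates the factor exp (- K n^d) that the tail
    bound for \<open>n < N\<close> does not supply.\<close>
  define C where "C = C0 + (\<Sum>(n, A)\<in>S. Cs n A) * exp (K * real N ^ ?D)"
  define c where "c = Min (insert c0 ((\<lambda>(n, A). cs n A) ` S))"
  have sumnn: "0 \<le> (\<Sum>(n, A)\<in>S. Cs n A)" by (intro sum_nonneg) (auto intro: less_imp_le cs(1))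
  have C: "C0 \<le> C" using sumnn by (simp add: C_def)
  have c: "0 < c" "c \<le> c0" unfolding c_def using fS r(4) cs(2) by auto
  \<comment> \<open>The value 1 for small \<open>n\<close> lies in [\<kappa>, 2] because \<kappa> is
    at most 1.\<close>
  define \<Lambda> where "\<Lambda> = (\<lambda>n A. if n \<ge> N then l n A else 1)"
  show ?thesis
  proof (rule that[of \<kappa> 2 C c K \<Lambda>])
    show "0 < C" using r(3) C by linarith
    show "\<kappa> \<le> \<Lambda> n A \<and> \<Lambda> n A \<le> 2" for n A using l r(2) by (simp add: \<Lambda>_def)
    fix t :: real and n and A :: "'d config" assume t: "t > 0" and n: "n \<ge> 1" and g: "good n \<epsilon> \<alpha> A"
    show "?err n A (\<Lambda> n A) t \<le> C * exp (- c * t) * exp (- K * real n ^ ?D)"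
    proof (cases "n \<ge> N")
      case True
      have "?err n A (\<Lambda> n A) t \<le> C0 * exp (- c0 * t) * exp (- K * real n ^ ?D)"
        using l(3)[OF True g t] True by (simp add: \<Lambda>_def)
      also have "\<dots> \<le> C * exp (- c * t) * exp (- K * real n ^ ?D)"
        using C r(3) c(2) t by (intro mult_right_mono mult_mono) auto
      finally show ?thesis .
    next
      case False
      then have S: "(n, A) \<in> S" using g by (simp add: S_def good_def)
      have "?err n A (\<Lambda> n A) t \<le> Cs n A * exp (- cs n A * t)" using cs(3)[OF t] False by (simp add: \<Lambda>_def)
      also have "\<dots> \<le> (\<Sum>(n, A)\<in>S. Cs n A) * exp (- c * t)"
      proof (rule mult_mono)
        show "Cs n A \<le> (\<Sum>(n, A)\<in>S. Cs n A)"
          using member_le_sum[OF S, of "\<lambda>(n, A). Cs n A"] fS cs(1) by (auto intro: less_imp_le)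
        have "c \<le> cs n A" unfolding c_def using fS S by (intro Min_le) auto
        then show "exp (- cs n A * t) \<le> exp (- c * t)" using t by simp
      qed (use sumnn in auto)
      also have "\<dots> \<le> ((\<Sum>(n, A)\<in>S. Cs n A) * exp (K * real N ^ ?D)) * exp (- c * t) * exp (- K * real n ^ ?D)"
      proof -
        have "real n ^ ?D \<le> real N ^ ?D" using False by (intro power_mono) auto
        then have "K * real n ^ ?D \<le> K * real N ^ ?D" using K by (intro mult_left_mono) auto
        then have "1 \<le> exp (K * real N ^ ?D) * exp (- K * real n ^ ?D)" by (simp flip: exp_add)
        then have "(\<Sum>(n, A)\<in>S. Cs n A) * exp (- c * t) * 1
            \<le> (\<Sum>(n, A)\<in>S. Cs n A) * exp (- c * t) * (exp (K * real N ^ ?D) * exp (- K * real n ^ ?D))"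
          using sumnn by (intro mult_left_mono) auto
        then show ?thesis by (simp add: mult_ac)
      qed
      also have "\<dots> \<le> C * exp (- c * t) * exp (- K * real n ^ ?D)"
        using r(3) by (intro mult_right_mono) (auto simp: C_def)
      finally show ?thesis .
    qed
  qed (use r c K in auto)
qed

end

theorem theorem2p6:
  fixes P Q :: "('d::finite) config measure" and \<epsilon>0 :: real
  assumes d2: "CARD('d) \<ge> 2"
    and P_gibbs: "gibbs_measure P" and P_mix: "nonunif_exp_phi_mixing P"
    and Q_gibbs: "gibbs_measure Q" and Q_stat: "stationary Q" and Q_erg: "ergodic Q"
    and R_pos: "\<forall>\<epsilon>\<in>{0..<\<epsilon>0}. \<exists>r>0. (\<lambda>n. rate_distortion_n Q P \<epsilon> n) \<longlonglongrightarrow> ereal r"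
  shows "\<forall>\<alpha> \<epsilon>. 0 < \<alpha> \<and> \<alpha> < 1 \<and> 0 < \<epsilon> \<and> \<epsilon> / \<alpha> < \<epsilon>0 \<longrightarrow>
    (\<exists>\<Lambda>1 \<Lambda>2 C c K \<Lambda>. 0 < \<Lambda>1 \<and> 0 < \<Lambda>2 \<and> 0 < C \<and> 0 < c \<and> 0 < K \<and>
       (\<forall>n A. A \<in> pats n \<longrightarrow> \<Lambda>1 \<le> \<Lambda> n A \<and> \<Lambda> n A \<le> \<Lambda>2) \<and>
       (\<forall>t>0. \<forall>n\<ge>1. AE \<omega> in Q. good n \<epsilon> \<alpha> (pat_of n \<omega>) \<longrightarrow>
          \<bar>measure P {\<sigma> \<in> space P. ereal_of_enat (hit_time n \<epsilon> (pat_of n \<omega>) \<sigma>) >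
               ereal (t / (\<Lambda> n (pat_of n \<omega>) * measure P (approx_ball n \<epsilon> (pat_of n \<omega>))))}
            - exp (- t)\<bar> \<le> C * exp (- c * t) * exp (- K * real n ^ CARD('d))))"
proof (intro allI impI)
  fix \<alpha> \<epsilon> :: real assume "0 < \<alpha> \<and> \<alpha> < 1 \<and> 0 < \<epsilon> \<and> \<epsilon> / \<alpha> < \<epsilon>0"
  then have \<alpha>: "0 < \<alpha>" and \<epsilon>: "0 \<le> \<epsilon>" by auto
  obtain C1 C2 where "stationary_mixing_field P C1 C2"
    using gibbs_mixing_stationary[OF P_gibbs P_mix] .
  then interpret stationary_mixing_field P C1 C2 .
  obtain \<Lambda>1 \<Lambda>2 C c K and \<Lambda> :: "nat \<Rightarrow> 'd config \<Rightarrow> real"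
    where pos: "0 < \<Lambda>1" "0 < \<Lambda>2" "0 < C" "0 < c" "0 < K"
      and \<Lambda>: "\<And>n A. \<Lambda>1 \<le> \<Lambda> n A \<and> \<Lambda> n A \<le> \<Lambda>2"
      and law: "\<And>t n A. \<lbrakk>t > 0; n \<ge> 1; good n \<epsilon> \<alpha> A\<rbrakk> \<Longrightarrow>
        \<bar>measure P (avoid (approx_ball n \<epsilon> A) (box (nat \<lfloor>root CARD('d) (t / (\<Lambda> n A * measure P (approx_ball n \<epsilon> A)))\<rfloor> - n)))
          - exp (- t)\<bar> \<le> C * exp (- c * t) * exp (- K * real n ^ CARD('d))"
    using exponential_law_good[OF \<alpha> \<epsilon>] by blast
  \<comment> \<open>The bound is established for each fixed good pattern and then applied with
    \<open>A = pat_of n \<omega>\<close>.\<close>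
  have "\<bar>measure P {\<sigma> \<in> space P. ereal_of_enat (hit_time n \<epsilon> A \<sigma>) > ereal (t / (\<Lambda> n A * measure P (approx_ball n \<epsilon> A)))}
      - exp (- t)\<bar> \<le> C * exp (- c * t) * exp (- K * real n ^ CARD('d))"
    if "t > 0" "n \<ge> 1" "good n \<epsilon> \<alpha> A" for t n A
  proof -
    have "0 < \<Lambda> n A" using \<Lambda>[of n A] pos(1) by linarith
    then have "0 \<le> t / (\<Lambda> n A * measure P (approx_ball n \<epsilon> A))" using that(1) by simp
    from hit_time_gt_iff[OF that(2) this, of \<epsilon> A] law[OF that] show ?thesis by simp
  qed
  with pos \<Lambda> show "\<exists>\<Lambda>1 \<Lambda>2 C c K \<Lambda>. 0 < \<Lambda>1 \<and> 0 < \<Lambda>2 \<and> 0 < C \<and> 0 < c \<and> 0 < K \<and>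
       (\<forall>n A. A \<in> pats n \<longrightarrow> \<Lambda>1 \<le> \<Lambda> n A \<and> \<Lambda> n A \<le> \<Lambda>2) \<and>
       (\<forall>t>0. \<forall>n\<ge>1. AE \<omega> in Q. good n \<epsilon> \<alpha> (pat_of n \<omega>) \<longrightarrow>
          \<bar>measure P {\<sigma> \<in> space P. ereal_of_enat (hit_time n \<epsilon> (pat_of n \<omega>) \<sigma>) >
               ereal (t / (\<Lambda> n (pat_of n \<omega>) * measure P (approx_ball n \<epsilon> (pat_of n \<omega>))))}
            - exp (- t)\<bar> \<le> C * exp (- c * t) * exp (- K * real n ^ CARD('d)))"
    by (intro exI[of _ \<Lambda>1] exI[of _ \<Lambda>2] exI[of _ C] exI[of _ c] exI[of _ K] exI[of _ \<Lambda>]) auto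
qed

end
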